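(* Let $n\ge2$, $N\ge n$ and let $(\mathcal T_0,\mathfrak c)$ be an $(N{+}1)$-colored initial triangulation in $\mathbb R^n$. Then: (i) For every $\mathcal T\in\mathbb B$ and every $T\in\mathcal T$, the recursive procedure $\mathrm{Refine}(\mathcal T,T)$ terminates. (ii) For each $T_0\in\mathcal T_0$ the descendants of $T_0$ in $\mathbb T$ fall into at most $n!\,n\,2^{n-2}$ similarity classes, and $\gamma(T)\le C_{sr}\,\gamma(T_0)$ for all $T\in\mathbb T$ with ancestor $T_0\in\mathcal T_0$, where $C_{sr}=2n(n+\sqrt2-1)$. (iii) Consecutive uniform full refinements of $\mathcal T_0$ (each consisting of $n$ successive bisections of all simplices) are conforming triangulations. (iv) $(\mathbb B,\vee,\wedge)$ is a distributive lattice, where $\mathcal T_1\vee\mathcal T_2$ is the coarsest common refinement and $\mathcal T_1\wedge\mathcal T_2$ the finest common coarsening of $\mathcal T_1,\mathcal T_2$.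
   Context: An $n$-simplex is the convex hull of $n+1$ affinely independent points of $\mathbb R^n$; an $m$-subsimplex is the convex hull of $m+1$ of its vertices. A (conforming) triangulation is a finite set of closed $n$-simplices with pairwise disjoint interiors such that any two intersect in the empty set or a common subsimplex. An $(N{+}1)$-colored triangulation is a triangulation $\mathcal T_0$ of a polyhedral domain with a map $\mathfrak c:\mathcal V(\mathcal T_0)\to\{0,\dots,N\}$ ($\mathcal V$ = vertices), $N\ge n$, such that vertices of each $T\in\mathcal T_0$ have distinct colors. Generations: every vertex $v$ has an integer generation $g(v)$, with level $\ell(v)\in\mathbb Z$ and type $t(v)\in\{1,\dots,N\}$ defined by $g(v)=N(\ell(v)-1)+t(v)$; initial vertices have $g(v)=-\mathfrak c(v)$. Write an arising $n$-simplex as $T=[v_0,\dots,v_n]$ with $g(v_0)>\dots>g(v_n)$. Bisection rule: if $\ell(v_n)\ne\ell(v_{n-1})$, bisection edge $\mathrm{bse}(T)=[v_{n-1},v_n]$ and the midpoint $\mathrm{bsv}(T)$ gets generation $g(v_{n-1})+N$; otherwise with $j=\min\{k:\ell(v_k)=\ell(v_n)\}$, $\mathrm{bse}(T)=[v_j,v_n]$ and $g(\mathrm{bsv}(T))=g(v_n)+2N+1-t(v_j)$. The two children of $T$ with $\mathrm{bse}(T)=[a,b]$ are obtained by replacing $a$, resp. $b$, by the midpoint. $\mathrm{Refine}(\mathcal T,T)$: let $e=\mathrm{bse}(T)$ and $\omega(e)$ the simplices of $\mathcal T$ containing the edge $e$; if some $T'\in\omega(e)$ has $\mathrm{bse}(T')\ne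 e$, return $\mathrm{Refine}(\mathrm{Refine}(\mathcal T,T'),T)$; otherwise replace every simplex in $\omega(e)$ by its two children. $\mathbb B$ is the set of triangulations obtained from $\mathcal T_0$ by finitely many such refinements; $\mathbb T$ the set of all simplices occurring in elements of $\mathbb B$. For a simplex $S$, $\gamma(S)=R(S)/r(S)$, with $R(S)$ the diameter of the smallest ball containing $S$ and $r(S)$ the diameter of the largest ball contained in $S$. *)

theory Defs
  imports "HOL-Analysis.Analysis"
begin

text \<open>Vertices of arising simplices carry their generation: a tagged vertex is a
pair (point, generation). An arising n-simplex is a set of n+1 tagged vertices.\<close>

type_synonym 'n vert = "(real^'n) \<times> int"
type_synonym 'n tsimplex = "'n vert set"

text \<open>g = N (l - 1) + t with t in {1..N}.\<close>
definition level :: "nat \<Rightarrow> int \<Rightarrow> int" where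
  "level N g = (g - 1) div int N + 1"

definition vtype :: "nat \<Rightarrow> int \<Rightarrow> int" where
  "vtype N g = (g - 1) mod int N + 1"

definition gen_list :: "'n tsimplex \<Rightarrow> int list" where
  "gen_list T = rev (sorted_list_of_set (snd ` T))"

definition vtx :: "'n tsimplex \<Rightarrow> nat \<Rightarrow> 'n vert" where
  "vtx T k = (THE v. v \<in> T \<and> snd v = gen_list T ! k)"

text \<open>Bisection data: (a, b, g) where bse(T) = [a,b] and g is the generation of bsv(T).\<close>
definition bis_data :: "nat \<Rightarrow> ('n::finite) tsimplex \<Rightarrow> 'n vert \<times> 'n vert \<times> int" where
  "bis_data N T =
     (let n = CARD('n); v = vtx T; g = (\<lambda>k. snd (v k)); l = (\<lambda>k. level N (g k)) in
      if l n \<noteq> l (n - 1) then (v (n - 1), v n, g (n - 1) + int N)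
      else (let j = (LEAST k. l k = l n) in
            (v j, v n, g n + 2 * int N + 1 - vtype N (g j))))"

definition bse_a :: "nat \<Rightarrow> ('n::finite) tsimplex \<Rightarrow> 'n vert" where
  "bse_a N T = fst (bis_data N T)"

definition bse_b :: "nat \<Rightarrow> ('n::finite) tsimplex \<Rightarrow> 'n vert" where
  "bse_b N T = fst (snd (bis_data N T))"

definition bse_pts :: "nat \<Rightarrow> ('n::finite) tsimplex \<Rightarrow> (real^'n) set" where
  "bse_pts N T = {fst (bse_a N T), fst (bse_b N T)}"

definition bsv :: "nat \<Rightarrow> ('n::finite) tsimplex \<Rightarrow> 'n vert" where
  "bsv N T = ((1/2) *\<^sub>R (fst (bse_a N T) + fst (bse_b N T)), snd (snd (bis_data N T)))"

definition children :: "nat \<Rightarrow> ('n::finite) tsimplex \<Rightarrow> 'n tsimplex set" where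
  "children N T = {insert (bsv N T) (T - {bse_a N T}), insert (bsv N T) (T - {bse_b N T})}"

definition descendant :: "nat \<Rightarrow> ('n::finite) tsimplex \<Rightarrow> 'n tsimplex \<Rightarrow> bool" where
  "descendant N = (\<lambda>T T'. T' \<in> children N T)\<^sup>*\<^sup>*"

definition omega :: "('n::finite) tsimplex set \<Rightarrow> (real^'n) set \<Rightarrow> 'n tsimplex set" where
  "omega \<T> E = {T' \<in> \<T>. E \<subseteq> fst ` T'}"

text \<open>Big-step semantics of the recursive procedure Refine (all possible choices of T').\<close>
inductive refine_run :: "nat \<Rightarrow> ('n::finite) tsimplex set \<Rightarrow> 'n tsimplex \<Rightarrow> 'n tsimplex set \<Rightarrow> bool"
  for N where
  split: "(\<forall>T'\<in>omega \<T> (bse_pts N T). bse_pts N T' = bse_pts N T) \<Longrightarrow>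
    refine_run N \<T> T ((\<T> - omega \<T> (bse_pts N T)) \<union> \<Union> (children N ` omega \<T> (bse_pts N T)))"
| recurse: "T' \<in> omega \<T> (bse_pts N T) \<Longrightarrow> bse_pts N T' \<noteq> bse_pts N T \<Longrightarrow>
    refine_run N \<T> T' \<T>1 \<Longrightarrow> refine_run N \<T>1 T \<T>2 \<Longrightarrow> refine_run N \<T> T \<T>2"

text \<open>Termination of Refine(T,T): every execution of the recursion terminates (the
recursive call for every admissible choice of T' terminates, and so does the outer call
on every possible result).\<close>
inductive refine_terminates :: "nat \<Rightarrow> ('n::finite) tsimplex set \<Rightarrow> 'n tsimplex \<Rightarrow> bool"
  for N where
  "(\<forall>T'\<in>omega \<T> (bse_pts N T). bse_pts N T' \<noteq> bse_pts N T \<longrightarrow>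
      refine_terminates N \<T> T' \<and>
      (\<forall>\<T>1. refine_run N \<T> T' \<T>1 \<longrightarrow> refine_terminates N \<T>1 T))
   \<Longrightarrow> refine_terminates N \<T> T"

definition init_tag :: "((real^'n) \<Rightarrow> nat) \<Rightarrow> (real^'n) set \<Rightarrow> 'n tsimplex" where
  "init_tag c S = (\<lambda>v. (v, - int (c v))) ` S"

inductive_set BB :: "nat \<Rightarrow> ('n::finite) tsimplex set \<Rightarrow> 'n tsimplex set set"
  for N \<T>0 where
  base: "\<T>0 \<in> BB N \<T>0"
| step: "\<T> \<in> BB N \<T>0 \<Longrightarrow> T \<in> \<T> \<Longrightarrow> refine_run N \<T> T \<T>' \<Longrightarrow> \<T>' \<in> BB N \<T>0"

definition TT :: "nat \<Rightarrow> ('n::finite) tsimplex set \<Rightarrow> 'n tsimplex set" where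
  "TT N \<T>0 = \<Union> (BB N \<T>0)"

definition refines :: "nat \<Rightarrow> ('n::finite) tsimplex set \<Rightarrow> 'n tsimplex set \<Rightarrow> bool" where
  "refines N \<T>2 \<T>1 \<longleftrightarrow> (\<forall>T\<in>\<T>2. \<exists>T'\<in>\<T>1. descendant N T' T)"

definition bisect_all :: "nat \<Rightarrow> ('n::finite) tsimplex set \<Rightarrow> 'n tsimplex set" where
  "bisect_all N \<T> = \<Union> (children N ` \<T>)"

definition geom :: "('n::finite) tsimplex set \<Rightarrow> (real^'n) set set" where
  "geom \<T> = (\<lambda>T. fst ` T) ` \<T>"

definition conforming_triangulation :: "(real^('n::finite)) set set \<Rightarrow> bool" where
  "conforming_triangulation \<S> \<longleftrightarrow>
     finite \<S> \<and>
     (\<forall>S\<in>\<S>. finite S \<and> card S = CARD('n) + 1 \<and> \<not> affine_dependent S) \<and>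
     (\<forall>S\<in>\<S>. \<forall>S'\<in>\<S>. S \<noteq> S' \<longrightarrow>
        interior (convex hull S) \<inter> interior (convex hull S') = {}) \<and>
     (\<forall>S\<in>\<S>. \<forall>S'\<in>\<S>. convex hull S \<inter> convex hull S' = {} \<or>
        (\<exists>W. W \<noteq> {} \<and> W \<subseteq> S \<inter> S' \<and> convex hull S \<inter> convex hull S' = convex hull W))"

definition similar :: "(real^'n) set \<Rightarrow> (real^'n) set \<Rightarrow> bool" where
  "similar A B \<longleftrightarrow> (\<exists>f k. k > 0 \<and> (\<forall>x y. dist (f x) (f y) = k * dist x y) \<and> f ` A = B)"

definition circ_diam :: "(real^'n) set \<Rightarrow> real" where
  "circ_diam S = 2 * Inf {r. \<exists>c. S \<subseteq> cball c r}"

definition in_diam :: "(real^'n) set \<Rightarrow> real" where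
  "in_diam S = 2 * Sup {r. r \<ge> 0 \<and> (\<exists>c. cball c r \<subseteq> S)}"

definition shape_gamma :: "(real^'n) set \<Rightarrow> real" where
  "shape_gamma S = circ_diam S / in_diam S"

end

theory Submission
  imports Defs
begin

text \<open>
  The generation of the midpoint of an edge is a function \<open>mid\<close> of the generations of its two
  endpoints, and the bisection edge of a simplex is its unique edge with the smallest value of
  \<open>mid\<close>. Hence simplices sharing an edge agree on when to bisect it: a recursive call of the
  refinement procedure has a strictly smaller bisection generation, which gives termination, and
  bisecting the whole forest in the order of these generations keeps all simplices face-to-face.
  The elements of \<open>BB\<close> correspond to the finite sets of bisected simplices that are closed under
  parents and under sharing a bisection edge. Such sets are closed under union and intersection,
  which makes \<open>BB\<close> a distributive lattice.

  If the vertices are arranged as in Maubach's algorithm, every descendant is, up to translation and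
  scaling, determined by a number \<open>k\<close> in \<open>{1..n}\<close> and a signed permutation of the edge vectors of
  the initial simplex. Counting them up to congruence gives the number of similarity classes.
\<close>

section \<open>Generations along Maubach's vertex order\<close>

text \<open>The definitions of \<open>omega\<close> and \<open>refine_run\<close> compare bare
  points, while every argument about bisection edges uses vertices together with their generations.
  The bridge is that a point carries only one generation in the whole forest
  (\<open>tag_unique\<close>). The bisection rule does not show this, since one point could be the
  midpoint of several edges; it is a consequence of conformity. Conformity is therefore proved first
  for the partitions \<open>uniform m\<close>, in which exactly the simplices with bisection
  generation at most \<open>m\<close> are bisected. It is then carried over to the leaves of an
  arbitrary closed set by comparing a leaf \<open>T\<close> with the uniform partition just before
  \<open>gm N T\<close>. The shape constant arises as \<open>2 * n * n\<close>: a ball of radius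
  \<open>r\<close> around the initial simplex yields one of radius \<open>h * n * r\<close> around a
  descendant of scale \<open>h\<close>, and a ball of radius \<open>r\<close> inside the initial
  simplex yields one of radius \<open>h / (2 * n) * r\<close> inside the descendant. The quotient of
  the two factors is at most the stated constant.\<close>

definition mid :: "nat \<Rightarrow> int \<Rightarrow> int \<Rightarrow> int" where
  "mid N g g' = (if level N g = level N g' then int N * (level N g + 1) + 1 - \<bar>g - g'\<bar>
     else max g g' + int N)"

lemma level_eq_iff:
  assumes "N > 0"
  shows "level N g = L \<longleftrightarrow> int N * L - int N < g \<and> g \<le> int N * L"
proof
  have d: "g - 1 = int N * ((g - 1) div int N) + (g - 1) mod int N" by simp
  have r: "0 \<le> (g - 1) mod int N" "(g - 1) mod int N < int N" using assms by auto
  assume "level N g = L"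
  then have "(g - 1) div int N = L - 1" by (simp add: level_def)
  with d have "g - 1 = int N * (L - 1) + (g - 1) mod int N" by simp
  with r show "int N * L - int N < g \<and> g \<le> int N * L" by (simp add: algebra_simps)
next
  assume a: "int N * L - int N < g \<and> g \<le> int N * L"
  have "(g - 1) div int N = L - 1"
    by (rule int_div_pos_eq[where r = "g - 1 - int N * (L - 1)"]) (use a in \<open>auto simp: algebra_simps\<close>)
  then show "level N g = L" by (simp add: level_def)
qed

lemma vtype_eq: "vtype N g = g - int N * (level N g - 1)"
  by (simp add: vtype_def level_def minus_div_mult_eq_mod[symmetric] mult.commute)

lemma mid_commute: "mid N g g' = mid N g' g"
  by (simp add: mid_def max.commute abs_minus_commute)

lemma mid_same:
  assumes "N > 0" "M = int N * L" "M - int N < g" "g \<le> M" "M - int N < g'" "g' \<le> M"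
  shows "mid N g g' = M + int N + 1 - \<bar>g - g'\<bar>"
proof -
  have "level N g = L" "level N g' = L" using assms by (simp_all add: level_eq_iff)
  then show ?thesis using assms by (simp add: mid_def algebra_simps)
qed

text \<open>Levels end at the multiples of \<open>N\<close>, so a multiple \<open>M\<close> between
  \<open>g\<close> and \<open>g'\<close> certifies different levels. The callers take for
  \<open>M\<close> the top or the bottom of level \<open>L\<close>.\<close>

lemma mid_diff:
  assumes "N > 0" "M = int N * L" "g \<le> M" "M < g'"
  shows "mid N g g' = g' + int N"
proof -
  have "level N g \<noteq> level N g'"
  proof
    assume e: "level N g = level N g'"
    define l where "l = level N g"
    have "int N * l - int N < g" "g' \<le> int N * l"
      using level_eq_iff[OF assms(1), of g l] level_eq_iff[OF assms(1), of g' l] e l_def by auto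
    then have "int N * l - int N < int N * L" "int N * L < int N * l" using assms by linarith+
    then have "int N * (l - 1) < int N * L" "int N * L < int N * l" by (auto simp: algebra_simps)
    then have "l - 1 < L" "L < l" using assms(1) by auto
    then show False by simp
  qed
  then show ?thesis using assms by (simp add: mid_def)
qed

text \<open>
  The order of the \<open>n + 1\<close> vertices before a bisection of the edge from vertex \<open>0\<close> to vertex \<open>k\<close>:
  vertices \<open>1..k\<close> have level \<open>L\<close>, the later ones level \<open>L + 1\<close>, each block by decreasing generation,
  and vertex \<open>0\<close> is either the youngest of level \<open>L\<close> or of lower level. The last clause keeps the
  block of level \<open>L + 1\<close> decreasing when the new vertex is put at position \<open>k\<close>.
\<close>

definition mgen :: "nat \<Rightarrow> nat \<Rightarrow> int \<Rightarrow> nat \<Rightarrow> (nat \<Rightarrow> int) \<Rightarrow> bool" where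
  "mgen N n L k g \<longleftrightarrow> 1 \<le> k \<and> k \<le> n \<and>
     (\<forall>i. 1 \<le> i \<longrightarrow> i \<le> k \<longrightarrow> int N * L - int N < g i \<and> g i \<le> int N * L) \<and>
     (\<forall>i. k < i \<longrightarrow> i \<le> n \<longrightarrow> int N * L < g i \<and> g i \<le> int N * L + int N) \<and>
     g 0 \<le> int N * L \<and>
     (\<forall>i j. 1 \<le> i \<longrightarrow> i < j \<longrightarrow> j \<le> k \<longrightarrow> g j < g i) \<and>
     (\<forall>i j. k < i \<longrightarrow> i < j \<longrightarrow> j \<le> n \<longrightarrow> g j < g i) \<and>
     (int N * L - int N < g 0 \<longrightarrow> g 1 < g 0) \<and>
     (k < n \<longrightarrow> g (Suc k) < mid N (g 0) (g k))"

lemma mgenD: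
  assumes "mgen N n L k g"
  shows "1 \<le> k" "k \<le> n"
    "\<And>i. 1 \<le> i \<Longrightarrow> i \<le> k \<Longrightarrow> int N * L - int N < g i"
    "\<And>i. 1 \<le> i \<Longrightarrow> i \<le> k \<Longrightarrow> g i \<le> int N * L"
    "\<And>i. k < i \<Longrightarrow> i \<le> n \<Longrightarrow> int N * L < g i"
    "\<And>i. k < i \<Longrightarrow> i \<le> n \<Longrightarrow> g i \<le> int N * L + int N"
    "g 0 \<le> int N * L"
    "\<And>i j. 1 \<le> i \<Longrightarrow> i < j \<Longrightarrow> j \<le> k \<Longrightarrow> g j < g i"
    "\<And>i j. k < i \<Longrightarrow> i < j \<Longrightarrow> j \<le> n \<Longrightarrow> g j < g i"
    "int N * L - int N < g 0 \<Longrightarrow> g 1 < g 0"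
    "k < n \<Longrightarrow> g (Suc k) < mid N (g 0) (g k)"
  using assms unfolding mgen_def by blast+

text \<open>The two cases are the two branches of the bisection rule: vertex \<open>0\<close> shares
  the level of vertex \<open>k\<close>, or it lies on a lower one.\<close>

lemma mgen_mid:
  assumes N: "N > 0" and g: "mgen N n L k g"
  shows "mid N (g 0) (g k) = (if int N * L - int N < g 0 then int N * L + int N + 1 - (g 0 - g k) else g k + int N)"
proof (cases "int N * L - int N < g 0")
  case True
  have "g k < g 0" using mgenD(10)[OF g True] mgenD(8)[OF g, of 1 k] mgenD(1)[OF g]
    by (cases "k = 1") auto
  then show ?thesis
    using True mid_same[OF N refl True] mgenD(1,2,3,4,7)[OF g] by auto
next
  case False
  then show ?thesis
    using mid_diff[OF N, of "int N * L - int N" "L - 1" "g 0" "g k"] mgenD(1,2,3)[OF g]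
    by (auto simp: algebra_simps)
qed

lemma mgen_0_gt:
  assumes g: "mgen N n L k g" and "int N * L - int N < g 0" "1 \<le> i" "i \<le> k"
  shows "g i < g 0"
  using mgenD(10)[OF g] mgenD(8)[OF g, of 1 i] assms by (cases "i = 1") auto

lemma mgen_k_le:
  assumes g: "mgen N n L k g" and "1 \<le> i" "i \<le> k"
  shows "g k \<le> g i"
  using mgenD(8)[OF g, of i k] assms by (cases "i = k") auto

lemma mgen_mid_bounds:
  assumes N: "N > 0" and g: "mgen N n L k g"
  shows "int N * L < mid N (g 0) (g k)" "mid N (g 0) (g k) \<le> int N * L + int N"
  unfolding mgen_mid[OF N g]
  using mgen_0_gt[OF g, of k] mgenD(1,2,7)[OF g] mgenD(3,4)[OF g, of k] by auto

text \<open>The child that keeps vertex \<open>0\<close>: the midpoint takes place \<open>k\<close>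
  and becomes the youngest vertex of level \<open>L + 1\<close>. Since vertex \<open>k - 1\<close>
  is younger than vertex \<open>k\<close>, the next bisection generation is larger, which is the
  last clause of \<open>mgen\<close> for the child. For \<open>k = 1\<close> the vertices
  \<open>1..n\<close> have all reached level \<open>L + 1\<close>, and vertex \<open>0\<close>
  counts as one of lower level.\<close>

lemma mgen_child_old:
  assumes N: "N > 0" and g: "mgen N n L k g"
  defines "z \<equiv> mid N (g 0) (g k)"
  shows "k > 1 \<Longrightarrow> mgen N n L (k - 1) (g(k := z)) \<and> z < mid N (g 0) (g (k - 1))"
    and "k = 1 \<Longrightarrow> mgen N n (L + 1) n (g(k := z))"
proof -
  note b = mgen_mid_bounds[OF N g, folded z_def]
  note D = mgenD[OF g, folded z_def]
  have up: "z > g j" if "k < j" "j \<le> n" for j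
    using D(9)[of "Suc k" j] D(11) that by (cases "j = Suc k") auto
  {
    assume k: "k > 1"
    have m: "mid N (g 0) (g (k - 1)) > z"
    proof (cases "int N * L - int N < g 0")
      case True
      have "mid N (g 0) (g (k-1)) = int N * L + int N + 1 - \<bar>g 0 - g (k-1)\<bar>"
        by (rule mid_same[OF N refl]) (use k D True in auto)
      moreover have "g (k-1) < g 0" using mgen_0_gt[OF g True] k by auto
      ultimately show ?thesis using mgen_mid[OF N g] True D(8)[of "k-1" k] k by (simp add: z_def)
    next
      case False
      have "mid N (g 0) (g (k-1)) = g (k-1) + int N"
        by (rule mid_diff[OF N, of "int N * L - int N" "L - 1"])
          (use False D k in \<open>auto simp: algebra_simps\<close>)
      then show ?thesis using mgen_mid[OF N g] False D(8)[of "k-1" k] k by (simp add: z_def)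
    qed
    moreover have "mgen N n L (k - 1) (g(k := z))"
      unfolding mgen_def
    proof (intro conjI allI impI)
      fix i j assume "k - 1 < i" "i < j" "j \<le> n"
      then show "(g(k := z)) j < (g(k := z)) i" using D(9)[of i j] up by (cases "i = k") auto
    qed (use D b m k in auto)
    ultimately show "mgen N n L (k - 1) (g(k := z)) \<and> z < mid N (g 0) (g (k - 1))" by simp
  }
  {
    assume k: "k = 1"
    have e: "int N * (L + 1) = int N * L + int N" by (simp add: algebra_simps)
    show "mgen N n (L + 1) n (g(k := z))" unfolding mgen_def e
    proof (intro conjI allI impI)
      fix i j :: nat assume "1 \<le> i" "i < j" "j \<le> n"
      then show "(g(k := z)) j < (g(k := z)) i" using D(9)[of i j] up k by (cases "i = k") auto
    next
      fix i :: nat assume "1 \<le> i" "i \<le> n"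
      then show "int N * L + int N - int N < (g(k := z)) i" "(g(k := z)) i \<le> int N * L + int N"
        using D(5,6)[of i] b k by auto
    qed (use D(1,2,7) b k in auto)
  }
qed

definition shift :: "nat \<Rightarrow> 'a \<Rightarrow> (nat \<Rightarrow> 'a) \<Rightarrow> nat \<Rightarrow> 'a" where
  "shift k z P i = (if i < k then P (Suc i) else if i = k then z else P i)"

text \<open>The child that loses vertex \<open>0\<close>: the old vertex \<open>1\<close>, the
  youngest remaining one of level \<open>L\<close>, takes over as vertex \<open>0\<close>. For
  \<open>k = 1\<close> it is the only vertex left below level \<open>L + 1\<close>.\<close>

lemma mgen_child_new:
  assumes N: "N > 0" and g: "mgen N n L k g"
  defines "z \<equiv> mid N (g 0) (g k)"
  shows "k > 1 \<Longrightarrow> mgen N n L (k - 1) (shift k z g) \<and> z < mid N (g 1) (g k)"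
    and "k = 1 \<Longrightarrow> mgen N n (L + 1) n (shift k z g)"
proof -
  note b = mgen_mid_bounds[OF N g, folded z_def]
  note D = mgenD[OF g, folded z_def]
  have up: "z > g j" if "k < j" "j \<le> n" for j
    using D(9)[of "Suc k" j] D(11) that by (cases "j = Suc k") auto
  {
    assume k: "k > 1"
    have m: "mid N (g 1) (g k) > z"
    proof -
      have e: "mid N (g 1) (g k) = int N * L + int N + 1 - \<bar>g 1 - g k\<bar>"
        by (rule mid_same[OF N refl]) (use k D in auto)
      moreover have "g k < g 1" using D(8) k by auto
      moreover have "g 1 \<le> int N * L" using D k by auto
      ultimately show ?thesis using mgen_mid[OF N g, folded z_def] D(10)
        by (cases "int N * L - int N < g 0") simp_all
    qed
    moreover have "mgen N n L (k - 1) (shift k z g)"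
      unfolding mgen_def
    proof (intro conjI allI impI)
      fix i j assume "k - 1 < i" "i < j" "j \<le> n"
      then show "shift k z g j < shift k z g i" using D(9)[of i j] up k by (cases "i = k") (auto simp: shift_def)
    next
      fix i j assume "1 \<le> i" "i < j" "j \<le> k - 1"
      then show "shift k z g j < shift k z g i" using D(8)[of "Suc i" "Suc j"] k by (auto simp: shift_def)
    qed (use D b m k in \<open>auto simp: shift_def\<close>)
    ultimately show "mgen N n L (k - 1) (shift k z g) \<and> z < mid N (g 1) (g k)" by simp
  }
  {
    assume k: "k = 1"
    have e: "int N * (L + 1) = int N * L + int N" by (simp add: algebra_simps)
    show "mgen N n (L + 1) n (shift k z g)" unfolding mgen_def e
    proof (intro conjI allI impI)
      fix i j :: nat assume "1 \<le> i" "i < j" "j \<le> n"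
      then show "shift k z g j < shift k z g i" using D(9)[of i j] up k
        by (cases "i = k") (auto simp: shift_def)
    next
      fix i :: nat assume "1 \<le> i" "i \<le> n"
      then show "int N * L + int N - int N < shift k z g i" "shift k z g i \<le> int N * L + int N"
        using D(5,6)[of i] b k by (auto simp: shift_def)
    qed (use D(1,2) D(4)[of 1] D(3)[of 1] b k in \<open>auto simp: shift_def\<close>)
  }
qed

text \<open>An edge with an endpoint of level \<open>L + 1\<close> has its midpoint beyond that
  level, whereas the midpoint of the edge from \<open>0\<close> to \<open>k\<close> belongs to it.
  Inside level \<open>L\<close> the value of \<open>mid\<close> falls as the gap of the generations
  grows, and vertex \<open>k\<close> is the oldest vertex of this level; if vertex \<open>0\<close>
  belongs to it, it is the youngest, so the edge from \<open>0\<close> to \<open>k\<close> has the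
  largest gap. If vertex \<open>0\<close> is on a lower level, edges at \<open>0\<close> are ordered
  by their other endpoint.\<close>

lemma mgen_mid_min:
  assumes N: "N > 0" and g: "mgen N n L k g" and ij: "i < j" "j \<le> n" "\<not> (i = 0 \<and> j = k)"
  shows "mid N (g 0) (g k) < mid N (g i) (g j)"
proof -
  note b = mgen_mid_bounds[OF N g]
  note D = mgenD[OF g]
  consider "j > k" | "i > 0" "j \<le> k" | "i = 0" "j < k" using ij by linarith
  then show ?thesis
  proof cases
    case 1
    show ?thesis
    proof (cases "i > k")
      case True
      have "mid N (g i) (g j) = (int N * L + int N) + int N + 1 - \<bar>g i - g j\<bar>"
        by (rule mid_same[OF N, of _ "L + 1"]) (use True 1 ij D(5,6) in \<open>auto simp: algebra_simps\<close>)
      then show ?thesis using b D(5,6)[of i] D(5,6)[of j] True 1 ij by auto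
    next
      case False
      have "mid N (g i) (g j) = g j + int N"
        by (rule mid_diff[OF N refl, of _ L]) (use False 1 ij D(4)[of i] D(5)[of j] D(7) in \<open>cases "i = 0"; auto\<close>)+
      then show ?thesis using b D(5)[of j] 1 ij by auto
    qed
  next
    case 2
    have e: "mid N (g i) (g j) = int N * L + int N + 1 - \<bar>g i - g j\<bar>"
      by (rule mid_same[OF N refl]) (use 2 ij D(3,4) in auto)
    have "g j < g i" using D(8) 2 ij by auto
    moreover have "g k \<le> g j" using mgen_k_le[OF g] 2 ij by auto
    moreover have "g i \<le> int N * L" using D(4) 2 ij by auto
    moreover have "int N * L - int N < g 0 \<Longrightarrow> g i < g 0" using mgen_0_gt[OF g] 2 ij by auto
    ultimately show ?thesis unfolding e mgen_mid[OF N g] by auto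
  next
    case 3
    have lt: "g k < g j" using D(8) 3 ij by auto
    show ?thesis
    proof (cases "int N * L - int N < g 0")
      case True
      have e: "mid N (g i) (g j) = int N * L + int N + 1 - \<bar>g i - g j\<bar>"
        by (rule mid_same[OF N refl]) (use 3 ij D True in auto)
      show ?thesis unfolding e mgen_mid[OF N g] using mgen_0_gt[OF g True, of j] 3 ij lt True by auto
    next
      case False
      have "mid N (g i) (g j) = g j + int N"
        by (rule mid_diff[OF N, of "int N * L - int N" "L - 1"])
          (use False D 3 ij in \<open>auto simp: algebra_simps\<close>)
      then show ?thesis unfolding mgen_mid[OF N g] using False lt by auto
    qed
  qed
qed

lemma mgen_inj: assumes "mgen N n L k g" shows "inj_on g {..n}"
proof (rule linorder_inj_onI)
  fix i j assume ij: "i < j" "i \<in> {..n}" "j \<in> {..n}"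
  note D = mgenD[OF assms]
  consider "i > k" | "i \<le> k" "j > k" | "j \<le> k" "i > 0" | "i = 0" "j \<le> k" using ij by linarith
  then show "g i \<noteq> g j"
  proof cases
    case 1 then show ?thesis using D(9)[of i j] ij by auto
  next
    case 2 then show ?thesis using D(4)[of i] D(7) D(5)[of j] ij by (cases "i = 0") auto
  next
    case 3 then show ?thesis using D(8)[of i j] ij by auto
  next
    case 4 then show ?thesis using mgen_0_gt[OF assms, of j] D(3)[of j] ij by (cases "int N * L - int N < g 0") auto
  qed
qed auto

section \<open>Maubach's order against the decreasing order of the bisection rule\<close>

lemma gen_list_decreasing:
  assumes "\<And>i j. i < j \<Longrightarrow> j \<le> n \<Longrightarrow> snd (V j) < snd (V i)"
  shows "gen_list (V ` {..n}) = map (snd \<circ> V) [0..<Suc n]"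
proof -
  have "sorted_wrt (<) (rev (map (snd \<circ> V) [0..<Suc n]))"
    unfolding sorted_wrt_rev by (simp only: sorted_wrt_map sorted_wrt_iff_nth_less) (use assms in \<open>auto simp del: upt_Suc\<close>)
  then have "sorted_list_of_set (set (rev (map (snd \<circ> V) [0..<Suc n]))) = rev (map (snd \<circ> V) [0..<Suc n])"
    by (subst sorted_list_of_set.idem_if_sorted_distinct) (auto simp: strict_sorted_iff)
  moreover have "set (rev (map (snd \<circ> V) [0..<Suc n])) = snd ` V ` {..n}"
    by (auto simp del: upt_Suc simp: image_comp lessThan_Suc_atMost[symmetric] lessThan_atLeast0)
  ultimately show ?thesis unfolding gen_list_def by (metis rev_rev_ident)
qed

lemma vtx_decreasing:
  assumes "\<And>i j. i < j \<Longrightarrow> j \<le> n \<Longrightarrow> snd (V j) < snd (V i)" "i \<le> n"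
  shows "vtx (V ` {..n}) i = V i"
proof -
  have e: "gen_list (V ` {..n}) ! i = snd (V i)"
    by (subst gen_list_decreasing[of n V]) (use assms in \<open>auto simp del: upt_Suc\<close>)
  have "j = i" if "snd (V j) = snd (V i)" "j \<le> n" for j
  proof (cases i j rule: linorder_cases)
    case less then show ?thesis using assms(1)[of i j] that by simp
  next
    case greater then show ?thesis using assms(1)[of j i] assms(2) that by simp
  qed simp
  then show ?thesis unfolding vtx_def e using assms(2) by (intro the_equality) blast+
qed

text \<open>The rule refers to vertices sorted by decreasing generation. That order arises from
  \<open>P\<close> by moving the block of level \<open>L + 1\<close> to the front and, if vertex
  \<open>0\<close> has a lower level, vertex \<open>0\<close> to the end. The two possible results
  differ only in which endpoint is named first.\<close>

lemma bis_data_state: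
  fixes P :: "nat \<Rightarrow> 'n::finite vert"
  assumes N: "N > 0" and g: "mgen N CARD('n) L k (\<lambda>i. snd (P i))"
  shows "bis_data N (P ` {..CARD('n)}) \<in>
    {(P 0, P k, mid N (snd (P 0)) (snd (P k))), (P k, P 0, mid N (snd (P 0)) (snd (P k)))}"
proof -
  define n where "n = CARD('n)"
  define g' where "g' = (\<lambda>i. snd (P i))"
  note g = g[folded n_def g'_def]
  note D = mgenD[OF g]
  have lev: "level N (g' i) = L" if "1 \<le> i" "i \<le> k" for i
    using that D(3,4)[of i] by (simp add: level_eq_iff[OF N])
  have lev1: "level N (g' i) = L + 1" if "k < i" "i \<le> n" for i
    using that D(5,6)[of i] by (simp add: level_eq_iff[OF N] algebra_simps)
  show ?thesis
  proof (cases "int N * L - int N < g' 0")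
    case True
    have lev0: "level N (g' 0) = L" using True D(7) by (simp add: level_eq_iff[OF N])
    define V where "V i = (if i < n - k then P (k + 1 + i) else P (i - (n - k)))" for i
    have dec: "snd (V j) < snd (V i)" if "i < j" "j \<le> n" for i j
    proof -
      have 1: "g' (k + 1 + j) < g' (k + 1 + i)" if "j < n - k" using D(9) \<open>i < j\<close> that by auto
      have 2: "g' (j - (n-k)) < g' (k + 1 + i)" if "\<not> j < n - k" "i < n - k"
      proof -
        have "int N * L < g' (k + 1 + i)" using D(5)[of "k + 1 + i"] that D(2) by simp
        moreover have "g' (j - (n - k)) \<le> int N * L"
          using D(4)[of "j - (n - k)"] D(7) that \<open>j \<le> n\<close> D(2) by (cases "j = n - k") simp_all
        ultimately show ?thesis by linarith
      qed
      have 3: "g' (j - (n-k)) < g' (i - (n-k))" if "\<not> i < n - k"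
        using D(8)[of "i - (n-k)" "j - (n-k)"] mgen_0_gt[OF g True, of "j - (n-k)"] that \<open>i < j\<close> \<open>j \<le> n\<close> D(2)
        by (cases "i = n - k") auto
      show ?thesis using 1 2 3 \<open>i < j\<close> unfolding V_def g'_def by auto
    qed
    have im: "V ` {..n} = P ` {..n}"
    proof (intro equalityI subsetI)
      fix x assume "x \<in> V ` {..n}"
      then show "x \<in> P ` {..n}" using D(1,2) by (auto simp: V_def)
    next
      fix x assume "x \<in> P ` {..n}"
      then obtain i where i: "i \<le> n" "x = P i" by auto
      show "x \<in> V ` {..n}"
      proof (cases "i \<le> k")
        case True
        then have "x = V (n - k + i)" using i by (simp add: V_def)
        then show ?thesis using True D(2) by auto
      next
        case False
        then have "x = V (i - (k + 1))" using i by (auto simp add: V_def)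
        then show ?thesis using False i by auto
      qed
    qed
    have vt: "vtx (P ` {..n}) i = V i" if "i \<le> n" for i
      using vtx_decreasing[of n V i] dec that im by simp
    have Vn: "V n = P k" "V (n - k) = P 0" using D(1,2) by (auto simp: V_def)
    have Vn1: "V (n - 1) = P (k - 1)" using D(1,2) by (auto simp: V_def)
    have l: "level N (snd (V n)) = L" "level N (snd (V (n - 1))) = L" "level N (snd (V (n - k))) = L"
      using lev[of k] lev[of "k - 1"] lev0 D(1,2) unfolding Vn Vn1 g'_def by (cases "k = 1"; simp)+
    \<comment> \<open>Place \<open>n - k\<close> is the first one after the block of level
      \<open>L + 1\<close>, and vertex \<open>0\<close> stands there.\<close>
    have least: "(LEAST i. level N (snd (vtx (P ` {..n}) i)) = level N (snd (vtx (P ` {..n}) n))) = n - k"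
    proof (rule Least_equality)
      show "level N (snd (vtx (P ` {..n}) (n - k))) = level N (snd (vtx (P ` {..n}) n))"
        using vt l by auto
    next
      fix i assume a: "level N (snd (vtx (P ` {..n}) i)) = level N (snd (vtx (P ` {..n}) n))"
      show "n - k \<le> i"
      proof (rule ccontr)
        assume "\<not> n - k \<le> i"
        then have "level N (snd (V i)) = L + 1" using lev1[of "k + 1 + i"] by (auto simp: V_def g'_def)
        moreover have "level N (snd (V i)) = L" using a vt[of i] vt[of n] \<open>\<not> n - k \<le> i\<close> l by auto
        ultimately show False by simp
      qed
    qed
    have "bis_data N (P ` {..n}) = (P 0, P k, snd (P k) + 2 * int N + 1 - vtype N (snd (P 0)))"
      unfolding bis_data_def n_def[symmetric] Let_def least
      using l vt Vn by (simp)
    \<comment> \<open>Expressing the type of vertex \<open>0\<close> by its generation and its level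
      turns the asymmetric rule into the symmetric formula of \<open>mid\<close>.\<close>
    moreover have "snd (P k) + 2 * int N + 1 - vtype N (snd (P 0)) = mid N (snd (P 0)) (snd (P k))"
      using mgen_mid[OF N g] True lev0 unfolding vtype_eq g'_def by (simp add: algebra_simps)
    ultimately show ?thesis by (simp add: n_def)
  next
    case False
    have lev0: "level N (g' 0) \<noteq> L" using False level_eq_iff[OF N] by auto
    define V where "V i = (if i < n - k then P (k + 1 + i) else if i < n then P (i + 1 - (n - k)) else P 0)" for i
    have dec: "snd (V j) < snd (V i)" if "i < j" "j \<le> n" for i j
    proof -
      have 1: "g' (k + 1 + j) < g' (k + 1 + i)" if "j < n - k" using D(9) \<open>i < j\<close> that by auto
      have 2: "g' (j + 1 - (n-k)) < g' (k + 1 + i)" if "\<not> j < n - k" "i < n - k" "j < n"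
      proof -
        have "int N * L < g' (k + 1 + i)" using D(5)[of "k + 1 + i"] that D(2) by simp
        moreover have "g' (j + 1 - (n - k)) \<le> int N * L"
          using D(4)[of "j + 1 - (n - k)"] that D(2) by simp
        ultimately show ?thesis by linarith
      qed
      have 3: "g' (j + 1 - (n-k)) < g' (i + 1 - (n-k))" if "\<not> i < n - k" "j < n"
        using D(8)[of "i + 1 - (n-k)" "j + 1 - (n-k)"] that \<open>i < j\<close> by auto
      have 4: "g' 0 < g' (k + 1 + i)" if "i < n - k"
      proof -
        have "int N * L < g' (k + 1 + i)" using D(5)[of "k + 1 + i"] that D(2) by simp
        then show ?thesis using False by linarith
      qed
      have 5: "g' 0 < g' (i + 1 - (n - k))" if "\<not> i < n - k" "i < n"
      proof -
        have "int N * L - int N < g' (i + 1 - (n - k))" using D(3)[of "i + 1 - (n - k)"] that D(1,2) by simp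
        then show ?thesis using False by linarith
      qed
      show ?thesis using 1 2 3 4 5 \<open>i < j\<close> \<open>j \<le> n\<close> unfolding V_def g'_def by auto
    qed
    have im: "V ` {..n} = P ` {..n}"
    proof (intro equalityI subsetI)
      fix x assume "x \<in> V ` {..n}"
      then show "x \<in> P ` {..n}" using D(1,2) by (auto simp: V_def)
    next
      fix x assume "x \<in> P ` {..n}"
      then obtain i where i: "i \<le> n" "x = P i" by auto
      consider "i = 0" | "1 \<le> i" "i \<le> k" | "i > k" by linarith
      then show "x \<in> V ` {..n}"
      proof cases
        case 1
        then have "x = V n" using i D(1,2) by (auto simp: V_def)
        then show ?thesis by auto
      next
        case 2
        then have "x = V (n - k + i - 1)" using i D(2) by (auto simp add: V_def)
        then show ?thesis using 2 D(2) by auto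
      next
        case 3
        then have "x = V (i - (k + 1))" using i by (auto simp add: V_def)
        then show ?thesis using 3 i by auto
      qed
    qed
    have vt: "vtx (P ` {..n}) i = V i" if "i \<le> n" for i
      using vtx_decreasing[of n V i] dec that im by simp
    have Vn: "V n = P 0" "V (n - 1) = P k" using D(1,2) by (auto simp: V_def)
    have "level N (snd (P k)) \<noteq> level N (snd (P 0))" using lev0 lev[of k] D(1) by (auto simp: g'_def)
    then have "bis_data N (P ` {..n}) = (P k, P 0, snd (P k) + int N)"
      unfolding bis_data_def n_def[symmetric] Let_def using vt Vn by auto
    moreover have "snd (P k) + int N = mid N (snd (P 0)) (snd (P k))"
      using mgen_mid[OF N g] False unfolding g'_def by simp
    ultimately show ?thesis by (simp add: n_def)
  qed
qed

section \<open>Bisection of tagged simplices\<close>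

definition edge :: "nat \<Rightarrow> ('n::finite) tsimplex \<Rightarrow> 'n tsimplex" where
  "edge N T = {bse_a N T, bse_b N T}"

definition gm :: "nat \<Rightarrow> ('n::finite) tsimplex \<Rightarrow> int" where
  "gm N T = snd (bsv N T)"

lemma bse_pts_edge: "bse_pts N T = fst ` edge N T"
  by (simp add: bse_pts_def edge_def)

lemma maubach_bse:
  fixes P :: "nat \<Rightarrow> 'n::finite vert"
  assumes "N > 0" "mgen N CARD('n) L k (\<lambda>i. snd (P i))"
  shows "{bse_a N (P ` {..CARD('n)}), bse_b N (P ` {..CARD('n)})} = {P 0, P k}"
    and "edge N (P ` {..CARD('n)}) = {P 0, P k}"
    and "bsv N (P ` {..CARD('n)}) =
      ((1/2) *\<^sub>R (fst (P 0) + fst (P k)), mid N (snd (P 0)) (snd (P k)))"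
    and "gm N (P ` {..CARD('n)}) = mid N (snd (P 0)) (snd (P k))"
  using bis_data_state[OF assms]
  by (auto simp: edge_def bsv_def bse_a_def bse_b_def gm_def add.commute)

lemma mgen_inj_vert:
  assumes "mgen N n L k (\<lambda>i. snd (P i))"
  shows "inj_on P {..n}"
  using mgen_inj[OF assms] unfolding inj_on_def by metis

lemma replace_image:
  assumes "inj_on P {..n}" "k \<le> n"
  shows "insert z (P ` {..n} - {P k}) = (P(k := z)) ` {..n}"
proof -
  have "P ` {..n} - {P k} = P ` ({..n} - {k})"
    using assms by (auto dest: inj_onD)
  also have "\<dots> = (P(k := z)) ` ({..n} - {k})" by auto
  finally have "insert z (P ` {..n} - {P k}) = (P(k := z)) ` insert k ({..n} - {k})"
    by (simp only: image_insert fun_upd_same)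
  moreover have "insert k ({..n} - {k}) = {..n}" using assms(2) by auto
  ultimately show ?thesis by (simp only:)
qed

lemma shift_image:
  assumes "inj_on P {..n}" "1 \<le> k" "k \<le> n"
  shows "insert z (P ` {..n} - {P 0}) = shift k z P ` {..n}"
proof (intro equalityI subsetI)
  fix x assume x: "x \<in> insert z (P ` {..n} - {P 0})"
  show "x \<in> shift k z P ` {..n}"
  proof (cases "x = z")
    case True then show ?thesis using assms by (auto simp: shift_def intro!: image_eqI[of _ _ k])
  next
    case False
    then obtain i where i: "i \<le> n" "x = P i" "i \<noteq> 0" using x by auto
    then have "x = shift k z P (if i \<le> k then i - 1 else i)" by (auto simp: shift_def)
    then show ?thesis using i by auto
  qed
next
  fix x assume "x \<in> shift k z P ` {..n}"
  then obtain i where i: "i \<le> n" "x = shift k z P i" by auto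
  have "P j \<noteq> P 0" if "j \<noteq> 0" "j \<le> n" for j using assms(1) that by (auto dest: inj_onD)
  then show "x \<in> insert z (P ` {..n} - {P 0})" using i assms by (auto simp: shift_def split: if_splits)
qed

lemma maubach_children:
  fixes P :: "nat \<Rightarrow> 'n::finite vert"
  assumes "N > 0" "mgen N CARD('n) L k (\<lambda>i. snd (P i))"
  defines "T \<equiv> P ` {..CARD('n)}"
  shows "children N T = {(P(k := bsv N T)) ` {..CARD('n)}, shift k (bsv N T) P ` {..CARD('n)}}"
proof -
  have "bse_a N T = P 0 \<and> bse_b N T = P k \<or> bse_a N T = P k \<and> bse_b N T = P 0"
    using maubach_bse(1)[OF assms(1,2)] unfolding T_def doubleton_eq_iff .
  then have "children N T = {insert (bsv N T) (T - {P k}), insert (bsv N T) (T - {P 0})}"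
    unfolding children_def by (elim disjE conjE) (simp_all only: insert_commute)
  also have "insert (bsv N T) (T - {P k}) = (P(k := bsv N T)) ` {..CARD('n)}" unfolding T_def
    by (rule replace_image[OF mgen_inj_vert[OF assms(2)] mgenD(2)[OF assms(2)]])
  also have "insert (bsv N T) (T - {P 0}) = shift k (bsv N T) P ` {..CARD('n)}" unfolding T_def
    by (rule shift_image[OF mgen_inj_vert[OF assms(2)] mgenD(1,2)[OF assms(2)]])
  finally show ?thesis .
qed

text \<open>\<open>k\<close> is the number of successive bisections after which the index
  \<open>L\<close> grows by one.\<close>

definition maubach :: "nat \<Rightarrow> int \<Rightarrow> nat \<Rightarrow> ('n::finite) tsimplex \<Rightarrow> bool" where
  "maubach N L k T \<longleftrightarrow> (\<exists>P. T = P ` {..CARD('n)} \<and> mgen N CARD('n) L k (\<lambda>i. snd (P i)))"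

text \<open>For \<open>k > 1\<close> the growth of \<open>gm\<close> is the inequality supplied by
  \<open>mgen_child_old\<close> and \<open>mgen_child_new\<close>. For \<open>k = 1\<close> it
  follows from the bounds alone: \<open>gm N T\<close> is at most the top of level
  \<open>L + 1\<close>, and \<open>gm N C\<close> lies above it.\<close>

lemma maubach_child:
  fixes T :: "('n::finite) tsimplex"
  assumes N: "N > 0" and T: "maubach N L k T" and C: "C \<in> children N T"
  shows "if k > 1 then maubach N L (k - 1) C else maubach N (L + 1) CARD('n) C"
    and "gm N T < gm N C"
proof -
  obtain P where P: "T = P ` {..CARD('n)}" "mgen N CARD('n) L k (\<lambda>i. snd (P i))"
    using T unfolding maubach_def by auto
  define g where "g = (\<lambda>i. snd (P i))"
  define z where "z = bsv N T"
  note g = P(2)[folded g_def]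
  note D = mgenD[OF g]
  have z: "snd z = mid N (g 0) (g k)" using maubach_bse[OF N P(2)] P(1) by (simp add: z_def g_def)
  have gmT: "gm N T = mid N (g 0) (g k)" using maubach_bse[OF N P(2)] P(1) by (simp add: g_def)
  consider "C = (P(k := z)) ` {..CARD('n)}" | "C = shift k z P ` {..CARD('n)}"
    using maubach_children[OF N P(2)] C P(1) z_def by auto
  then have "(if k > 1 then maubach N L (k - 1) C else maubach N (L + 1) CARD('n) C) \<and> gm N T < gm N C"
  proof cases
    case 1
    note c = mgen_child_old[OF N g, folded z]
    have e: "(\<lambda>i. snd ((P(k := z)) i)) = g(k := snd z)" by (auto simp: g_def)
    show ?thesis
    proof (cases "k > 1")
      case True
      then have "k - 1 \<noteq> k" by simp
      have m: "mgen N CARD('n) L (k - 1) (\<lambda>i. snd ((P(k := z)) i))"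
        "snd z < mid N (g 0) (g (k - 1))" using c(1)[OF True] unfolding e by auto
      have "gm N C = mid N (g 0) (g (k - 1))" unfolding 1 maubach_bse(4)[OF N m(1)]
        using \<open>k - 1 \<noteq> k\<close> True by (simp add: g_def)
      moreover have "maubach N L (k - 1) C" unfolding maubach_def using 1 m(1) by blast
      ultimately show ?thesis using True m(2) gmT z by simp
    next
      case False
      then have k: "k = 1" using D(1) by simp
      have m: "mgen N CARD('n) (L + 1) CARD('n) (\<lambda>i. snd ((P(k := z)) i))"
        using c(2) k unfolding e by auto
      have "gm N C > int N * (L + 1)"
        using mgen_mid_bounds[OF N m] unfolding 1 maubach_bse(4)[OF N m] by simp
      moreover have "gm N T \<le> int N * (L + 1)" using mgen_mid_bounds[OF N g] gmT by (simp add: algebra_simps)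
      moreover have "maubach N (L + 1) CARD('n) C" unfolding maubach_def using 1 m by blast
      ultimately show ?thesis using k by simp
    qed
  next
    case 2
    note c = mgen_child_new[OF N g, folded z]
    have e: "(\<lambda>i. snd (shift k z P i)) = shift k (snd z) g" by (auto simp: g_def shift_def)
    show ?thesis
    proof (cases "k > 1")
      case True
      then have m: "mgen N CARD('n) L (k - 1) (\<lambda>i. snd (shift k z P i))"
        "snd z < mid N (g 1) (g k)" using c(1) unfolding e by auto
      have "gm N C = mid N (g 1) (g k)" unfolding 2 maubach_bse(4)[OF N m(1)]
        using True by (simp add: g_def shift_def)
      moreover have "maubach N L (k - 1) C" unfolding maubach_def using 2 m(1) by blast
      ultimately show ?thesis using True m(2) gmT z by simp
    next
      case False
      then have k: "k = 1" using D(1) by simp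
      have m: "mgen N CARD('n) (L + 1) CARD('n) (\<lambda>i. snd (shift k z P i))"
        using c(2) k unfolding e by auto
      have "gm N C > int N * (L + 1)"
        using mgen_mid_bounds[OF N m] unfolding 2 maubach_bse(4)[OF N m] by simp
      moreover have "gm N T \<le> int N * (L + 1)" using mgen_mid_bounds[OF N g] gmT by (simp add: algebra_simps)
      moreover have "maubach N (L + 1) CARD('n) C" unfolding maubach_def using 2 m by blast
      ultimately show ?thesis using k by simp
    qed
  qed
  then show "if k > 1 then maubach N L (k - 1) C else maubach N (L + 1) CARD('n) C" "gm N T < gm N C"
    by auto
qed

lemma maubach_edge:
  fixes T :: "('n::finite) tsimplex"
  assumes N: "N > 0" and T: "maubach N L k T"
  shows "bse_a N T \<in> T" "bse_b N T \<in> T" "bse_a N T \<noteq> bse_b N T"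
    "int N * L < gm N T" "gm N T \<le> int N * L + int N"
    "gm N T = mid N (snd (bse_a N T)) (snd (bse_b N T))"
    "\<And>u v. u \<in> T \<Longrightarrow> v \<in> T \<Longrightarrow> u \<noteq> v \<Longrightarrow> {u, v} \<noteq> edge N T \<Longrightarrow> gm N T < mid N (snd u) (snd v)"
    "\<And>v. v \<in> T \<Longrightarrow> snd v < gm N T"
proof -
  obtain P where P: "T = P ` {..CARD('n)}" "mgen N CARD('n) L k (\<lambda>i. snd (P i))"
    using T unfolding maubach_def by auto
  note M = maubach_bse[OF N P(2), folded P(1)]
  note D = mgenD[OF P(2)]
  have ne: "P 0 \<noteq> P k" using mgen_inj_vert[OF P(2)] D(1,2) by (auto dest: inj_onD)
  show "bse_a N T \<in> T" "bse_b N T \<in> T" "bse_a N T \<noteq> bse_b N T"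
    "gm N T = mid N (snd (bse_a N T)) (snd (bse_b N T))"
    using M ne P(1) D(1,2) by (auto simp: doubleton_eq_iff mid_commute)
  show b: "int N * L < gm N T" "gm N T \<le> int N * L + int N" using mgen_mid_bounds[OF N P(2)] M(4) by auto
  show "gm N T < mid N (snd u) (snd v)" if uv: "u \<in> T" "v \<in> T" "u \<noteq> v" "{u, v} \<noteq> edge N T" for u v
  proof -
    obtain i j where ij: "i \<le> CARD('n)" "j \<le> CARD('n)" "u = P i" "v = P j" using uv P(1) by auto
    then have "i \<noteq> j" using uv by auto
    then consider "i < j" | "j < i" by linarith
    then show ?thesis
    proof cases
      case 1
      have "\<not> (i = 0 \<and> j = k)" using ij uv(4) M(2) by auto
      then show ?thesis using mgen_mid_min[OF N P(2) 1 ij(2)] ij M(4) by simp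
    next
      case 2
      have "\<not> (j = 0 \<and> i = k)" using ij uv(4) M(2) by auto
      then show ?thesis using mgen_mid_min[OF N P(2) 2 ij(1)] ij M(4) by (simp add: mid_commute)
    qed
  qed
  show "snd v < gm N T" if v: "v \<in> T" for v
  proof -
    obtain i where i: "i \<le> CARD('n)" "v = P i" using v P(1) by auto
    show ?thesis
    proof (cases "i \<le> k")
      case True
      then have "snd (P i) \<le> int N * L" using D(4)[of i] D(7) by (cases "i = 0") auto
      then show ?thesis using b i by simp
    next
      case False
      then have "snd (P i) \<le> snd (P (Suc k))" using D(9)[of "Suc k" i] i by (cases "i = Suc k") auto
      then show ?thesis using D(11) False i M(4) by auto
    qed
  qed
qed

section \<open>Faces of bisected simplices\<close>

lemma affine_coeffs_unique:
  fixes S :: "'a::real_vector set"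
  assumes "finite S" "\<not> affine_dependent S" "sum u S = sum v S"
    "(\<Sum>x\<in>S. u x *\<^sub>R x) = (\<Sum>x\<in>S. v x *\<^sub>R x)" "x \<in> S"
  shows "u x = v x"
proof (rule ccontr)
  assume "u x \<noteq> v x"
  then have "affine_dependent S" unfolding affine_dependent_explicit_finite[OF assms(1)]
    using assms by (intro exI[of _ "\<lambda>x. u x - v x"]) (auto simp: sum_subtractf scaleR_diff_left)
  then show False using assms by simp
qed

lemma sum_remove2:
  assumes "finite S" "a \<in> S" "b \<in> S" "a \<noteq> b"
  shows "sum f S = f a + (f b + sum f (S - {a, b}))"
proof -
  have "sum f S = f a + sum f (S - {a})" using assms by (simp add: sum.remove)
  also have "sum f (S - {a}) = f b + sum f (S - {a} - {b})" using assms by (intro sum.remove) auto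
  also have "S - {a} - {b} = S - {a, b}" by auto
  finally show ?thesis .
qed

text \<open>Splitting the weight of the midpoint evenly between \<open>a\<close> and
  \<open>b\<close> leaves \<open>b\<close> with at least the weight of \<open>a\<close>. With the
  converse \<open>bisected_hullI\<close>, the child is the half of the simplex cut out by this
  inequality between barycentric coordinates.\<close>

lemma bisected_hull_coeffs:
  fixes S :: "'a::real_vector set"
  assumes S: "finite S" "a \<in> S" "b \<in> S" "a \<noteq> b"
    and x: "x \<in> convex hull (insert ((1/2) *\<^sub>R (a + b)) (S - {a}))"
  obtains \<mu> where "\<forall>v\<in>S. 0 \<le> \<mu> v" "sum \<mu> S = 1" "(\<Sum>v\<in>S. \<mu> v *\<^sub>R v) = x" "\<mu> a \<le> \<mu> b"
proof -
  have ne: "S - {a} \<noteq> {}" using S by auto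
  obtain u w y where uw: "0 \<le> u" "0 \<le> w" "u + w = 1" "y \<in> convex hull (S - {a})"
    "x = u *\<^sub>R ((1/2) *\<^sub>R (a + b)) + w *\<^sub>R y"
    using x unfolding convex_hull_insert[OF ne] by blast
  obtain l where l: "\<forall>v\<in>S - {a}. 0 \<le> l v" "sum l (S - {a}) = 1" "(\<Sum>v\<in>S - {a}. l v *\<^sub>R v) = y"
    using uw(4) S(1) by (auto simp: convex_hull_finite)
  have e: "insert b (S - {a, b}) = S - {a}" "b \<notin> S - {a, b}" using S by auto
  have l2: "l b + sum l (S - {a, b}) = 1" using l(2) e S(1) by (metis finite_Diff sum.insert)
  have l3: "l b *\<^sub>R b + (\<Sum>v\<in>S - {a, b}. l v *\<^sub>R v) = y" using l(3) e S(1)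
    by (metis (no_types, lifting) finite_Diff sum.insert)
  define \<mu> where "\<mu> v = (if v = a then u / 2 else if v = b then u / 2 + w * l b else w * l v)" for v
  have r1: "sum \<mu> (S - {a, b}) = w * sum l (S - {a, b})" unfolding sum_distrib_left
    by (rule sum.cong) (auto simp: \<mu>_def)
  have r2: "(\<Sum>v\<in>S - {a, b}. \<mu> v *\<^sub>R v) = w *\<^sub>R (\<Sum>v\<in>S - {a, b}. l v *\<^sub>R v)" unfolding scaleR_sum_right
    by (rule sum.cong) (auto simp: \<mu>_def)
  show ?thesis
  proof
    show "\<forall>v\<in>S. 0 \<le> \<mu> v" using l uw S by (auto simp: \<mu>_def)
    show "\<mu> a \<le> \<mu> b" using l uw S by (auto simp: \<mu>_def)
    have "sum \<mu> S = \<mu> a + (\<mu> b + sum \<mu> (S - {a, b}))" by (rule sum_remove2[OF S])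
    also have "\<dots> = u + w * (l b + sum l (S - {a, b}))" using S unfolding r1 by (simp add: \<mu>_def algebra_simps)
    finally show "sum \<mu> S = 1" using l2 uw by simp
    have "(\<Sum>v\<in>S. \<mu> v *\<^sub>R v) = \<mu> a *\<^sub>R a + (\<mu> b *\<^sub>R b + (\<Sum>v\<in>S - {a, b}. \<mu> v *\<^sub>R v))" by (rule sum_remove2[OF S])
    also have "\<dots> = u *\<^sub>R ((1/2) *\<^sub>R (a + b)) + w *\<^sub>R (l b *\<^sub>R b + (\<Sum>v\<in>S - {a, b}. l v *\<^sub>R v))"
      using S unfolding r2 by (simp add: \<mu>_def algebra_simps)
    finally show "(\<Sum>v\<in>S. \<mu> v *\<^sub>R v) = x" using l3 uw by simp
  qed
qed

lemma bisected_hullI: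
  fixes S :: "'a::real_vector set"
  assumes S: "finite S" "a \<in> S" "b \<in> S" "a \<noteq> b"
    and \<mu>: "\<forall>v\<in>S. 0 \<le> \<mu> v" "sum \<mu> S = 1" "(\<Sum>v\<in>S. \<mu> v *\<^sub>R v) = x" "\<mu> a \<le> \<mu> b"
  shows "x \<in> convex hull (insert ((1/2) *\<^sub>R (a + b)) (S - {a}))"
proof -
  define z where "z = (1/2) *\<^sub>R (a + b)"
  \<comment> \<open>Equal parts of the weights of \<open>a\<close> and \<open>b\<close> are merged
    at the midpoint; only the excess remains at \<open>b\<close>.\<close>
  define \<nu> where "\<nu> = \<mu>(a := 2 * \<mu> a, b := \<mu> b - \<mu> a)"
  define f where "f = (\<lambda>v. v)(a := z)"
  have r1: "sum \<nu> (S - {a, b}) = sum \<mu> (S - {a, b})" by (rule sum.cong) (auto simp: \<nu>_def)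
  have r2: "(\<Sum>v\<in>S - {a, b}. \<nu> v *\<^sub>R f v) = (\<Sum>v\<in>S - {a, b}. \<mu> v *\<^sub>R v)"
    by (rule sum.cong) (auto simp: \<nu>_def f_def)
  have "sum \<nu> S = sum \<mu> S" unfolding sum_remove2[OF S] r1 using S by (simp add: \<nu>_def)
  then have s: "sum \<nu> S = 1" using \<mu> by simp
  have "(\<Sum>v\<in>S. \<nu> v *\<^sub>R f v) = (\<Sum>v\<in>S. \<mu> v *\<^sub>R v)" unfolding sum_remove2[OF S, of "\<lambda>v. \<nu> v *\<^sub>R f v"] r2
      sum_remove2[OF S, of "\<lambda>v. \<mu> v *\<^sub>R v"]
    using S by (simp add: \<nu>_def f_def z_def algebra_simps)
  moreover have "(\<Sum>v\<in>S. \<nu> v *\<^sub>R f v) \<in> convex hull (insert z (S - {a}))"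
    by (rule convex_sum[OF S(1) convex_convex_hull s]) (use \<mu> S in \<open>auto simp: \<nu>_def f_def intro!: hull_inc\<close>)
  ultimately show ?thesis using \<mu> by (simp add: z_def)
qed

lemma bisected_hull_face:
  fixes S :: "'a::real_vector set"
  assumes S: "finite S" "a \<in> S" "b \<in> S" "a \<noteq> b"
    and \<mu>: "\<forall>v\<in>S. 0 \<le> \<mu> v" "sum \<mu> S = 1" "(\<Sum>v\<in>S. \<mu> v *\<^sub>R v) = x" "\<mu> a = \<mu> b"
  shows "x \<in> convex hull (insert ((1/2) *\<^sub>R (a + b)) (S - {a, b}))"
proof -
  define z where "z = (1/2) *\<^sub>R (a + b)"
  define f where "f = (\<lambda>v. v)(a := z, b := z)"
  have r2: "(\<Sum>v\<in>S - {a, b}. \<mu> v *\<^sub>R f v) = (\<Sum>v\<in>S - {a, b}. \<mu> v *\<^sub>R v)"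
    by (rule sum.cong) (auto simp: f_def)
  have "(\<Sum>v\<in>S. \<mu> v *\<^sub>R f v) = (\<Sum>v\<in>S. \<mu> v *\<^sub>R v)" unfolding sum_remove2[OF S, of "\<lambda>v. \<mu> v *\<^sub>R f v"] r2
      sum_remove2[OF S, of "\<lambda>v. \<mu> v *\<^sub>R v"]
    using S \<mu>(4) by (simp add: f_def z_def algebra_simps flip: scaleR_add_left)
  moreover have "(\<Sum>v\<in>S. \<mu> v *\<^sub>R f v) \<in> convex hull (insert z (S - {a, b}))"
    by (rule convex_sum[OF S(1) convex_convex_hull \<mu>(2)]) (use \<mu> S in \<open>auto simp: f_def intro!: hull_inc\<close>)
  ultimately show ?thesis using \<mu> by (simp add: z_def)
qed

lemma bisected_hull_subset:
  fixes S :: "'a::real_vector set"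
  assumes "a \<in> S" "b \<in> S"
  shows "convex hull (insert ((1/2) *\<^sub>R (a + b)) (S - {c})) \<subseteq> convex hull S"
proof (rule hull_minimal)
  have "(1/2) *\<^sub>R a + (1/2) *\<^sub>R b \<in> convex hull S"
    by (intro convexD[OF convex_convex_hull]) (use assms in \<open>auto intro: hull_inc\<close>)
  then show "insert ((1/2) *\<^sub>R (a + b)) (S - {c}) \<subseteq> convex hull S"
    by (auto simp: scaleR_add_right intro: hull_inc)
qed simp

lemma subset_hull_coeffs:
  fixes S :: "'a::real_vector set"
  assumes "finite S" "W \<subseteq> S" "x \<in> convex hull W"
  obtains \<mu> where "\<forall>v\<in>S. 0 \<le> \<mu> v" "sum \<mu> S = 1" "(\<Sum>v\<in>S. \<mu> v *\<^sub>R v) = x" "\<forall>v. v \<notin> W \<longrightarrow> \<mu> v = 0"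
proof -
  have W: "finite W" using assms finite_subset by auto
  obtain l where l: "\<forall>v\<in>W. 0 \<le> l v" "sum l W = 1" "(\<Sum>v\<in>W. l v *\<^sub>R v) = x"
    using assms(3) W by (auto simp: convex_hull_finite)
  define \<mu> where "\<mu> v = (if v \<in> W then l v else 0)" for v
  have "sum \<mu> S = sum l W" "(\<Sum>v\<in>S. \<mu> v *\<^sub>R v) = (\<Sum>v\<in>W. l v *\<^sub>R v)"
    by (rule sum.mono_neutral_cong_right; use assms in \<open>auto simp: \<mu>_def\<close>)+
  then show ?thesis using l by (intro that[of \<mu>]) (auto simp: \<mu>_def)
qed

lemma hull_coeffs_restrict:
  fixes S :: "'a::real_vector set"
  assumes "finite S" "W \<subseteq> S" "\<forall>v\<in>S. 0 \<le> \<mu> v" "sum \<mu> S = 1" "(\<Sum>v\<in>S. \<mu> v *\<^sub>R v) = x"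
    "\<forall>v\<in>S - W. \<mu> v = 0"
  shows "sum \<mu> W = 1" "(\<Sum>v\<in>W. \<mu> v *\<^sub>R v) = x" "x \<in> convex hull W"
proof -
  have "finite W" using assms finite_subset by auto
  show 1: "sum \<mu> W = 1" "(\<Sum>v\<in>W. \<mu> v *\<^sub>R v) = x"
    using sum.mono_neutral_right[of S W \<mu>] sum.mono_neutral_right[of S W "\<lambda>v. \<mu> v *\<^sub>R v"] assms by auto
  show "x \<in> convex hull W" unfolding convex_hull_finite[OF \<open>finite W\<close>] using 1 assms by blast
qed

text \<open>By uniqueness of barycentric coordinates, those of \<open>x\<close> on \<open>S\<close>
  vanish outside \<open>W\<close>. If \<open>W\<close> misses \<open>a\<close> or \<open>b\<close>,
  one of their weights is zero, and the inequality defining the half forces the weight of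
  \<open>a\<close> to vanish. Otherwise the inequality is inherited by \<open>W\<close>, so
  \<open>x\<close> lies in the corresponding half of the face.\<close>

lemma bisected_Int_face:
  fixes S :: "'a::real_vector set"
  assumes S: "finite S" "\<not> affine_dependent S" "a \<in> S" "b \<in> S" "a \<noteq> b" and W: "W \<subseteq> S"
    and x: "x \<in> convex hull (insert ((1/2) *\<^sub>R (a + b)) (S - {a}))" "x \<in> convex hull W"
  shows "\<not> {a, b} \<subseteq> W \<Longrightarrow> x \<in> convex hull (W - {a})"
    and "{a, b} \<subseteq> W \<Longrightarrow> x \<in> convex hull (insert ((1/2) *\<^sub>R (a + b)) (W - {a}))"
proof -
  obtain \<mu> where \<mu>: "\<forall>v\<in>S. 0 \<le> \<mu> v" "sum \<mu> S = 1" "(\<Sum>v\<in>S. \<mu> v *\<^sub>R v) = x" "\<mu> a \<le> \<mu> b"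
    using bisected_hull_coeffs[OF S(1,3-5) x(1)] by blast
  obtain \<nu> where \<nu>: "\<forall>v\<in>S. 0 \<le> \<nu> v" "sum \<nu> S = 1" "(\<Sum>v\<in>S. \<nu> v *\<^sub>R v) = x" "\<forall>v. v \<notin> W \<longrightarrow> \<nu> v = 0"
    using subset_hull_coeffs[OF S(1) W x(2)] by blast
  have e: "\<mu> v = \<nu> v" if "v \<in> S" for v
    using affine_coeffs_unique[OF S(1,2), of \<mu> \<nu>] \<mu> \<nu> that by auto
  have z: "\<forall>v\<in>S - W. \<mu> v = 0" using e \<nu> by auto
  have W0: "finite W" using W S finite_subset by auto
  {
    assume "\<not> {a, b} \<subseteq> W"
    then have "\<mu> a = 0 \<or> \<mu> b = 0" using z S by blast
    moreover have "0 \<le> \<mu> a" using \<mu>(1) S by blast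
    ultimately have "\<mu> a = 0" using \<mu>(4) by linarith
    then show "x \<in> convex hull (W - {a})"
      using hull_coeffs_restrict[of S "W - {a}" \<mu> x] z \<mu> S W by auto
  next
    assume ab: "{a, b} \<subseteq> W"
    show "x \<in> convex hull (insert ((1/2) *\<^sub>R (a + b)) (W - {a}))"
      by (rule bisected_hullI[OF W0 _ _ S(5)]) (use ab hull_coeffs_restrict[OF S(1) W \<mu>(1-3) z] \<mu> W in auto)
  }
qed

text \<open>On both halves at once the weights of \<open>a\<close> and \<open>b\<close>
  coincide.\<close>

lemma bisected_halves_Int:
  fixes S :: "'a::real_vector set"
  assumes S: "finite S" "\<not> affine_dependent S" "a \<in> S" "b \<in> S" "a \<noteq> b"
    and x: "x \<in> convex hull (insert ((1/2) *\<^sub>R (a + b)) (S - {a}))"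
      "x \<in> convex hull (insert ((1/2) *\<^sub>R (a + b)) (S - {b}))"
  shows "x \<in> convex hull (insert ((1/2) *\<^sub>R (a + b)) (S - {a, b}))"
proof -
  obtain \<mu> where \<mu>: "\<forall>v\<in>S. 0 \<le> \<mu> v" "sum \<mu> S = 1" "(\<Sum>v\<in>S. \<mu> v *\<^sub>R v) = x" "\<mu> a \<le> \<mu> b"
    using bisected_hull_coeffs[OF S(1,3-5) x(1)] by blast
  obtain \<nu> where \<nu>: "\<forall>v\<in>S. 0 \<le> \<nu> v" "sum \<nu> S = 1" "(\<Sum>v\<in>S. \<nu> v *\<^sub>R v) = x" "\<nu> b \<le> \<nu> a"
    using bisected_hull_coeffs[of S b a x] S x(2) by (auto simp: add.commute)
  have e: "\<mu> v = \<nu> v" if "v \<in> S" for v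
    using affine_coeffs_unique[OF S(1,2), of \<mu> \<nu>] \<mu> \<nu> that by auto
  show ?thesis using bisected_hull_face[OF S(1,3-5) \<mu>(1-3)] \<mu>(4) \<nu>(4) e S by auto
qed

definition proper_simplex :: "('n::finite) tsimplex \<Rightarrow> bool" where
  "proper_simplex T \<longleftrightarrow> finite T \<and> card T = CARD('n) + 1 \<and> inj_on fst T \<and> \<not> affine_dependent (fst ` T)"

abbreviation (input) tag_hull :: "('n::finite) tsimplex \<Rightarrow> (real^'n) set" where
  "tag_hull T \<equiv> convex hull (fst ` T)"

text \<open>Intersecting sets of tagged vertices makes the relation stronger than conformity of the
  point sets: for proper simplices it forces a common point that is a vertex of both to have the
  same generation in both. The reverse inclusion holds by monotonicity of the hull.\<close>

definition face_to_face :: "('n::finite) tsimplex \<Rightarrow> 'n tsimplex \<Rightarrow> bool" where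
  "face_to_face T T' \<longleftrightarrow> tag_hull T \<inter> tag_hull T' \<subseteq> tag_hull (T \<inter> T')"

lemma face_to_face_commute: "face_to_face T T' \<longleftrightarrow> face_to_face T' T"
  by (simp add: face_to_face_def Int_commute)

lemma midpoint_notin_affine:
  fixes S :: "'a::real_vector set"
  assumes "\<not> affine_dependent S" "a \<in> S" "b \<in> S" "a \<noteq> b"
  shows "(1/2) *\<^sub>R (a + b) \<notin> affine hull (S - {a})"
proof
  let ?z = "(1/2) *\<^sub>R (a + b)"
  assume z: "?z \<in> affine hull (S - {a})"
  have "b \<in> affine hull (S - {a})" using assms by (auto intro: hull_inc)
  then have "2 *\<^sub>R ?z + (-1) *\<^sub>R b \<in> affine hull (S - {a})"
    by (intro mem_affine[OF affine_affine_hull z]) auto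
  then have "a \<in> affine hull (S - {a})" by (simp add: algebra_simps)
  then show False using assms unfolding affine_dependent_def by auto
qed

lemma proper_simplex_child:
  assumes "proper_simplex T" "a \<in> T" "b \<in> T" "a \<noteq> b"
  shows "proper_simplex (insert ((1/2) *\<^sub>R (fst a + fst b), g) (T - {a}))"
proof -
  let ?z = "(1/2) *\<^sub>R (fst a + fst b)"
  have T: "finite T" "card T = CARD('a) + 1" "inj_on fst T" "\<not> affine_dependent (fst ` T)"
    using assms by (auto simp: proper_simplex_def)
  have im: "fst ` (T - {a}) = fst ` T - {fst a}"
    using T assms by (auto dest: inj_onD)
  have ne: "fst a \<noteq> fst b" using T assms by (auto dest: inj_onD)
  have n: "?z \<notin> affine hull (fst ` T - {fst a})"
    using midpoint_notin_affine[OF T(4), of "fst a" "fst b"] assms ne by auto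
  then have n2: "?z \<notin> fst ` (T - {a})" unfolding im by (auto intro: hull_inc)
  have nd: "\<not> affine_dependent (fst ` T - {fst a})"
    using T(4) affine_independent_subset[of "fst ` T" "fst ` T - {fst a}"] by auto
  show ?thesis unfolding proper_simplex_def
  proof (intro conjI)
    show "finite (insert (?z, g) (T - {a}))" using T by simp
    have "(?z, g) \<notin> T - {a}" using n2 by force
    then show "card (insert (?z, g) (T - {a})) = CARD('a) + 1" using T assms by simp
    show "inj_on fst (insert (?z, g) (T - {a}))"
      unfolding inj_on_insert using T n2 by (auto intro: inj_on_subset)
    show "\<not> affine_dependent (fst ` insert (?z, g) (T - {a}))"
      using affine_independent_insert[OF nd n] im by simp
  qed
qed

lemma proper_simplex_vertex_in_face:
  assumes "proper_simplex T" "W \<subseteq> T" "v \<in> T" "fst v \<in> tag_hull W"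
  shows "v \<in> W"
proof (rule ccontr)
  assume "v \<notin> W"
  then have "fst ` W \<subseteq> fst ` T - {fst v}" using assms unfolding proper_simplex_def by (auto dest: inj_onD)
  then have "fst v \<in> affine hull (fst ` T - {fst v})"
    using assms(4) convex_hull_subset_affine_hull hull_mono by blast
  then show False using assms unfolding proper_simplex_def affine_dependent_def by auto
qed

lemma tag_hull_remove:
  assumes "proper_simplex T" "W \<subseteq> T" "a \<in> T"
  shows "fst ` (W - {a}) = fst ` W - {fst a}"
  using assms unfolding proper_simplex_def by (auto dest: inj_onD)

text \<open>The common face does not contain the whole bisected edge, so it is not cut; only the
  part avoiding \<open>a\<close> can meet the child.\<close>

lemma face_to_face_child:
  assumes T: "proper_simplex T" "a \<in> T" "b \<in> T" "a \<noteq> b" and f: "face_to_face T T'" and ab: "\<not> {a, b} \<subseteq> T'"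
  shows "face_to_face (insert ((1/2) *\<^sub>R (fst a + fst b), g) (T - {a})) T'"
  unfolding face_to_face_def
proof
  let ?z = "(1/2) *\<^sub>R (fst a + fst b)" and ?W = "T \<inter> T'"
  have TT: "finite (fst ` T)" "inj_on fst T" "\<not> affine_dependent (fst ` T)"
    using T by (auto simp: proper_simplex_def)
  have ne: "fst a \<noteq> fst b" using TT T by (auto dest: inj_onD)
  fix x assume "x \<in> tag_hull (insert (?z, g) (T - {a})) \<inter> tag_hull T'"
  then have x: "x \<in> convex hull (insert ?z (fst ` T - {fst a}))" "x \<in> tag_hull T'"
    using tag_hull_remove[OF T(1) order_refl T(2)] by auto
  have "x \<in> tag_hull T"
    using bisected_hull_subset[of "fst a" "fst ` T" "fst b" "fst a"] T x(1) by auto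
  then have xW: "x \<in> tag_hull ?W" using f x unfolding face_to_face_def by auto
  have "\<not> {fst a, fst b} \<subseteq> fst ` ?W"
  proof
    assume "{fst a, fst b} \<subseteq> fst ` ?W"
    then have "a \<in> ?W" "b \<in> ?W"
      using inj_on_image_mem_iff[OF TT(2), of _ ?W] T by (meson Int_lower1 insert_subset)+
    then show False using ab by auto
  qed
  then have "x \<in> convex hull (fst ` ?W - {fst a})"
    using bisected_Int_face(1)[OF TT(1,3) _ _ ne _ x(1) xW] T by auto
  then have "x \<in> tag_hull (?W - {a})" using tag_hull_remove[OF T(1) _ T(2), of ?W] by simp
  moreover have "tag_hull (?W - {a}) \<subseteq> tag_hull (insert (?z, g) (T - {a}) \<inter> T')"
    by (intro hull_mono image_mono) auto
  ultimately show "x \<in> tag_hull (insert (?z, g) (T - {a}) \<inter> T')" by auto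
qed

text \<open>Here the common face is bisected along with both simplices. For \<open>c = a\<close> the
  children lie over the same half of that face; for \<open>c = b\<close> they lie over opposite
  halves and meet only in the cut.\<close>

lemma face_to_face_children:
  assumes T: "proper_simplex T" "a \<in> T" "b \<in> T" "a \<noteq> b"
    and T': "proper_simplex T'" "a \<in> T'" "b \<in> T'" and f: "face_to_face T T'" and c: "c \<in> {a, b}"
  shows "face_to_face (insert ((1/2) *\<^sub>R (fst a + fst b), g) (T - {a}))
    (insert ((1/2) *\<^sub>R (fst a + fst b), g) (T' - {c}))"
  unfolding face_to_face_def
proof
  let ?z = "(1/2) *\<^sub>R (fst a + fst b)" and ?W = "T \<inter> T'"
  have TT: "finite (fst ` T)" "inj_on fst T" "\<not> affine_dependent (fst ` T)"
    using T by (auto simp: proper_simplex_def)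
  have TT': "finite (fst ` T')" "inj_on fst T'" "\<not> affine_dependent (fst ` T')"
    using T' by (auto simp: proper_simplex_def)
  have ne: "fst a \<noteq> fst b" using TT T by (auto dest: inj_onD)
  fix x assume "x \<in> tag_hull (insert (?z, g) (T - {a})) \<inter> tag_hull (insert (?z, g) (T' - {c}))"
  then have x: "x \<in> convex hull (insert ?z (fst ` T - {fst a}))" "x \<in> convex hull (insert ?z (fst ` T' - {fst c}))"
    using tag_hull_remove[OF T(1) order_refl T(2)] tag_hull_remove[OF T'(1) order_refl, of c] c T' by auto
  have xT: "x \<in> tag_hull T"
    using bisected_hull_subset[of "fst a" "fst ` T" "fst b" "fst a"] T x(1) by auto
  have z: "?z = (1/2) *\<^sub>R (fst b + fst a)" by (simp add: add.commute)
  have W: "fst ` ?W \<subseteq> fst ` T" "fst ` ?W \<subseteq> fst ` T'" "{fst a, fst b} \<subseteq> fst ` ?W" "{fst b, fst a} \<subseteq> fst ` ?W"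
    using T T' by auto
  have rW: "fst ` ?W - {fst a} = fst ` (?W - {a})" "fst ` ?W - {fst a, fst b} = fst ` (?W - {a, b})"
    using TT T by (auto dest: inj_onD)
  have xT': "x \<in> tag_hull T'"
    using bisected_hull_subset[of "fst a" "fst ` T'" "fst b" "fst c"] T' x(2) by auto
  have xW: "x \<in> tag_hull ?W" using f xT xT' unfolding face_to_face_def by auto
  have xa: "x \<in> convex hull (insert ?z (fst ` ?W - {fst a}))"
    using bisected_Int_face(2)[OF TT(1,3) _ _ ne W(1) x(1) xW] T W by auto
  show "x \<in> tag_hull (insert (?z, g) (T - {a}) \<inter> insert (?z, g) (T' - {c}))" (is "_ \<in> tag_hull ?R")
  proof (cases "c = a")
    case True
    have "insert ?z (fst ` ?W - {fst a}) \<subseteq> fst ` ?R" unfolding rW True by auto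
    then show ?thesis using xa hull_mono by blast
  next
    case False
    then have cb: "c = b" using c by simp
    have "x \<in> convex hull (insert ?z (fst ` ?W - {fst b}))" unfolding z
      by (rule bisected_Int_face(2)[OF TT'(1,3) _ _ ne[symmetric] W(2) x(2)[unfolded cb z] xW W(4)]) (use T' in auto)
    then have "x \<in> convex hull (insert ?z (fst ` ?W - {fst a, fst b}))"
      using bisected_halves_Int[OF _ _ _ _ ne xa] W TT affine_independent_subset[OF TT(3) W(1)]
      by (metis finite_subset insert_subset)
    moreover have "insert ?z (fst ` ?W - {fst a, fst b}) \<subseteq> fst ` ?R" unfolding rW cb by auto
    ultimately show ?thesis using hull_mono by blast
  qed
qed

section \<open>The bisection forest\<close>

locale forest =
  fixes N :: nat and R :: "('n::finite) tsimplex set"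
  assumes N: "N > 0"
    and finite_R: "finite R"
    and root_proper: "T \<in> R \<Longrightarrow> proper_simplex T"
    and root_maubach: "T \<in> R \<Longrightarrow> maubach N 0 CARD('n) T"
    and root_face: "T \<in> R \<Longrightarrow> T' \<in> R \<Longrightarrow> face_to_face T T'"
begin

inductive_set FT :: "'n tsimplex set" where
  root: "T \<in> R \<Longrightarrow> T \<in> FT"
| child: "T \<in> FT \<Longrightarrow> C \<in> children N T \<Longrightarrow> C \<in> FT"

lemma FT_maubach:
  assumes "T \<in> FT" obtains L k where "L \<ge> 0" "maubach N L k T"
proof -
  from assms have "\<exists>L k. L \<ge> 0 \<and> maubach N L k T"
  proof induction
    case (root T) then show ?case using root_maubach by force
  next
    case (child T C)
    then obtain L k where L: "L \<ge> 0" "maubach N L k T" by auto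
    show ?case using maubach_child(1)[OF N L(2) child(2)] L(1)
      by (cases "k > 1") (auto intro: exI[of _ "L + 1"])
  qed
  then show ?thesis using that by auto
qed

lemma FT_edge:
  assumes "T \<in> FT"
  shows "bse_a N T \<in> T" "bse_b N T \<in> T" "bse_a N T \<noteq> bse_b N T" "0 < gm N T"
    "gm N T = mid N (snd (bse_a N T)) (snd (bse_b N T))"
    "\<And>u v. u \<in> T \<Longrightarrow> v \<in> T \<Longrightarrow> u \<noteq> v \<Longrightarrow> {u, v} \<noteq> edge N T \<Longrightarrow> gm N T < mid N (snd u) (snd v)"
    "\<And>v. v \<in> T \<Longrightarrow> snd v < gm N T"
    "\<And>C. C \<in> children N T \<Longrightarrow> gm N T < gm N C"
proof -
  obtain L k where L: "L \<ge> 0" "maubach N L k T" using FT_maubach[OF assms] .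
  note m = maubach_edge[OF N L(2)]
  show "bse_a N T \<in> T" "bse_b N T \<in> T" "bse_a N T \<noteq> bse_b N T"
    "gm N T = mid N (snd (bse_a N T)) (snd (bse_b N T))"
    "\<And>u v. u \<in> T \<Longrightarrow> v \<in> T \<Longrightarrow> u \<noteq> v \<Longrightarrow> {u, v} \<noteq> edge N T \<Longrightarrow> gm N T < mid N (snd u) (snd v)"
    "\<And>v. v \<in> T \<Longrightarrow> snd v < gm N T"
    using m by auto
  have "0 \<le> int N * L" using L by simp
  then show "0 < gm N T" using m(4) by linarith
  show "\<And>C. C \<in> children N T \<Longrightarrow> gm N T < gm N C" using maubach_child(2)[OF N L(2)] .
qed

lemma childE:
  assumes "T \<in> FT" "C \<in> children N T"
  obtains a b where "edge N T = {a, b}" "a \<noteq> b" "a \<in> T" "b \<in> T"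
    "C = insert ((1/2) *\<^sub>R (fst a + fst b), gm N T) (T - {a})"
proof -
  have z: "bsv N T = ((1/2) *\<^sub>R (fst (bse_a N T) + fst (bse_b N T)), gm N T)"
    "bsv N T = ((1/2) *\<^sub>R (fst (bse_b N T) + fst (bse_a N T)), gm N T)"
    by (auto simp: bsv_def gm_def add.commute)
  consider "C = insert (bsv N T) (T - {bse_a N T})" | "C = insert (bsv N T) (T - {bse_b N T})"
    using assms(2) unfolding children_def by auto
  then show ?thesis
  proof cases
    case 1
    then show ?thesis using that[of "bse_a N T" "bse_b N T"] z(1) FT_edge(1-3)[OF assms(1)]
      by (simp add: edge_def)
  next
    case 2
    then show ?thesis using that[of "bse_b N T" "bse_a N T"] z(2) FT_edge(1-3)[OF assms(1)]
      by (simp add: edge_def insert_commute)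
  qed
qed

lemma edgeE:
  assumes "T \<in> FT"
  obtains a b where "edge N T = {a, b}" "a \<noteq> b" "a \<in> T" "b \<in> T" "gm N T = mid N (snd a) (snd b)"
  using FT_edge(1-5)[OF assms] that by (simp add: edge_def)

lemma edge_subset: "T \<in> FT \<Longrightarrow> edge N T \<subseteq> T"
  using FT_edge(1,2) by (simp add: edge_def)

lemma child_containing:
  assumes "T \<in> FT" "E \<subseteq> T" "\<not> edge N T \<subseteq> E"
  obtains C where "C \<in> children N T" "E \<subseteq> C"
proof -
  consider "bse_a N T \<notin> E" | "bse_b N T \<notin> E" using assms by (auto simp: edge_def)
  then show ?thesis
  proof cases
    case 1 then show ?thesis
      by (intro that[of "insert (bsv N T) (T - {bse_a N T})"]) (use assms in \<open>auto simp: children_def\<close>)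
  next
    case 2 then show ?thesis
      by (intro that[of "insert (bsv N T) (T - {bse_b N T})"]) (use assms in \<open>auto simp: children_def\<close>)
  qed
qed

lemma FT_proper: "T \<in> FT \<Longrightarrow> proper_simplex T"
proof (induction rule: FT.induct)
  case (child T C)
  then obtain a b where "a \<noteq> b" "a \<in> T" "b \<in> T"
    "C = insert ((1/2) *\<^sub>R (fst a + fst b), gm N T) (T - {a})" using childE by metis
  then show ?case using proper_simplex_child[OF child.IH, of a b] by simp
qed (rule root_proper)

lemma child_hull:
  assumes "T \<in> FT" "C \<in> children N T"
  shows "tag_hull C \<subseteq> tag_hull T"
proof -
  obtain a b where ab: "a \<noteq> b" "a \<in> T" "b \<in> T"
    "C = insert ((1/2) *\<^sub>R (fst a + fst b), gm N T) (T - {a})" using childE[OF assms] by metis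
  have "fst ` C = insert ((1/2) *\<^sub>R (fst a + fst b)) (fst ` T - {fst a})"
    using ab tag_hull_remove[OF FT_proper[OF assms(1)] order_refl ab(2)] by simp
  then show ?thesis using bisected_hull_subset[of "fst a" "fst ` T" "fst b" "fst a"] ab by auto
qed

text \<open>Both generations are values of \<open>mid\<close> on edges of \<open>T\<close>, and the
  bisection edge of \<open>T\<close> is the only edge where \<open>mid\<close> is smallest.
  Termination and conformity both rest on this comparison.\<close>

lemma edge_in_simplex:
  assumes "T \<in> FT" "Y \<in> FT" "edge N Y \<subseteq> T"
  shows "edge N T = edge N Y \<and> gm N T = gm N Y \<or> edge N T \<noteq> edge N Y \<and> gm N T < gm N Y"
proof -
  obtain a b where Y: "edge N Y = {a, b}" "a \<noteq> b" "gm N Y = mid N (snd a) (snd b)"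
    using edgeE[OF assms(2)] by metis
  obtain c d where T: "edge N T = {c, d}" "gm N T = mid N (snd c) (snd d)"
    using edgeE[OF assms(1)] by metis
  show ?thesis
  proof (cases "edge N T = edge N Y")
    case True
    then have "gm N T = gm N Y" using Y T by (auto simp: doubleton_eq_iff mid_commute)
    then show ?thesis using True by simp
  next
    case False
    then show ?thesis using FT_edge(6)[OF assms(1), of a b] Y assms(3) by auto
  qed
qed

section \<open>Partitions by a threshold on the bisection generation\<close>

definition leaves :: "'n tsimplex set \<Rightarrow> 'n tsimplex set" where
  "leaves I = (R \<union> \<Union> (children N ` I)) - I"

definition uniform :: "int \<Rightarrow> 'n tsimplex set" where
  "uniform m = leaves {T \<in> FT. gm N T \<le> m}"

lemma leaves_FT: "I \<subseteq> FT \<Longrightarrow> leaves I \<subseteq> FT"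
  unfolding leaves_def using FT.intros by blast

lemma uniform_iff:
  "T \<in> uniform m \<longleftrightarrow> T \<in> FT \<and> m < gm N T \<and> (T \<in> R \<or> (\<exists>Y\<in>FT. gm N Y \<le> m \<and> T \<in> children N Y))"
  unfolding uniform_def leaves_def using FT.intros by (auto simp: not_le)

lemma FT_cases:
  assumes "T \<in> FT" obtains "T \<in> R" | Y where "Y \<in> FT" "T \<in> children N Y" "gm N Y < gm N T"
  using assms by (cases rule: FT.cases) (use FT_edge(8) in blast)+

text \<open>A parent has a smaller bisection generation, so \<open>T\<close> is present just before
  its own turn.\<close>

lemma FT_uniform: "T \<in> FT \<Longrightarrow> T \<in> uniform (gm N T - 1)"
  unfolding uniform_iff by (auto elim: FT_cases)

lemma face_child:
  assumes "Y \<in> FT" "X \<in> children N Y" "face_to_face Y T" "\<not> edge N Y \<subseteq> T"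
  shows "face_to_face X T"
proof -
  obtain a b where ab: "edge N Y = {a, b}" "a \<noteq> b" "a \<in> Y" "b \<in> Y"
    "X = insert ((1/2) *\<^sub>R (fst a + fst b), gm N Y) (Y - {a})" using childE[OF assms(1,2)] .
  show ?thesis unfolding ab(5)
    by (rule face_to_face_child[OF FT_proper[OF assms(1)] ab(3,4,2) assms(3)]) (use ab assms in auto)
qed

lemma uniform_Suc:
  assumes "X \<in> uniform (m + 1)"
  obtains "X \<in> uniform m" | Y where "Y \<in> uniform m" "Y \<in> FT" "gm N Y = m + 1" "X \<in> children N Y"
proof -
  have X: "X \<in> FT" "m + 1 < gm N X" "X \<in> R \<or> (\<exists>Y\<in>FT. gm N Y \<le> m + 1 \<and> X \<in> children N Y)"
    using assms unfolding uniform_iff by auto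
  from X(3) show ?thesis
  proof
    assume "X \<in> R" then show ?thesis using that(1) X unfolding uniform_iff by auto
  next
    assume "\<exists>Y\<in>FT. gm N Y \<le> m + 1 \<and> X \<in> children N Y"
    then obtain Y where Y: "Y \<in> FT" "gm N Y \<le> m + 1" "X \<in> children N Y" by auto
    show ?thesis
    proof (cases "gm N Y = m + 1")
      case True
      then show ?thesis using that(2) Y FT_uniform[OF Y(1)] by simp
    next
      case False
      then have "gm N Y \<le> m" using Y(2) by linarith
      then have "X \<in> uniform m" unfolding uniform_iff using X(1,2) Y(1,3) by auto
      then show ?thesis by (rule that(1))
    qed
  qed
qed

lemma child_new_vertex:
  assumes "Y \<in> FT" "X \<in> children N Y" "v \<in> X" "snd v < gm N Y"
  shows "v \<in> Y"
  using childE[OF assms(1,2)] assms(3,4) by (metis DiffD1 insert_iff less_irrefl snd_conv)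

text \<open>Raising the threshold to \<open>m + 1\<close> bisects precisely the simplices with
  \<open>gm\<close> equal to \<open>m + 1\<close>. If two of them share a bisection edge, their
  children match; otherwise they are bisected one after the other, each time without cutting the
  common face.\<close>

lemma uniform_face:
  assumes "0 \<le> m" "X \<in> uniform m" "X' \<in> uniform m"
  shows "face_to_face X X'"
  using assms
proof (induction m arbitrary: X X' rule: int_ge_induct)
  case base
  \<comment> \<open>Bisection generations are positive, so threshold \<open>0\<close> leaves only
    the roots.\<close>
  then have "X \<in> R" "X' \<in> R" unfolding uniform_iff using FT_edge(4) by force+
  then show ?case by (rule root_face)
next
  case (step m)
  have mixed: "face_to_face X X'" if "Y \<in> uniform m" "Y \<in> FT" "gm N Y = m + 1" "X \<in> children N Y"
    "X' \<in> uniform m" "X' \<in> uniform (m + 1)" for X X' Y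
  proof (rule face_child[OF that(2,4) step.IH[OF that(1,5)]])
    \<comment> \<open>A simplex that survives threshold \<open>m + 1\<close> cannot contain an edge
      whose \<open>mid\<close> is \<open>m + 1\<close>, since its own minimum is larger.\<close>
    show "\<not> edge N Y \<subseteq> X'"
      using edge_in_simplex[OF _ that(2), of X'] that(3,6) unfolding uniform_iff by auto
  qed
  show ?case
  proof (cases rule: uniform_Suc[OF step.prems(1)])
    case 1
    note X = this
    show ?thesis
    proof (cases rule: uniform_Suc[OF step.prems(2)])
      case 1 then show ?thesis using step.IH X by blast
    next
      case (2 Y') then show ?thesis using mixed[of Y' X' X] X step.prems(1) face_to_face_commute by blast
    qed
  next
    case (2 Y)
    note Y = this
    show ?thesis
    proof (cases rule: uniform_Suc[OF step.prems(2)])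
      case 1 then show ?thesis using mixed[OF Y] step.prems(2) by blast
    next
      case (2 Y')
      note Y' = this
      have YY: "face_to_face Y Y'" using step.IH Y Y' by blast
      show ?thesis
      proof (cases "edge N Y \<subseteq> Y'")
        case True
        then have e: "edge N Y' = edge N Y" using edge_in_simplex[OF Y'(2) Y(2)] Y Y' by auto
        obtain a b where ab: "edge N Y = {a, b}" "a \<noteq> b" "a \<in> Y" "b \<in> Y"
          "X = insert ((1/2) *\<^sub>R (fst a + fst b), gm N Y) (Y - {a})" using childE[OF Y(2,4)] .
        obtain c d where cd: "edge N Y' = {c, d}" "c \<noteq> d" "c \<in> Y'" "d \<in> Y'"
          "X' = insert ((1/2) *\<^sub>R (fst c + fst d), gm N Y') (Y' - {c})" using childE[OF Y'(2,4)] .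
        have m: "(1/2) *\<^sub>R (fst c + fst d) = (1/2) *\<^sub>R (fst a + fst b)" and c: "c \<in> {a, b}"
          using e ab(1) cd(1) by (auto simp: doubleton_eq_iff add.commute)
        have g: "gm N Y' = gm N Y" using Y Y' by simp
        show ?thesis unfolding ab(5) cd(5) m g
          by (rule face_to_face_children[OF FT_proper[OF Y(2)] ab(3,4,2) FT_proper[OF Y'(2)] _ _ YY c])
            (use True ab in auto)
      next
        case False
        have XY': "face_to_face X Y'" by (rule face_child[OF Y(2,4) YY False])
        \<comment> \<open>The only new vertex of \<open>X\<close> has generation
          \<open>m + 1\<close>, but all vertices of \<open>Y'\<close> are older. So an edge of
          \<open>Y'\<close> in \<open>X\<close> would already lie in \<open>Y\<close>, and the two
          bisection edges would agree.\<close>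
        have "\<not> edge N Y' \<subseteq> X"
        proof
          assume a: "edge N Y' \<subseteq> X"
          have "edge N Y' \<subseteq> Y"
          proof
            fix v assume v: "v \<in> edge N Y'"
            then have "v \<in> Y'" using edge_subset[OF Y'(2)] by blast
            then have "snd v < gm N Y'" by (rule FT_edge(7)[OF Y'(2)])
            moreover have "v \<in> X" using v a by blast
            ultimately show "v \<in> Y" using child_new_vertex[OF Y(2,4)] Y(3) Y'(3) by metis
          qed
          then have "edge N Y = edge N Y'" using edge_in_simplex[OF Y(2) Y'(2)] Y Y' by auto
          then show False using False edge_subset[OF Y'(2)] by auto
        qed
        then have "face_to_face X' X" using face_child[OF Y'(2,4)] XY' face_to_face_commute by blast
        then show ?thesis using face_to_face_commute by blast
      qed
    qed
  qed
qed

text \<open>At least one endpoint of the bisection edge differs from \<open>v\<close>, and the child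
  that replaces this endpoint still contains \<open>v\<close>. Such children are followed until the
  threshold is passed.\<close>

lemma vertex_persists:
  assumes "T \<in> FT" "v \<in> T" "gm N T - 1 \<le> m"
  shows "\<exists>X\<in>uniform m. v \<in> X"
  using assms
proof (induction "nat (m + 1 - gm N T)" arbitrary: T rule: less_induct)
  case less
  show ?case
  proof (cases "gm N T - 1 = m")
    case True then show ?thesis using FT_uniform[OF less(2)] less(3) by auto
  next
    case False
    have "\<not> edge N T \<subseteq> {v}" using FT_edge(3)[OF less(2)] by (auto simp: edge_def)
    then obtain C where C: "C \<in> children N T" "{v} \<subseteq> C" using child_containing[OF less(2), of "{v}"] less(3) by auto
    have CF: "C \<in> FT" using FT.child[OF less(2) C(1)] .
    have g: "gm N T < gm N C" using FT_edge(8)[OF less(2) C(1)] .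
    show ?thesis
    proof (cases "gm N C - 1 \<le> m")
      case True
      then show ?thesis using less(1)[OF _ CF] C g by auto
    next
      case f: False
      then have "C \<in> uniform m" unfolding uniform_iff using CF C(1) less(2,4) False by auto
      then show ?thesis using C by auto
    qed
  qed
qed

text \<open>Both vertices survive into a common uniform partition. There the shared point lies in
  the common face of two simplices, hence is one of its tagged vertices.\<close>

lemma tag_unique:
  assumes "T \<in> FT" "T' \<in> FT" "v \<in> T" "v' \<in> T'" "fst v = fst v'"
  shows "v = v'"
proof -
  define m where "m = max (gm N T) (gm N T') - 1"
  have "gm N T - 1 \<le> m" "gm N T' - 1 \<le> m" unfolding m_def by auto
  note vp = vertex_persists[OF assms(1,3) this(1)] vertex_persists[OF assms(2,4) this(2)]
  obtain X where X: "X \<in> uniform m" "v \<in> X" using vp(1) by blast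
  obtain X' where X': "X' \<in> uniform m" "v' \<in> X'" using vp(2) by blast
  have "0 \<le> m" using FT_edge(4)[OF assms(1)] m_def by auto
  then have f: "face_to_face X X'" using uniform_face X X' by blast
  have p: "proper_simplex X" "proper_simplex X'" using X X' FT_proper unfolding uniform_iff by auto
  have "fst v \<in> tag_hull X" using X by (auto intro: hull_inc)
  moreover have "fst v' \<in> tag_hull X'" using X' by (auto intro: hull_inc)
  ultimately have "fst v \<in> tag_hull (X \<inter> X')" using f assms(5) unfolding face_to_face_def by auto
  then have "v \<in> X \<inter> X'" by (intro proper_simplex_vertex_in_face[OF p(1) _ X(2)]) auto
  then show ?thesis using p(2) X'(2) assms(5) unfolding proper_simplex_def by (auto dest: inj_onD)
qed

lemma bse_pts_subset_iff:
  assumes "T \<in> FT" "T' \<in> FT"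
  shows "bse_pts N T \<subseteq> fst ` T' \<longleftrightarrow> edge N T \<subseteq> T'"
proof
  assume a: "bse_pts N T \<subseteq> fst ` T'"
  show "edge N T \<subseteq> T'"
  proof
    fix v assume v: "v \<in> edge N T"
    then obtain v' where "v' \<in> T'" "fst v = fst v'" using a unfolding bse_pts_edge by auto
    then show "v \<in> T'" using tag_unique[OF assms, of v v'] v edge_subset[OF assms(1)] by auto
  qed
qed (auto simp: bse_pts_edge)

lemma bse_pts_eq_iff:
  assumes "T \<in> FT" "T' \<in> FT"
  shows "bse_pts N T = bse_pts N T' \<longleftrightarrow> edge N T = edge N T'"
proof
  assume a: "bse_pts N T = bse_pts N T'"
  have "edge N T \<subseteq> edge N T'" if F: "T \<in> FT" "T' \<in> FT" "bse_pts N T = bse_pts N T'" for T T'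
  proof
    fix v assume v: "v \<in> edge N T"
    then obtain v' where v': "v' \<in> edge N T'" "fst v = fst v'" using F(3) unfolding bse_pts_edge by blast
    then show "v \<in> edge N T'" using tag_unique[OF F(1,2), of v v'] v
        edge_subset[OF F(1)] edge_subset[OF F(2)] by auto
  qed
  then show "edge N T = edge N T'" using assms a by blast
qed (simp add: bse_pts_edge)

lemma omega_iff:
  assumes "T \<in> FT" "\<T> \<subseteq> FT"
  shows "omega \<T> (bse_pts N T) = {X \<in> \<T>. edge N T \<subseteq> X}"
  unfolding omega_def using bse_pts_subset_iff[OF assms(1)] assms(2) by blast

lemma descendant_refl: "descendant N T T"
  by (simp add: descendant_def)

lemma descendant_trans: "descendant N X Y \<Longrightarrow> descendant N Y Z \<Longrightarrow> descendant N X Z"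
  unfolding descendant_def by (rule rtranclp_trans)

lemma descendant_child: "C \<in> children N T \<Longrightarrow> descendant N T C"
  unfolding descendant_def by auto

lemma descendant_FT:
  assumes "descendant N Y X" "Y \<in> FT"
  shows "X \<in> FT \<and> tag_hull X \<subseteq> tag_hull Y \<and> (X = Y \<or> gm N Y < gm N X)"
  using assms(1) unfolding descendant_def
proof (induction rule: rtranclp_induct)
  case base then show ?case using assms by auto
next
  case (step Z X)
  then show ?case using FT.child child_hull[of Z X] FT_edge(8)[of Z X] by auto
qed

text \<open>While the bisection edge of \<open>T\<close> is a different one, some child still
  contains the edge of \<open>Y\<close>. Along these children \<open>gm\<close> grows but cannot
  exceed \<open>gm N Y\<close>, so the descent ends at a simplex whose own bisection edge it
  is.\<close>

lemma edge_persists: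
  assumes "T \<in> FT" "Y \<in> FT" "edge N Y \<subseteq> T"
  shows "\<exists>X. descendant N T X \<and> edge N X = edge N Y"
  using assms
proof (induction "nat (gm N Y - gm N T)" arbitrary: T rule: less_induct)
  case less
  show ?case
  proof (cases "edge N T = edge N Y")
    case True then show ?thesis using descendant_refl by blast
  next
    case False
    then have g: "gm N T < gm N Y" using edge_in_simplex[OF less(2-4)] by auto
    have "\<not> edge N T \<subseteq> edge N Y"
      using False FT_edge(3)[OF less(2)] by (auto simp: edge_def)
    then obtain C where C: "C \<in> children N T" "edge N Y \<subseteq> C" using child_containing[OF less(2,4)] by auto
    have "gm N T < gm N C" using FT_edge(8)[OF less(2) C(1)] .
    then obtain X where "descendant N C X" "edge N X = edge N Y"
      using less(1)[OF _ FT.child[OF less(2) C(1)] less(3) C(2)] g by auto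
    then show ?thesis using descendant_trans[OF descendant_child[OF C(1)]] by blast
  qed
qed

text \<open>The closed sets of simplices are the sets of all bisected simplices of the elements of
  \<^term>\<open>BB N R\<close>; union and intersection of closed sets give the lattice operations.\<close>

definition closed_forest :: "'n tsimplex set \<Rightarrow> bool" where
  "closed_forest I \<longleftrightarrow> finite I \<and> I \<subseteq> FT \<and> (\<forall>Y\<in>FT. \<forall>X\<in>children N Y. X \<in> I \<longrightarrow> Y \<in> I) \<and>
     (\<forall>X\<in>I. \<forall>Y\<in>FT. edge N Y = edge N X \<longrightarrow> Y \<in> I)"

lemma closed_forestD:
  assumes "closed_forest I"
  shows "finite I" "I \<subseteq> FT" "\<And>X Y. Y \<in> FT \<Longrightarrow> X \<in> children N Y \<Longrightarrow> X \<in> I \<Longrightarrow> Y \<in> I"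
    "\<And>X Y. X \<in> I \<Longrightarrow> Y \<in> FT \<Longrightarrow> edge N Y = edge N X \<Longrightarrow> Y \<in> I"
  using assms unfolding closed_forest_def by blast+

lemma closed_descendant:
  assumes I: "closed_forest I" and "descendant N Y X" "X \<in> I" "Y \<in> FT"
  shows "Y \<in> I"
  using assms(2,3,4) unfolding descendant_def
proof (induction rule: converse_rtranclp_induct)
  case (step Y Z)
  then show ?case using closed_forestD(3)[OF I] FT.child by blast
qed

lemma leaf_above:
  assumes "T \<in> FT" "T \<notin> I"
  shows "\<exists>Y\<in>leaves I. descendant N Y T"
  using assms
proof induction
  case (root T)
  then show ?case using descendant_refl unfolding leaves_def by blast
next
  case (child T C)
  show ?case
  proof (cases "T \<in> I")
    case True
    then show ?thesis using child descendant_refl[of C] unfolding leaves_def by blast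
  next
    case False
    then show ?thesis using child descendant_trans descendant_child by blast
  qed
qed

text \<open>Otherwise some descendant of the leaf has the bisection edge of \<open>Y\<close>.
  Closure under shared edges puts that descendant into \<open>I\<close>, and closure under parents
  then puts the leaf itself into \<open>I\<close>.\<close>

lemma closed_edge_leaf:
  assumes I: "closed_forest I" and T: "T \<in> leaves I" and Y: "Y \<in> I"
  shows "\<not> edge N Y \<subseteq> T"
proof
  assume a: "edge N Y \<subseteq> T"
  have TF: "T \<in> FT" "T \<notin> I" "Y \<in> FT" using T Y closed_forestD(2)[OF I] leaves_FT unfolding leaves_def by blast+
  obtain X where X: "descendant N T X" "edge N X = edge N Y" using edge_persists[OF TF(1,3) a] by auto
  have "X \<in> I" using closed_forestD(4)[OF I Y] descendant_FT[OF X(1) TF(1)] X(2) by auto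
  then show False using closed_descendant[OF I X(1) _ TF(1)] TF by auto
qed

text \<open>Induction along the ancestors of \<open>X\<close>, starting from the uniform partition just before \<open>T\<close> is
  bisected: no ancestor of \<open>X\<close> has its bisection edge in the leaf \<open>T\<close>.\<close>

lemma leaf_face_above:
  assumes I: "closed_forest I" and T: "T \<in> leaves I"
    and "X \<in> I \<union> leaves I" "gm N T \<le> gm N X"
  shows "face_to_face X T"
  using assms(3,4)
proof (induction "nat (gm N X)" arbitrary: X rule: less_induct)
  case less
  have TF: "T \<in> FT" using T closed_forestD(2)[OF I] leaves_FT by auto
  have XF: "X \<in> FT" using less.prems closed_forestD(2)[OF I] leaves_FT by auto
  have T0: "T \<in> uniform (gm N T - 1)" "0 \<le> gm N T - 1" using FT_uniform[OF TF] FT_edge(4)[OF TF] by auto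
  have "X \<in> R \<or> (\<exists>Y\<in>I. X \<in> children N Y)"
  proof (cases "X \<in> I")
    case True
    then show ?thesis using closed_forestD(3)[OF I] by (cases rule: FT_cases[OF XF]) blast+
  next
    case False
    then show ?thesis using less.prems unfolding leaves_def by auto
  qed
  then show ?case
  proof
    assume "X \<in> R"
    then have "X \<in> uniform (gm N T - 1)" unfolding uniform_iff using XF less.prems by auto
    then show ?thesis using uniform_face[OF T0(2)] T0(1) by blast
  next
    assume "\<exists>Y\<in>I. X \<in> children N Y"
    then obtain Y where Y: "Y \<in> I" "X \<in> children N Y" by auto
    have YF: "Y \<in> FT" using Y closed_forestD(2)[OF I] by auto
    have g: "gm N Y < gm N X" using FT_edge(8)[OF YF Y(2)] .
    show ?thesis
    proof (cases "gm N Y < gm N T")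
      case True
      then have "X \<in> uniform (gm N T - 1)" unfolding uniform_iff using XF YF Y less.prems by auto
      then show ?thesis using uniform_face[OF T0(2)] T0(1) by blast
    next
      case False
      have "face_to_face Y T"
        by (rule less(1)) (use g Y False FT_edge(4)[OF YF] in auto)
      then show ?thesis using face_child[OF YF Y(2)] closed_edge_leaf[OF I T Y(1)] by blast
    qed
  qed
qed

lemma leaves_face:
  assumes "closed_forest I" "T \<in> leaves I" "X \<in> leaves I"
  shows "face_to_face X T"
proof (cases "gm N T \<le> gm N X")
  case True then show ?thesis using leaf_face_above[OF assms(1,2)] assms(3) by auto
next
  case False
  then have "face_to_face T X" using leaf_face_above[OF assms(1,3)] assms(2) by auto
  then show ?thesis using face_to_face_commute by blast
qed

text \<open>The point of \<open>v\<close> lies in the hulls of \<open>A\<close> and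
  \<open>X\<close>, hence in their common face, and a vertex of \<open>X\<close> lying in a face of
  \<open>X\<close> is a vertex of that face.\<close>

lemma leaf_vertex_of_descendant:
  assumes I: "closed_forest I" and A: "A \<in> leaves I" and X: "X \<in> leaves I"
    and d: "descendant N A Y" and v: "v \<in> Y" "v \<in> X"
  shows "v \<in> A"
proof -
  have F: "A \<in> FT" "X \<in> FT" using A X closed_forestD(2)[OF I] leaves_FT by auto
  have "fst v \<in> tag_hull A" using descendant_FT[OF d F(1)] v(1) by (auto intro: hull_inc)
  moreover have "fst v \<in> tag_hull X" using v by (auto intro: hull_inc)
  ultimately have "fst v \<in> tag_hull (X \<inter> A)"
    using leaves_face[OF I A X] unfolding face_to_face_def by auto
  then have "v \<in> X \<inter> A" by (intro proper_simplex_vertex_in_face[OF FT_proper[OF F(2)] _ v(2)]) auto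
  then show ?thesis by simp
qed

lemma leaves_antichain:
  assumes I: "closed_forest I" and A: "A \<in> leaves I" and X: "X \<in> leaves I" and d: "descendant N A X"
  shows "X = A"
proof -
  have F: "A \<in> FT" "X \<in> FT" using A X closed_forestD(2)[OF I] leaves_FT by auto
  have "X \<subseteq> A" using leaf_vertex_of_descendant[OF I A X d] by auto
  then show ?thesis using FT_proper[OF F(1)] FT_proper[OF F(2)] card_subset_eq[of A X]
    unfolding proper_simplex_def by auto
qed

text \<open>The definition of \<open>leaves\<close> only says that \<open>X\<close> is a root or has
  some parent in \<open>I\<close>. A different parent outside \<open>I\<close> would have a leaf
  strictly above \<open>X\<close>, against \<open>leaves_antichain\<close>.\<close>

lemma leaf_parent:
  assumes I: "closed_forest I" and X: "X \<in> leaves I" "Y \<in> FT" "X \<in> children N Y"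
  shows "Y \<in> I"
proof (rule ccontr)
  assume "Y \<notin> I"
  then obtain A where A: "A \<in> leaves I" "descendant N A Y" using leaf_above[OF X(2)] by blast
  have F: "A \<in> FT" using A closed_forestD(2)[OF I] leaves_FT by auto
  have "X = A" using leaves_antichain[OF I A(1) X(1)] descendant_trans[OF A(2) descendant_child[OF X(3)]] by auto
  then show False using descendant_FT[OF A(2) F] FT_edge(8)[OF X(2,3)] by auto
qed

lemma finite_children: "finite (children N T)"
  by (simp add: children_def)

text \<open>The point is that no child of a simplex in \<open>D\<close> belongs to \<open>I\<close>
  or \<open>D\<close>: in \<open>I\<close> it would bring its parent along, and in \<open>D\<close>
  it would have the same bisection edge as its parent and thus the same generation.\<close>

lemma leaves_extend:
  assumes I: "closed_forest I" and D: "D \<subseteq> leaves I" "\<And>X. X \<in> D \<Longrightarrow> edge N X = e"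
  shows "(leaves I - D) \<union> \<Union> (children N ` D) = leaves (I \<union> D)"
proof -
  have DF: "D \<subseteq> FT" "D \<inter> I = {}" using D closed_forestD(2)[OF I] leaves_FT unfolding leaves_def by blast+
  have "C \<notin> I \<union> D" if X: "X \<in> D" "C \<in> children N X" for X C
  proof
    assume C: "C \<in> I \<union> D"
    have XF: "X \<in> FT" using X DF by auto
    have "C \<notin> I" using closed_forestD(3)[OF I XF X(2)] X DF by auto
    then have CD: "C \<in> D" using C by auto
    then have "edge N X \<subseteq> C" using D(2)[OF X(1)] D(2)[of C] DF edge_subset[of C] by auto
    then show False using edge_in_simplex[of C X] XF CD DF FT_edge(8)[OF XF X(2)] by auto
  qed
  then show ?thesis unfolding leaves_def using DF by blast
qed

text \<open>Bisecting the complete star of a compatible edge keeps the set closed. For closure under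
  shared edges, take the leaf \<open>A\<close> above a simplex \<open>Y\<close> with that edge:
  \<open>A\<close> already contains both endpoints, so it is in the star and is bisected at the same
  edge. Equal generations then give \<open>Y = A\<close>.\<close>

lemma closed_extend:
  assumes I: "closed_forest I" and T: "T \<in> leaves I"
    and e: "\<forall>X\<in>leaves I. edge N T \<subseteq> X \<longrightarrow> edge N X = edge N T"
  shows "closed_forest (I \<union> {X \<in> leaves I. edge N T \<subseteq> X})"
  unfolding closed_forest_def
proof (intro conjI ballI impI)
  let ?D = "{X \<in> leaves I. edge N T \<subseteq> X}"
  note C = closed_forestD[OF I]
  have "finite (leaves I)" using C(1) finite_R finite_children unfolding leaves_def by auto
  then show "finite (I \<union> ?D)" using C(1) by auto
  show "I \<union> ?D \<subseteq> FT" using C(2) leaves_FT by blast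
  show "Y \<in> I \<union> ?D" if "Y \<in> FT" "X \<in> children N Y" "X \<in> I \<union> ?D" for X Y
    using that C(3) leaf_parent[OF I] by blast
  show "Y \<in> I \<union> ?D" if X: "X \<in> I \<union> ?D" "Y \<in> FT" "edge N Y = edge N X" for X Y
  proof (cases "X \<in> I \<or> Y \<in> I")
    case True
    then show ?thesis using C(4)[of X Y] X(2,3) by blast
  next
    case False
    then have XD: "X \<in> leaves I" "edge N X = edge N T" using X e by auto
    obtain A where A: "A \<in> leaves I" "descendant N A Y" using leaf_above[OF X(2)] False by blast
    have AF: "A \<in> FT" "X \<in> FT" using A XD C(2) leaves_FT by auto
    have "edge N X \<subseteq> A"
    proof
      fix v assume "v \<in> edge N X"
      then have "v \<in> Y" "v \<in> X" using X(3) edge_subset[OF X(2)] edge_subset[OF AF(2)] by blast+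
      then show "v \<in> A" by (rule leaf_vertex_of_descendant[OF I A(1) XD(1) A(2)])
    qed
    then have "edge N A = edge N X" using e A XD by auto
    then have "gm N A = gm N Y" using edge_in_simplex[OF AF(1) X(2)] X(3) edge_subset[OF AF(1)] by auto
    then have "Y = A" using descendant_FT[OF A(2) AF(1)] by auto
    then show ?thesis using A \<open>edge N X \<subseteq> A\<close> XD by auto
  qed
qed

section \<open>Runs of the refinement procedure as growing closed sets\<close>

lemma leaves_mono: "I \<subseteq> J \<Longrightarrow> I \<union> leaves I \<subseteq> J \<union> leaves J"
  unfolding leaves_def by blast

text \<open>\<open>T\<close> is not assumed to be a leaf, so that the induction applies to the outer
  call after a recursive one. The condition \<open>T \<in> I \<union> leaves I\<close> passes from
  \<open>I\<close> to larger closed sets and guarantees that \<open>T\<close> ends up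
  bisected.\<close>

lemma refine_run_closed:
  assumes "refine_run N \<T> T \<T>'" "T \<in> FT" "closed_forest I" "\<T> = leaves I"
  shows "\<exists>I'. closed_forest I' \<and> \<T>' = leaves I' \<and> I \<subseteq> I' \<and> (T \<in> I \<union> leaves I \<longrightarrow> T \<in> I')"
  using assms
proof (induction arbitrary: I rule: refine_run.induct)
  case (split \<T> T)
  let ?D = "{X \<in> leaves I. edge N T \<subseteq> X}"
  have LF: "leaves I \<subseteq> FT" using closed_forestD(2)[OF split(3)] leaves_FT by auto
  have om: "omega \<T> (bse_pts N T) = ?D" using omega_iff[OF split(2) LF] split(4) by simp
  have e: "edge N X = edge N T" if "X \<in> ?D" for X
  proof -
    have "X \<in> FT" using that LF by auto
    then show ?thesis using split(1) that unfolding om using bse_pts_eq_iff[OF _ split(2)] by blast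
  qed
  have TD: "T \<in> leaves I \<Longrightarrow> T \<in> ?D" using edge_subset[OF split(2)] by auto
  have ext: "(\<T> - ?D) \<union> \<Union> (children N ` ?D) = leaves (I \<union> ?D)" unfolding split(4)
    by (rule leaves_extend[OF split(3) _ e]) auto
  \<comment> \<open>The star is empty if no leaf contains the edge. Otherwise any member
    \<open>S\<close> is a leaf with the same bisection edge and can stand in for
    \<open>T\<close>.\<close>
  have "closed_forest (I \<union> ?D)"
  proof (cases "?D = {}")
    case True
    show ?thesis unfolding True using split(3) by simp
  next
    case False
    then obtain S where S: "S \<in> ?D" by blast
    have eS: "edge N S = edge N T" using e[OF S] .
    have "S \<in> leaves I" using S by blast
    moreover have "\<forall>X\<in>leaves I. edge N S \<subseteq> X \<longrightarrow> edge N X = edge N S" unfolding eS using e by blast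
    ultimately show ?thesis using closed_extend[OF split(3), of S] unfolding eS by blast
  qed
  then show ?case unfolding om ext using TD by blast
next
  case (recurse T' \<T> T \<T>1 \<T>2)
  have "T' \<in> leaves I" using recurse.hyps(1) recurse.prems(3) unfolding omega_def by auto
  then have "T' \<in> FT" using closed_forestD(2)[OF recurse.prems(2)] leaves_FT by auto
  then obtain I1 where I1: "closed_forest I1" "\<T>1 = leaves I1" "I \<subseteq> I1"
    using recurse.IH(1)[OF _ recurse.prems(2,3)] by auto
  then obtain I2 where I2: "closed_forest I2" "\<T>2 = leaves I2" "I1 \<subseteq> I2" "T \<in> I1 \<union> leaves I1 \<longrightarrow> T \<in> I2"
    using recurse.IH(2)[OF recurse.prems(1)] by blast
  then show ?case using I1(3) leaves_mono[OF I1(3)] by blast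
qed

lemma finite_below: "finite {T \<in> FT. gm N T \<le> m}"
proof -
  have "finite {T \<in> FT. gm N T \<le> int j}" for j
  proof (induction j)
    case 0
    have "{T \<in> FT. gm N T \<le> int 0} = {}" using FT_edge(4) by force
    then show ?case by (simp only: finite.emptyI)
  next
    case (Suc j)
    have "{T \<in> FT. gm N T \<le> int (Suc j)} \<subseteq> R \<union> \<Union> (children N ` {T \<in> FT. gm N T \<le> int j})"
    proof
      fix T assume "T \<in> {T \<in> FT. gm N T \<le> int (Suc j)}"
      then have T: "T \<in> FT" "gm N T \<le> int j + 1" by auto
      show "T \<in> R \<union> \<Union> (children N ` {T \<in> FT. gm N T \<le> int j})"
        using T(2) by (cases rule: FT_cases[OF T(1)]) force+
    qed
    moreover have "finite (R \<union> \<Union> (children N ` {T \<in> FT. gm N T \<le> int j}))"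
      using Suc finite_R finite_children by auto
    ultimately show ?case using finite_subset by blast
  qed
  from this[of "nat m"] show ?thesis by (rule rev_finite_subset) auto
qed

text \<open>A lexicographic induction. The recursive call lowers \<open>gm N T\<close>. The repeated
  outer call keeps \<open>T\<close>, but meanwhile \<open>T'\<close> has been bisected, so fewer of
  the finitely many simplices with generation at most \<open>gm N T\<close> are outstanding.\<close>

lemma refine_terminates_leaves:
  assumes "T \<in> FT" "closed_forest I"
  shows "refine_terminates N (leaves I) T"
  using assms
proof (induction "nat (gm N T)" arbitrary: T I rule: less_induct)
  case less
  note outer = less
  show ?case using less.prems(2)
  proof (induction "card ({X \<in> FT. gm N X \<le> gm N T} - I)" arbitrary: I rule: less_induct)
    case less
    have LF: "leaves I \<subseteq> FT" using closed_forestD(2)[OF less(2)] leaves_FT by auto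
    show ?case
    proof (rule refine_terminates.intros, intro ballI impI conjI allI)
      fix T' assume T': "T' \<in> omega (leaves I) (bse_pts N T)" and ne: "bse_pts N T' \<noteq> bse_pts N T"
      have T'l: "T' \<in> leaves I" "edge N T \<subseteq> T'" using T' omega_iff[OF outer(2) LF] by auto
      have F: "T' \<in> FT" using T'l LF by auto
      have "edge N T' \<noteq> edge N T" using ne bse_pts_eq_iff[OF F outer(2)] by auto
      then have g: "gm N T' < gm N T" using edge_in_simplex[OF F outer(2) T'l(2)] by auto
      then show "refine_terminates N (leaves I) T'"
        using outer(1)[OF _ F less(2)] FT_edge(4)[OF F] by auto
      fix \<T>1 assume "refine_run N (leaves I) T' \<T>1"
      then obtain I1 where I1: "closed_forest I1" "\<T>1 = leaves I1" "I \<subseteq> I1" "T' \<in> I1"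
        using refine_run_closed[OF _ F less(2) refl] T'l by blast
      have "T' \<notin> I" using T'l unfolding leaves_def by auto
      then have "{X \<in> FT. gm N X \<le> gm N T} - I1 \<subset> {X \<in> FT. gm N X \<le> gm N T} - I"
        using I1 F g by auto
      then have "card ({X \<in> FT. gm N X \<le> gm N T} - I1) < card ({X \<in> FT. gm N X \<le> gm N T} - I)"
        by (intro psubset_card_mono finite_Diff finite_below)
      then show "refine_terminates N \<T>1 T" using less(1)[OF _ I1(1)] I1(2) by auto
    qed
  qed
qed

text \<open>The last step is undone: among the simplices of \<open>I\<close> with maximal bisection
  generation, remove all those sharing one edge. The rest stays closed, because a removed simplex
  with a child left in \<open>I\<close> would contradict maximality, and a single call of the
  procedure that splits immediately restores the removed star.\<close>

lemma closed_in_BB: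
  assumes "closed_forest I"
  shows "leaves I \<in> BB N R"
  using assms
proof (induction "card I" arbitrary: I rule: less_induct)
  case less
  note C = closed_forestD[OF less(2)]
  show ?case
  proof (cases "I = {}")
    case True
    then show ?thesis using BB.base[of R N] by (simp add: leaves_def)
  next
    case False
    define g where "g = Max (gm N ` I)"
    have "g \<in> gm N ` I" unfolding g_def using C(1) False by (intro Max_in) auto
    then obtain T where T: "T \<in> I" "gm N T = g" by auto
    have gmax: "gm N X \<le> g" if "X \<in> I" for X unfolding g_def using C(1) that by simp
    have TF: "T \<in> FT" using T C by auto
    define D where "D = {X \<in> I. edge N X = edge N T}"
    define J where "J = I - D"
    have gD: "gm N X = g" if "X \<in> D" for X
    proof -
      have "X \<in> FT" "edge N X = edge N T" using that C D_def by auto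
      then show ?thesis using edge_in_simplex[of X T] TF T edge_subset[of X] by auto
    qed
    have J: "closed_forest J" unfolding closed_forest_def
    proof (intro conjI ballI impI)
      show "finite J" "J \<subseteq> FT" using C J_def by auto
      show "Y \<in> J" if "Y \<in> FT" "X \<in> children N Y" "X \<in> J" for X Y
        using C(3)[OF that(1,2)] that(3) gD[of Y] gmax[of X] FT_edge(8)[OF that(1,2)] unfolding J_def by auto
      show "Y \<in> J" if "X \<in> J" "Y \<in> FT" "edge N Y = edge N X" for X Y
        using C(4)[of X Y] that unfolding J_def D_def by auto
    qed
    have DL: "D \<subseteq> leaves J"
    proof
      fix X assume X: "X \<in> D"
      then have XI: "X \<in> I" "X \<in> FT" using D_def C by auto
      show "X \<in> leaves J"
      proof (cases rule: FT_cases[OF XI(2)])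
        case 1 then show ?thesis using X unfolding leaves_def J_def by auto
      next
        case (2 Y)
        then have "Y \<in> I" using C(3) XI by blast
        moreover have "Y \<notin> D" using gD[of Y] gD[OF X] 2 by auto
        ultimately show ?thesis using 2 X unfolding leaves_def J_def by auto
      qed
    qed
    have LF: "leaves J \<subseteq> FT" using closed_forestD(2)[OF J] leaves_FT by auto
    have om: "omega (leaves J) (bse_pts N T) = D"
    proof -
      \<comment> \<open>A descendant of \<open>X\<close> is bisected at the edge of
        \<open>T\<close>, hence lies in \<open>I\<close>. So does \<open>X\<close>, and a leaf of
        \<open>J\<close> that lies in \<open>I\<close> must be one of the removed simplices.\<close>
      have "X \<in> D" if X: "X \<in> leaves J" "edge N T \<subseteq> X" for X
      proof -
        have XF: "X \<in> FT" using X LF by auto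
        obtain Z where Z: "descendant N X Z" "edge N Z = edge N T" using edge_persists[OF XF TF X(2)] by auto
        then have "Z \<in> I" using C(4)[OF T(1)] descendant_FT[OF Z(1) XF] by auto
        then have "X \<in> I" using closed_descendant[OF less(2) Z(1) _ XF] by auto
        then show ?thesis using X(1) unfolding leaves_def J_def by auto
      qed
      moreover have "edge N T \<subseteq> X" if "X \<in> D" for X
        using that C edge_subset[of X] unfolding D_def by auto
      ultimately show ?thesis unfolding omega_iff[OF TF LF] using DL by blast
    qed
    have "T \<in> D" using T D_def by auto
    then have "card J < card I" unfolding J_def using C(1) T(1) by (intro psubset_card_mono) auto
    then have "leaves J \<in> BB N R" using less(1) J by blast
    moreover have "T \<in> leaves J" using \<open>T \<in> D\<close> DL by auto
    moreover have "refine_run N (leaves J) T ((leaves J - omega (leaves J) (bse_pts N T)) \<union> \<Union> (children N ` omega (leaves J) (bse_pts N T)))"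
      by (rule refine_run.split, unfold om) (simp add: D_def bse_pts_edge)
    ultimately have "(leaves J - D) \<union> \<Union> (children N ` D) \<in> BB N R" unfolding om by (rule BB.step)
    moreover have "(leaves J - D) \<union> \<Union> (children N ` D) = leaves (J \<union> D)"
      by (rule leaves_extend[OF J DL, of "edge N T"]) (simp add: D_def)
    moreover have "J \<union> D = I" unfolding J_def D_def by auto
    ultimately show ?thesis by simp
  qed
qed

lemma BB_eq: "BB N R = leaves ` {I. closed_forest I}"
proof
  show "leaves ` {I. closed_forest I} \<subseteq> BB N R" using closed_in_BB by auto
  show "BB N R \<subseteq> leaves ` {I. closed_forest I}"
  proof
    fix \<T> assume "\<T> \<in> BB N R"
    then show "\<T> \<in> leaves ` {I. closed_forest I}"
    proof induction
      case base
      have "closed_forest {}" "leaves {} = R" by (auto simp: closed_forest_def leaves_def)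
      then show ?case by blast
    next
      case (step \<T> T \<T>')
      then obtain I where I: "closed_forest I" "\<T> = leaves I" by auto
      then have "T \<in> FT" using step(2) closed_forestD(2)[OF I(1)] leaves_FT by auto
      then show ?case using refine_run_closed[OF step(3) _ I] by blast
    qed
  qed
qed

text \<open>If \<open>X\<close> were in \<open>I\<close> but not in \<open>J\<close>, a leaf of
  \<open>J\<close> would lie above \<open>X\<close> and a leaf of \<open>I\<close> above that.
  Closure under parents would put this leaf of \<open>I\<close> into \<open>I\<close>.\<close>

lemma refines_iff:
  assumes I: "closed_forest I" and J: "closed_forest J"
  shows "refines N (leaves J) (leaves I) \<longleftrightarrow> I \<subseteq> J"
proof
  assume r: "refines N (leaves J) (leaves I)"
  show "I \<subseteq> J"
  proof (rule subsetI, rule ccontr)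
    fix X assume X: "X \<in> I" "X \<notin> J"
    then have XF: "X \<in> FT" using closed_forestD(2)[OF I] by auto
    obtain Y where Y: "Y \<in> leaves J" "descendant N Y X" using leaf_above[OF XF X(2)] by auto
    obtain Z where Z: "Z \<in> leaves I" "descendant N Z Y" using r Y unfolding refines_def by auto
    have "Z \<in> FT" using Z closed_forestD(2)[OF I] leaves_FT by auto
    then have "Z \<in> I" using closed_descendant[OF I descendant_trans[OF Z(2) Y(2)] X(1)] by auto
    then show False using Z unfolding leaves_def by auto
  qed
next
  assume IJ: "I \<subseteq> J"
  show "refines N (leaves J) (leaves I)" unfolding refines_def
  proof
    fix T assume T: "T \<in> leaves J"
    then have "T \<in> FT" using closed_forestD(2)[OF J] leaves_FT by blast
    moreover have "T \<notin> I" using T IJ unfolding leaves_def by blast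
    ultimately show "\<exists>T'\<in>leaves I. descendant N T' T" by (rule leaf_above)
  qed
qed

lemma closed_Un: "closed_forest I \<Longrightarrow> closed_forest J \<Longrightarrow> closed_forest (I \<union> J)"
  unfolding closed_forest_def by blast

lemma closed_Int: "closed_forest I \<Longrightarrow> closed_forest J \<Longrightarrow> closed_forest (I \<inter> J)"
  unfolding closed_forest_def by blast

lemma leaves_inj: "closed_forest I \<Longrightarrow> closed_forest J \<Longrightarrow> leaves I = leaves J \<longleftrightarrow> I = J"
  using refines_iff[of I J] refines_iff[of J I] refines_iff[of I I] by auto

section \<open>Conformity of the full uniform refinements\<close>

lemma conforming_uniform:
  assumes "Q \<subseteq> uniform m" "finite Q" "0 \<le> m"
  shows "conforming_triangulation (geom Q)"
proof -
  have p: "proper_simplex T" if "T \<in> Q" for T using that assms(1) FT_proper uniform_iff by blast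
  have f: "tag_hull T \<inter> tag_hull T' \<subseteq> tag_hull (T \<inter> T')" if "T \<in> Q" "T' \<in> Q" for T T'
    using uniform_face[OF assms(3)] that assms(1) unfolding face_to_face_def by blast
  have f': "tag_hull T \<inter> tag_hull T' = tag_hull (T \<inter> T')" if "T \<in> Q" "T' \<in> Q" for T T'
    using f[OF that] hull_mono[of "fst ` (T \<inter> T')" "fst ` T" convex]
      hull_mono[of "fst ` (T \<inter> T')" "fst ` T'" convex] by auto
  have c: "card (fst ` T) = CARD('n) + 1" if "T \<in> Q" for T
    using p[OF that] unfolding proper_simplex_def by (auto simp: card_image)
  show ?thesis unfolding conforming_triangulation_def geom_def
  proof (intro conjI ballI impI)
    show "finite ((`) fst ` Q)" using assms by simp
  next
    fix S assume "S \<in> (`) fst ` Q"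
    then show "finite S" "card S = CARD('n) + 1" "\<not> affine_dependent S"
      using p c unfolding proper_simplex_def by auto
  next
    fix S S' assume "S \<in> (`) fst ` Q" "S' \<in> (`) fst ` Q" and ne: "S \<noteq> S'"
    then obtain T T' where T: "T \<in> Q" "T' \<in> Q" "S = fst ` T" "S' = fst ` T'" by auto
    have fin: "finite T" "finite T'" "card T = CARD('n) + 1" "card T' = CARD('n) + 1"
      using p[OF T(1)] p[OF T(2)] unfolding proper_simplex_def by auto
    \<comment> \<open>Different simplices share at most \<open>n\<close> vertices, too few for a
      hull with interior points.\<close>
    have "T \<inter> T' \<noteq> T" using card_subset_eq[OF fin(2), of T] fin ne T by auto
    then have "card (T \<inter> T') < CARD('n) + 1" using psubset_card_mono[OF fin(1), of "T \<inter> T'"] fin by auto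
    then have "card (fst ` (T \<inter> T')) \<le> DIM(real^'n)"
      using card_image_le[of "T \<inter> T'" fst] fin by simp
    then have "interior (tag_hull (T \<inter> T')) = {}"
      by (intro empty_interior_convex_hull) (use fin in auto)
    then show "interior (convex hull S) \<inter> interior (convex hull S') = {}"
      unfolding T interior_Int[symmetric] using interior_mono[OF f[OF T(1,2)]] by auto
  next
    fix S S' assume "S \<in> (`) fst ` Q" "S' \<in> (`) fst ` Q"
    then obtain T T' where T: "T \<in> Q" "T' \<in> Q" "S = fst ` T" "S' = fst ` T'" by auto
    show "convex hull S \<inter> convex hull S' = {} \<or>
        (\<exists>W. W \<noteq> {} \<and> W \<subseteq> S \<inter> S' \<and> convex hull S \<inter> convex hull S' = convex hull W)"
      using f'[OF T(1,2)] unfolding T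
      by (cases "T \<inter> T' = {}") (auto intro!: exI[of _ "fst ` (T \<inter> T')"])
  qed
qed

lemma bisect_all_funpow:
  "X \<in> (bisect_all N ^^ j) R \<Longrightarrow>
    X \<in> FT \<and> maubach N (int (j div CARD('n))) (CARD('n) - j mod CARD('n)) X"
proof (induction j arbitrary: X)
  case 0
  then show ?case using root_maubach FT.root by auto
next
  case (Suc j)
  have "(bisect_all N ^^ Suc j) R = \<Union> (children N ` ((bisect_all N ^^ j) R))" by (simp add: bisect_all_def)
  then obtain Y where Y: "Y \<in> (bisect_all N ^^ j) R" "X \<in> children N Y" using Suc.prems by blast
  let ?n = "CARD('n)"
  have n: "?n > 0" by simp
  have IH: "Y \<in> FT" "maubach N (int (j div ?n)) (?n - j mod ?n) Y" using Suc.IH[OF Y(1)] by auto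
  note m = maubach_child(1)[OF N IH(2) Y(2)]
  have lt: "j mod ?n < ?n" using n by simp
  show ?case
  proof (cases "Suc (j mod ?n) = ?n")
    case True
    then have "Suc j mod ?n = 0" "Suc j div ?n = Suc (j div ?n)" by (auto simp: mod_Suc div_Suc)
    moreover have "?n - j mod ?n = 1" using True by linarith
    ultimately show ?thesis using m FT.child[OF IH(1) Y(2)] by (simp add: add.commute)
  next
    case False
    then have "Suc j mod ?n = Suc (j mod ?n)" "Suc j div ?n = j div ?n" by (auto simp: mod_Suc div_Suc)
    moreover have "?n - j mod ?n > 1" "?n - j mod ?n - 1 = ?n - Suc (j mod ?n)" using False lt by linarith+
    ultimately show ?thesis using m FT.child[OF IH(1) Y(2)] by (auto simp: add.commute)
  qed
qed

lemma finite_bisect_all: "finite ((bisect_all N ^^ j) R)"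
  by (induction j) (auto simp: finite_R bisect_all_def finite_children)

text \<open>After \<open>q\<close> full rounds every simplex has index \<open>L = q\<close>, hence
  bisection generation above \<open>N * q\<close>. Its parent in the last round has index
  \<open>q - 1\<close> and generation at most \<open>N * q\<close>, so this threshold separates the
  two.\<close>

lemma bisect_all_uniform:
  "(bisect_all N ^^ (CARD('n) * q)) R \<subseteq> uniform (int N * int q)"
proof
  fix X assume X: "X \<in> (bisect_all N ^^ (CARD('n) * q)) R"
  have n: "CARD('n) > 0" by simp
  have XF: "X \<in> FT" "maubach N (int q) CARD('n) X" using bisect_all_funpow[OF X] n by auto
  have g: "int N * int q < gm N X" using maubach_edge(4)[OF N XF(2)] .
  show "X \<in> uniform (int N * int q)"
  proof (cases q)
    case 0 then show ?thesis using X XF g unfolding uniform_iff by auto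
  next
    case (Suc r)
    define j where "j = CARD('n) * q - 1"
    have j: "CARD('n) * q = Suc j" using n unfolding j_def Suc by simp
    have "(bisect_all N ^^ Suc j) R = \<Union> (children N ` ((bisect_all N ^^ j) R))" by (simp add: bisect_all_def)
    then obtain Y where Y: "Y \<in> (bisect_all N ^^ j) R" "X \<in> children N Y" using X unfolding j by blast
    have "j = r * CARD('n) + (CARD('n) - 1)" using j Suc n by (auto simp: algebra_simps)
    then have "j div CARD('n) = r" using n by (metis add.right_neutral div_less div_mult_self3 diff_less less_not_refl zero_less_one)
    then have "gm N Y \<le> int N * int r + int N"
      using bisect_all_funpow[OF Y(1)] maubach_edge(5)[OF N] by auto
    then have "gm N Y \<le> int N * int q" using Suc by (simp add: algebra_simps)
    then show ?thesis unfolding uniform_iff using XF g Y bisect_all_funpow[OF Y(1)] by auto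
  qed
qed

end

section \<open>Similarity classes\<close>

text \<open>
  With \<open>d\<close> the edge vectors along the path through the vertices \<open>0..n\<close>, the part of the path beyond
  vertex \<open>k\<close> has already been halved.
\<close>

definition kuhn_pt :: "nat \<Rightarrow> (nat \<Rightarrow> 'a::real_vector) \<Rightarrow> nat \<Rightarrow> 'a" where
  "kuhn_pt k d i = (if i \<le> k then 1 else 1/2) *\<^sub>R (\<Sum>l<i. d l)"

definition signed_perms :: "nat \<Rightarrow> (nat \<Rightarrow> 'a::real_vector) \<Rightarrow> (nat \<Rightarrow> 'a) set" where
  "signed_perms n a = (\<lambda>(\<sigma>, E) l. if l \<in> E then - a (\<sigma> l) else a (\<sigma> l)) `
     ({\<sigma>. \<sigma> permutes {..<n}} \<times> Pow {..<n})"

lemma signed_permsE: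
  assumes "d \<in> signed_perms n a"
  obtains \<sigma> E where "\<sigma> permutes {..<n}" "E \<subseteq> {..<n}" "d = (\<lambda>l. if l \<in> E then - a (\<sigma> l) else a (\<sigma> l))"
  using assms unfolding signed_perms_def by auto

lemma signed_permsI:
  assumes "\<sigma> permutes {..<n}" "E \<subseteq> {..<n}"
  shows "(\<lambda>l. if l \<in> E then - a (\<sigma> l) else a (\<sigma> l)) \<in> signed_perms n a"
  unfolding signed_perms_def by (rule image_eqI[of _ _ "(\<sigma>, E)"]) (use assms in auto)

lemma finite_signed_perms: "finite (signed_perms n a)"
  unfolding signed_perms_def by (intro finite_imageI finite_cartesian_product) (auto simp: finite_permutations)

lemma card_signed_perms: "card (signed_perms n a) \<le> fact n * 2 ^ n"
proof -
  have f: "finite ({\<sigma>. \<sigma> permutes {..<n}} \<times> Pow {..<n})"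
    by (intro finite_cartesian_product) (auto simp: finite_permutations)
  have "card (signed_perms n a) \<le> card ({\<sigma>. \<sigma> permutes {..<n}} \<times> Pow {..<n})"
    unfolding signed_perms_def by (rule card_image_le[OF f])
  also have "\<dots> = fact n * 2 ^ n"
    using card_permutations[of "{..<n}" n] by (simp add: card_cartesian_product card_Pow)
  finally show ?thesis .
qed

lemma signed_perms_self: "a \<in> signed_perms n a"
  using signed_permsI[OF permutes_id, of "{}" n a] by simp

text \<open>Since \<open>a\<close> vanishes from \<open>n\<close> on, signs at those places have no
  effect. This lets \<open>F\<close> be any set, in particular \<open>UNIV\<close> for the negation
  of the whole sequence.\<close>

lemma signed_perms_act:
  assumes a: "\<And>l. n \<le> l \<Longrightarrow> a l = 0" and d: "d \<in> signed_perms n a" and \<tau>: "\<tau> permutes {..<n}"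
  shows "(\<lambda>l. if l \<in> F then - d (\<tau> l) else d (\<tau> l)) \<in> signed_perms n a"
proof -
  obtain \<sigma> E where s: "\<sigma> permutes {..<n}" "E \<subseteq> {..<n}" "d = (\<lambda>l. if l \<in> E then - a (\<sigma> l) else a (\<sigma> l))"
    using signed_permsE[OF d] .
  define E' where "E' = {l. l < n \<and> (l \<in> F) \<noteq> (\<tau> l \<in> E)}"
  have st: "(\<sigma> \<circ> \<tau>) permutes {..<n}" using permutes_compose[OF \<tau> s(1)] .
  have "(\<lambda>l. if l \<in> F then - d (\<tau> l) else d (\<tau> l)) = (\<lambda>l. if l \<in> E' then - a ((\<sigma> \<circ> \<tau>) l) else a ((\<sigma> \<circ> \<tau>) l))"
  proof
    fix l
    show "(if l \<in> F then - d (\<tau> l) else d (\<tau> l)) = (if l \<in> E' then - a ((\<sigma> \<circ> \<tau>) l) else a ((\<sigma> \<circ> \<tau>) l))"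
    proof (cases "l < n")
      case True then show ?thesis by (auto simp: s(3) E'_def)
    next
      case False
      then have "a (\<sigma> (\<tau> l)) = 0" using permutes_not_in[OF st, of l] a[of l] by simp
      then show ?thesis by (simp add: s(3))
    qed
  qed
  then show ?thesis using signed_permsI[OF st, of E' a] by (auto simp: E'_def)
qed

lemma permutes_lessThanI:
  fixes \<tau> :: "nat \<Rightarrow> nat"
  assumes "\<And>l. l < n \<Longrightarrow> \<tau> l < n" "\<And>l m. l < n \<Longrightarrow> m < n \<Longrightarrow> \<tau> l = \<tau> m \<Longrightarrow> l = m" "\<And>l. n \<le> l \<Longrightarrow> \<tau> l = l"
  shows "\<tau> permutes {..<n}"
proof (rule bij_imp_permutes)
  have "inj_on \<tau> {..<n}" using assms(2) by (auto intro: inj_onI)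
  moreover have "\<tau> ` {..<n} = {..<n}"
    by (rule endo_inj_surj) (use assms(1) calculation in auto)
  ultimately show "bij_betw \<tau> {..<n} {..<n}" by (simp add: bij_betw_def)
qed (use assms(3) in auto)

text \<open>The step sequence of the child that loses vertex \<open>0\<close>, with the old vertex
  \<open>1\<close> as base point. The entry \<open>- d 0\<close> is twice the difference between the
  midpoint and half the old vertex \<open>k\<close>, both measured from the new base point; the
  factor two undoes the halving beyond place \<open>k - 1\<close>.\<close>

definition rotate_steps :: "nat \<Rightarrow> (nat \<Rightarrow> 'a::real_vector) \<Rightarrow> nat \<Rightarrow> 'a" where
  "rotate_steps k d l = (if l < k - 1 then d (Suc l) else if l = k - 1 then - d 0 else d l)"

definition reverse_steps :: "nat \<Rightarrow> (nat \<Rightarrow> 'a::real_vector) \<Rightarrow> nat \<Rightarrow> 'a" where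
  "reverse_steps k d l = (if l < k then - d (k - 1 - l) else d l)"

lemma signed_perms_rotate:
  assumes a: "\<And>l. n \<le> l \<Longrightarrow> a l = 0" and d: "d \<in> signed_perms n a" and k: "1 \<le> k" "k \<le> n"
  shows "rotate_steps k d \<in> signed_perms n a"
proof -
  define \<tau> where "\<tau> l = (if l < k - 1 then Suc l else if l = k - 1 then 0 else l)" for l :: nat
  have "\<tau> permutes {..<n}"
    by (rule permutes_lessThanI) (use k in \<open>auto simp: \<tau>_def split: if_splits\<close>)
  from signed_perms_act[OF a d this, of "{k - 1}"]
  show ?thesis by (rule back_subst[of "\<lambda>x. x \<in> _"]) (auto simp: \<tau>_def rotate_steps_def)
qed

lemma signed_perms_reverse:
  assumes a: "\<And>l. n \<le> l \<Longrightarrow> a l = 0" and d: "d \<in> signed_perms n a" and k: "1 \<le> k" "k \<le> n"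
  shows "reverse_steps k d \<in> signed_perms n a"
proof -
  define \<tau> where "\<tau> l = (if l < k then k - 1 - l else l)" for l :: nat
  have "\<tau> permutes {..<n}"
    by (rule permutes_lessThanI) (use k in \<open>auto simp: \<tau>_def split: if_splits\<close>)
  from signed_perms_act[OF a d this, of "{..<k}"]
  show ?thesis by (rule back_subst[of "\<lambda>x. x \<in> _"]) (auto simp: \<tau>_def reverse_steps_def)
qed

lemma signed_perms_uminus:
  assumes a: "\<And>l. n \<le> l \<Longrightarrow> a l = 0" and d: "d \<in> signed_perms n a"
  shows "(\<lambda>l. - d l) \<in> signed_perms n a"
  using signed_perms_act[OF a d permutes_id, of UNIV] by simp

lemma sum_rotate_steps:
  assumes "1 \<le> k"
  shows "(\<Sum>l<i. rotate_steps k d l) = (if i < k then (\<Sum>l<Suc i. d l) - d 0 else (\<Sum>l<i. d l) - 2 *\<^sub>R d 0)"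
proof (induction i)
  case 0 then show ?case using assms by simp
next
  case (Suc i)
  consider "Suc i < k" | "Suc i = k" | "k \<le> i" by linarith
  then show ?case
    by cases (use Suc in \<open>auto simp: rotate_steps_def scaleR_2\<close>)
qed

lemma sum_reverse_steps:
  shows "(\<Sum>l<i. reverse_steps k d l) =
    (if i \<le> k then (\<Sum>l<k - i. d l) - (\<Sum>l<k. d l) else (\<Sum>l<i. d l) - 2 *\<^sub>R (\<Sum>l<k. d l))"
proof (induction i)
  case 0 then show ?case by simp
next
  case (Suc i)
  consider "Suc i \<le> k" | "i = k" | "k < i" by linarith
  then show ?case
  proof cases
    case 1
    then have "k - i = Suc (k - Suc i)" by simp
    then have "(\<Sum>l<k - i. d l) = (\<Sum>l<k - Suc i. d l) + d (k - Suc i)" by (metis sum.lessThan_Suc)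
    then show ?thesis using Suc 1 by (simp add: reverse_steps_def)
  qed (use Suc in \<open>auto simp: reverse_steps_def scaleR_2\<close>)
qed

definition steps_distinct :: "nat \<Rightarrow> (nat \<Rightarrow> 'a::real_vector) \<Rightarrow> bool" where
  "steps_distinct n a \<longleftrightarrow> (\<forall>l<n. a l \<noteq> 0) \<and> (\<forall>l<n. \<forall>m<n. l \<noteq> m \<longrightarrow> a l \<noteq> a m \<and> a l \<noteq> - a m)"

lemma real_vector_eq_uminus_self: "x = - x \<longleftrightarrow> x = 0" for x :: "'a::real_vector"
proof
  assume "x = - x"
  then have "x + x = 0" by (metis add.right_inverse)
  then have "2 *\<^sub>R x = 0" by (simp add: scaleR_2)
  then show "x = 0" by simp
qed simp

lemma signed_perms_distinct:
  assumes a: "steps_distinct n a" and d: "d \<in> signed_perms n a"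
  shows "steps_distinct n d"
proof -
  obtain \<sigma> E where s: "\<sigma> permutes {..<n}" "E \<subseteq> {..<n}" "d = (\<lambda>l. if l \<in> E then - a (\<sigma> l) else a (\<sigma> l))"
    using signed_permsE[OF d] .
  have lt: "\<sigma> l < n" if "l < n" for l using permutes_in_image[OF s(1), of l] that by simp
  have ne: "\<sigma> l \<noteq> \<sigma> m" if "l \<noteq> m" for l m using permutes_inj[OF s(1)] that by (auto dest: injD)
  show ?thesis unfolding steps_distinct_def
  proof (intro conjI allI impI)
    fix l assume "l < n" then show "d l \<noteq> 0" using a lt unfolding steps_distinct_def s(3) by auto
  next
    fix l m assume lm: "l < n" "m < n" "l \<noteq> m"
    have "a (\<sigma> l) \<noteq> a (\<sigma> m) \<and> a (\<sigma> l) \<noteq> - a (\<sigma> m)"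
      using a lt[OF lm(1)] lt[OF lm(2)] ne[OF lm(3)] unfolding steps_distinct_def by blast
    moreover from this have "- a (\<sigma> l) \<noteq> a (\<sigma> m)" by (metis minus_minus)
    ultimately show "d l \<noteq> d m" "d l \<noteq> - d m" unfolding s(3) by simp_all
  qed
qed

text \<open>The orbit of a vertex set under translations and point reflections. Scale and base point
  are absent because \<open>kuhn_pt\<close> is already normalised.\<close>

definition flat_class :: "'a::real_vector set \<Rightarrow> 'a set set" where
  "flat_class A = {B. \<exists>t. B = (\<lambda>x. t + x) ` A \<or> B = (\<lambda>x. t - x) ` A}"

lemma flat_class_self: "A \<in> flat_class A"
  unfolding flat_class_def by (auto intro!: exI[of _ 0])

lemma flat_class_plus: "flat_class ((\<lambda>x. u + x) ` A) = flat_class A"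
proof -
  have "B \<in> flat_class A" if "B \<in> flat_class ((\<lambda>x. u + x) ` A)" for B and A :: "'a set" and u
  proof -
    obtain t where "B = (\<lambda>x. t + x) ` (\<lambda>x. u + x) ` A \<or> B = (\<lambda>x. t - x) ` (\<lambda>x. u + x) ` A"
      using \<open>B \<in> _\<close> unfolding flat_class_def by blast
    then have "B = (\<lambda>x. (t + u) + x) ` A \<or> B = (\<lambda>x. (t - u) - x) ` A"
      by (auto simp: image_image algebra_simps)
    then show ?thesis unfolding flat_class_def by blast
  qed
  from this[of _ u A] this[of _ "- u" "(\<lambda>x. u + x) ` A"] show ?thesis
    by (auto simp: image_image)
qed

lemma flat_class_uminus: "flat_class (uminus ` A) = flat_class A"
proof -
  have "B \<in> flat_class A" if "B \<in> flat_class (uminus ` A)" for B and A :: "'a set"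
    using that unfolding flat_class_def by (auto simp: image_image)
  from this[of _ A] this[of _ "uminus ` A"] show ?thesis
    by (auto simp: image_image)
qed

lemma kuhn_pt_uminus: "kuhn_pt k (\<lambda>l. - d l) i = - kuhn_pt k d i"
  by (simp add: kuhn_pt_def sum_negf)

text \<open>Walking the first \<open>k\<close> steps backwards visits the same vertices, seen from
  vertex \<open>k\<close>. Beyond place \<open>k\<close> the partial sums change by twice the vector
  to vertex \<open>k\<close>, and the factor \<open>1/2\<close> makes this the same
  translation.\<close>

lemma kuhn_pt_reverse:
  assumes "k \<le> n"
  shows "kuhn_pt k (reverse_steps k d) ` {..n} = (\<lambda>x. - (\<Sum>l<k. d l) + x) ` kuhn_pt k d ` {..n}"
proof -
  define \<rho> where "\<rho> i = (if i \<le> k then k - i else i)" for i :: nat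
  have e: "kuhn_pt k (reverse_steps k d) i = - (\<Sum>l<k. d l) + kuhn_pt k d (\<rho> i)" for i
    unfolding kuhn_pt_def sum_reverse_steps by (auto simp: \<rho>_def algebra_simps)
  have "\<rho> ` {..n} = {..n}"
  proof
    show "\<rho> ` {..n} \<subseteq> {..n}" using assms by (auto simp: \<rho>_def)
    show "{..n} \<subseteq> \<rho> ` {..n}"
    proof
      fix i assume "i \<in> {..n}"
      then show "i \<in> \<rho> ` {..n}" using assms by (intro image_eqI[of _ _ "\<rho> i"]) (auto simp: \<rho>_def)
    qed
  qed
  then have "kuhn_pt k d ` {..n} = kuhn_pt k d ` \<rho> ` {..n}" by simp
  then show ?thesis by (simp add: image_image e)
qed

lemma card_le_fibers:
  assumes "finite X" "\<And>x. x \<in> X \<Longrightarrow> m \<le> card {y \<in> X. f y = f x}"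
  shows "m * card (f ` X) \<le> card X"
proof -
  have "m * card (f ` X) = (\<Sum>z\<in>f ` X. m)" by simp
  also have "\<dots> \<le> (\<Sum>z\<in>f ` X. card {y \<in> X. f y = z})" by (rule sum_mono) (use assms(2) in auto)
  also have "\<dots> = card (\<Union>z\<in>f ` X. {y \<in> X. f y = z})"
    by (rule card_UN_disjoint[symmetric]) (use assms(1) in auto)
  also have "(\<Union>z\<in>f ` X. {y \<in> X. f y = z}) = X" by auto
  finally show ?thesis .
qed

text \<open>The four step sequences \<open>d\<close>, \<open>- d\<close>, \<open>reverse_steps k d\<close> and \<open>- reverse_steps k d\<close> describe
  congruent simplices; this is where the factor \<open>1/4\<close> in the number of classes comes from.\<close>

lemma card_flat_classes:
  fixes a :: "nat \<Rightarrow> 'a::real_vector"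
  assumes n: "2 \<le> n" and a: "\<And>l. n \<le> l \<Longrightarrow> a l = 0" "steps_distinct n a" and k: "1 \<le> k" "k \<le> n"
  shows "card ((\<lambda>d. flat_class (kuhn_pt k d ` {..n})) ` signed_perms n a) \<le> fact n * 2 ^ (n - 2)"
proof -
  let ?X = "signed_perms n a" and ?f = "\<lambda>d. flat_class (kuhn_pt k d ` {..n})"
  have "4 \<le> card {y \<in> ?X. ?f y = ?f d}" if d: "d \<in> ?X" for d
  proof -
    define m where "m = (\<lambda>(e :: nat \<Rightarrow> 'a) l. - e l)"
    have m_apply: "m e l = - e l" for e l by (simp add: m_def)
    let ?r = "reverse_steps k d"
    have r: "?r \<in> ?X" by (rule signed_perms_reverse[OF a(1) d k])
    have mX: "m e \<in> ?X" if "e \<in> ?X" for e unfolding m_def by (rule signed_perms_uminus[OF a(1) that])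
    have fm: "?f (m e) = ?f e" for e
      using flat_class_uminus[of "kuhn_pt k e ` {..n}"] unfolding m_def by (simp add: image_image kuhn_pt_uminus)
    have fr: "?f ?r = ?f d" unfolding kuhn_pt_reverse[OF k(2)] by (rule flat_class_plus)
    have D: "steps_distinct n d" by (rule signed_perms_distinct[OF a(2) d])
    have nz: "d l \<noteq> 0" if "l < n" for l using D that unfolding steps_distinct_def by auto
    have ns: "d l \<noteq> - d l" if "l < n" for l using nz[OF that] real_vector_eq_uminus_self[of "d l"] by simp
    have nm: "e \<noteq> m e" if "e \<in> ?X" for e
    proof
      assume "e = m e"
      then have "e 0 = - e 0" by (metis m_apply)
      then have "e 0 = 0" using real_vector_eq_uminus_self[of "e 0"] by simp
      then show False using signed_perms_distinct[OF a(2) that] n unfolding steps_distinct_def by auto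
    qed
    have dr: "d \<noteq> ?r"
    proof
      assume "d = ?r"
      then have "d 0 = ?r 0" by simp
      then have e: "d 0 = - d (k - 1)" using k by (simp add: reverse_steps_def)
      show False
      proof (cases "k = 1")
        case True then show False using e ns[of 0] n by simp
      next
        case False
        then have "0 < n" "k - 1 < n" "0 \<noteq> k - 1" using k by auto
        then show False using D e unfolding steps_distinct_def by blast
      qed
    qed
    have dmr: "d \<noteq> m ?r"
    proof
      assume eq: "d = m ?r"
      show False
      proof (cases "k = 1")
        case True
        \<comment> \<open>For \<open>k = 1\<close> the entries at \<open>0\<close> agree, so the
          difference shows at place \<open>1\<close>, which exists because \<open>n\<close> is at
          least two.\<close>
        have "d 1 = - ?r 1" using eq m_apply by metis
        then have "d 1 = - d 1" using True by (simp add: reverse_steps_def)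
        then show False using ns[of 1] n by simp
      next
        case False
        have "d 0 = - ?r 0" using eq m_apply by metis
        then have e: "d 0 = d (k - 1)" using k by (simp add: reverse_steps_def)
        have "0 < n" "k - 1 < n" "0 \<noteq> k - 1" using k False by auto
        then show False using D e unfolding steps_distinct_def by blast
      qed
    qed
    have mm: "m (m e) = e" for e by (simp add: m_def)
    have c4: "card {d, m d, ?r, m ?r} = 4"
      using nm[OF d] nm[OF r] dr dmr mm by (auto simp: card_insert_if) (metis mm)+
    have sub: "{d, m d, ?r, m ?r} \<subseteq> {y \<in> ?X. ?f y = ?f d}" using d r mX fm fr by auto
    have "finite {y \<in> ?X. ?f y = ?f d}"
      by (rule finite_subset[OF _ finite_signed_perms[of n a]]) auto
    from card_mono[OF this sub] show ?thesis unfolding c4 .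
  qed
  then have "4 * card (?f ` ?X) \<le> card ?X" by (rule card_le_fibers[OF finite_signed_perms])
  also have "\<dots> \<le> fact n * 2 ^ n" by (rule card_signed_perms)
  also have "(2::nat) ^ n = 4 * 2 ^ (n - 2)" using le_Suc_ex[OF n] by (auto simp: power_add)
  finally show ?thesis by simp
qed

section \<open>Shape regularity\<close>

lemma circ_diam_le:
  fixes S S0 :: "(real^'n) set"
  assumes ne: "S \<noteq> {}" and b: "bounded S0" and \<kappa>: "\<kappa> > 0"
    and c: "\<And>c r. S0 \<subseteq> cball c r \<Longrightarrow> \<exists>c'. S \<subseteq> cball c' (\<kappa> * r)"
  shows "circ_diam S \<le> \<kappa> * circ_diam S0" and "0 \<le> circ_diam S"
proof -
  let ?A = "{r. \<exists>c. S \<subseteq> cball c r}" and ?B = "{r. \<exists>c. S0 \<subseteq> cball c r}"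
  have pos: "0 \<le> r" if r: "r \<in> ?A" for r
  proof -
    obtain c where c: "S \<subseteq> cball c r" using r by auto
    obtain x where "x \<in> S" using ne by auto
    then have "dist c x \<le> r" using c by auto
    then show ?thesis using zero_le_dist[of c x] by linarith
  qed
  have bdd: "bdd_below ?A" by (rule bdd_belowI[of _ 0]) (use pos in auto)
  obtain c0 r0 where "S0 \<subseteq> cball c0 r0" using b unfolding bounded_def subset_iff mem_cball by blast
  then have B: "?B \<noteq> {}" by auto
  have le: "Inf ?A / \<kappa> \<le> r" if "r \<in> ?B" for r
  proof -
    have "\<kappa> * r \<in> ?A" using that c by auto
    then have "Inf ?A \<le> \<kappa> * r" using bdd by (rule cInf_lower)
    then show ?thesis using \<kappa> by (simp add: divide_le_eq mult.commute)
  qed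
  have "Inf ?A / \<kappa> \<le> Inf ?B" by (rule cInf_greatest[OF B le])
  then show "circ_diam S \<le> \<kappa> * circ_diam S0" unfolding circ_diam_def
    using \<kappa> by (simp add: divide_le_eq mult.commute)
  have "?A \<noteq> {}" using B c by blast
  then have "0 \<le> Inf ?A" by (rule cInf_greatest) (rule pos)
  then show "0 \<le> circ_diam S" unfolding circ_diam_def by simp
qed

lemma inscribed_radii_bdd:
  fixes S :: "(real^'n) set"
  assumes "bounded S"
  shows "bdd_above {r. r \<ge> 0 \<and> (\<exists>c. cball c r \<subseteq> S)}"
proof -
  obtain B where B: "\<And>x. x \<in> S \<Longrightarrow> norm x \<le> B" using assms unfolding bounded_iff by auto
  obtain e :: "real^'n" where e: "norm e = 1" using vector_choose_size[of 1] by auto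
  show ?thesis
  proof (rule bdd_aboveI[of _ B])
    fix r assume "r \<in> {r. r \<ge> 0 \<and> (\<exists>c. cball c r \<subseteq> S)}"
    then obtain c where r: "0 \<le> r" "cball c r \<subseteq> S" by auto
    have "c + r *\<^sub>R e \<in> S" "c - r *\<^sub>R e \<in> S" using r e by (auto simp: dist_norm intro!: subsetD[OF r(2)])
    then have "norm (c + r *\<^sub>R e) \<le> B" "norm (c - r *\<^sub>R e) \<le> B" using B by auto
    then have "norm ((c + r *\<^sub>R e) - (c - r *\<^sub>R e)) \<le> B + B" using norm_triangle_ineq4 order_trans add_mono by metis
    moreover have "(c + r *\<^sub>R e) - (c - r *\<^sub>R e) = (2 * r) *\<^sub>R e" by (simp add: algebra_simps flip: scaleR_2)
    ultimately show "r \<le> B" using e r by simp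
  qed
qed

lemma in_diam_ge:
  fixes S S0 :: "(real^'n) set"
  assumes ne: "S0 \<noteq> {}" and b: "bounded S" and \<kappa>: "\<kappa> > 0"
    and c: "\<And>c r. 0 \<le> r \<Longrightarrow> cball c r \<subseteq> S0 \<Longrightarrow> \<exists>c'. cball c' (\<kappa> * r) \<subseteq> S"
  shows "\<kappa> * in_diam S0 \<le> in_diam S"
proof -
  let ?A = "{r. r \<ge> 0 \<and> (\<exists>c. cball c r \<subseteq> S)}" and ?B = "{r. r \<ge> 0 \<and> (\<exists>c. cball c r \<subseteq> S0)}"
  obtain x where x: "x \<in> S0" using ne by auto
  then have "0 \<in> ?B" by auto
  then have B: "?B \<noteq> {}" by blast
  have "r \<le> Sup ?A / \<kappa>" if "r \<in> ?B" for r
  proof -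
    have "\<kappa> * r \<in> ?A" using that c \<kappa> by auto
    then have "\<kappa> * r \<le> Sup ?A" using inscribed_radii_bdd[OF b] by (rule cSup_upper)
    then show ?thesis using \<kappa> by (simp add: le_divide_eq mult.commute)
  qed
  then have "Sup ?B \<le> Sup ?A / \<kappa>" by (rule cSup_least[OF B])
  then show ?thesis unfolding in_diam_def using \<kappa> by (simp add: le_divide_eq mult.commute)
qed

lemma in_diam_pos:
  fixes S :: "(real^'n) set"
  assumes "bounded S" "interior S \<noteq> {}"
  shows "0 < in_diam S"
proof -
  obtain x e where x: "0 < e" "cball x e \<subseteq> S" using assms(2) by (auto simp: mem_interior_cball)
  then have "e \<le> Sup {r. r \<ge> 0 \<and> (\<exists>c. cball c r \<subseteq> S)}"
    by (intro cSup_upper inscribed_radii_bdd assms) auto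
  then show ?thesis unfolding in_diam_def using x by simp
qed

definition kuhn_simplex :: "nat \<Rightarrow> 'a::real_vector \<Rightarrow> real \<Rightarrow> nat \<Rightarrow> (nat \<Rightarrow> 'a) \<Rightarrow> 'a set" where
  "kuhn_simplex n b h k d = convex hull ((\<lambda>i. b + h *\<^sub>R kuhn_pt k d i) ` {..n})"

lemma norm_sum_steps:
  fixes d :: "nat \<Rightarrow> 'a::real_normed_vector"
  assumes "\<And>l. l < n \<Longrightarrow> norm (d l) \<le> M" "i \<le> j" "j \<le> n"
  shows "norm ((\<Sum>l<j. d l) - (\<Sum>l<i. d l)) \<le> real (j - i) * M"
  using assms(2,3)
proof (induction j rule: dec_induct)
  case (step j)
  have "norm ((\<Sum>l<Suc j. d l) - (\<Sum>l<i. d l)) = norm (((\<Sum>l<j. d l) - (\<Sum>l<i. d l)) + d j)" by (simp add: algebra_simps)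
  also have "\<dots> \<le> real (j - i) * M + M" using step assms(1)[of j] by (intro norm_triangle_mono) auto
  also have "\<dots> = real (Suc j - i) * M" using step by (simp add: Suc_diff_le algebra_simps)
  finally show ?case .
qed simp

lemma signed_perms_norm:
  fixes a :: "nat \<Rightarrow> 'a::real_normed_vector"
  assumes "d \<in> signed_perms n a" "\<And>l. l < n \<Longrightarrow> norm (a l) \<le> M" "l < n"
  shows "norm (d l) \<le> M"
proof -
  obtain \<sigma> E where s: "\<sigma> permutes {..<n}" "E \<subseteq> {..<n}" "d = (\<lambda>l. if l \<in> E then - a (\<sigma> l) else a (\<sigma> l))"
    using signed_permsE[OF assms(1)] .
  have "\<sigma> l < n" using permutes_in_image[OF s(1), of l] assms(3) by simp
  then show ?thesis using assms(2) by (simp add: s(3))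
qed

text \<open>The centre is the midpoint of the bisection edge. From there a vertex up to place
  \<open>k\<close> is reached by half a signed sum of \<open>k\<close> steps, and a later one by
  half the sum of the steps after place \<open>k\<close>. The bound \<open>2 * r\<close> for the
  steps comes from an enclosing ball of radius \<open>r\<close>.\<close>

lemma kuhn_simplex_in_cball:
  fixes d :: "nat \<Rightarrow> 'a::real_normed_vector"
  assumes d: "\<And>l. l < n \<Longrightarrow> norm (d l) \<le> 2 * r" and h: "h > 0" and k: "1 \<le> k" "k \<le> n"
  shows "kuhn_simplex n b h k d \<subseteq> cball (b + (h / 2) *\<^sub>R (\<Sum>l<k. d l)) (h * real n * r)"
  unfolding kuhn_simplex_def
proof (rule hull_minimal)
  show "(\<lambda>i. b + h *\<^sub>R kuhn_pt k d i) ` {..n} \<subseteq> cball (b + (h / 2) *\<^sub>R (\<Sum>l<k. d l)) (h * real n * r)"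
  proof (clarsimp simp: dist_norm)
    fix i assume i: "i \<le> n"
    let ?s = "\<lambda>j. \<Sum>l<j. d l"
    have "0 < n" using k by simp
    then have r0: "0 \<le> 2 * r" using d[of 0] norm_ge_zero[of "d 0"] by linarith
    have "norm ((h / 2) *\<^sub>R ?s k - h *\<^sub>R kuhn_pt k d i) \<le> (h / 2) * (real n * (2 * r))"
    proof (cases "i \<le> k")
      case True
      have e: "(h / 2) *\<^sub>R ?s k - h *\<^sub>R kuhn_pt k d i = (h / 2) *\<^sub>R ((?s k - ?s i) - (?s i - ?s 0))"
        using True by (simp add: kuhn_pt_def algebra_simps flip: scaleR_2)
      have "norm ((?s k - ?s i) - (?s i - ?s 0)) \<le> real (k - i) * (2 * r) + real (i - 0) * (2 * r)"
        by (rule norm_triangle_le_diff, rule add_mono; rule norm_sum_steps[OF d]) (use True i k in auto)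
      also have "\<dots> = real k * (2 * r)" using True by (simp add: of_nat_diff algebra_simps)
      also have "\<dots> \<le> real n * (2 * r)" using k r0 by (intro mult_right_mono) auto
      finally show ?thesis unfolding e using h by simp
    next
      case False
      have e: "(h / 2) *\<^sub>R ?s k - h *\<^sub>R kuhn_pt k d i = - ((h / 2) *\<^sub>R (?s i - ?s k))"
        using False by (simp add: kuhn_pt_def algebra_simps)
      have "norm (?s i - ?s k) \<le> real (i - k) * (2 * r)" by (rule norm_sum_steps[OF d]) (use False i in auto)
      also have "\<dots> \<le> real n * (2 * r)" using i r0 by (intro mult_right_mono) auto
      finally show ?thesis unfolding e norm_minus_cancel using h by simp
    qed
    then show "norm ((h / 2) *\<^sub>R ?s k - h *\<^sub>R kuhn_pt k d i) \<le> h * real n * r" by simp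
  qed
qed simp

lemma kuhn_simplex_coords:
  assumes "x \<in> kuhn_simplex n b 1 n a"
  obtains y :: "nat \<Rightarrow> real" where "\<And>l. 0 \<le> y l \<and> y l \<le> 1" "x = b + (\<Sum>l<n. y l *\<^sub>R a l)"
proof -
  let ?Y = "{b + (\<Sum>l<n. y l *\<^sub>R a l) |y. \<forall>l. 0 \<le> y l \<and> y l \<le> (1::real)}"
  have "kuhn_simplex n b 1 n a \<subseteq> ?Y" unfolding kuhn_simplex_def
  proof (rule hull_minimal)
    show "(\<lambda>i. b + 1 *\<^sub>R kuhn_pt n a i) ` {..n} \<subseteq> ?Y"
    proof
      fix x assume "x \<in> (\<lambda>i. b + 1 *\<^sub>R kuhn_pt n a i) ` {..n}"
      then obtain i where i: "i \<le> n" "x = b + (\<Sum>l<i. a l)" by (auto simp: kuhn_pt_def)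
      have "(\<Sum>l<n. (if l < i then 1 else 0 :: real) *\<^sub>R a l) = (\<Sum>l<i. a l)"
        by (rule sum.mono_neutral_cong_right) (use i in auto)
      then show "x \<in> ?Y" using i by (intro CollectI exI[of _ "\<lambda>l. if l < i then 1 else 0"]) auto
    qed
    show "convex ?Y"
    proof (rule convexI, clarify)
      fix u v :: real and y z :: "nat \<Rightarrow> real"
      assume uv: "0 \<le> u" "0 \<le> v" "u + v = 1" and y: "\<forall>l. 0 \<le> y l \<and> y l \<le> 1" and z: "\<forall>l. 0 \<le> z l \<and> z l \<le> 1"
      have "u *\<^sub>R (b + (\<Sum>l<n. y l *\<^sub>R a l)) + v *\<^sub>R (b + (\<Sum>l<n. z l *\<^sub>R a l))
          = (u + v) *\<^sub>R b + (\<Sum>l<n. (u * y l + v * z l) *\<^sub>R a l)"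
        by (simp add: scaleR_add_left scaleR_add_right sum.distrib scaleR_sum_right)
      moreover have "0 \<le> u * y l + v * z l \<and> u * y l + v * z l \<le> 1" for l
      proof
        show "0 \<le> u * y l + v * z l" using uv y z by simp
        have "u * y l + v * z l \<le> u * 1 + v * 1" using uv y z by (intro add_mono mult_left_mono) auto
        then show "u * y l + v * z l \<le> 1" using uv by simp
      qed
      ultimately show "\<exists>y'. u *\<^sub>R (b + (\<Sum>l<n. y l *\<^sub>R a l)) + v *\<^sub>R (b + (\<Sum>l<n. z l *\<^sub>R a l))
          = b + (\<Sum>l<n. y' l *\<^sub>R a l) \<and> (\<forall>l. 0 \<le> y' l \<and> y' l \<le> 1)"
        using uv(3) by (intro exI[of _ "\<lambda>l. u * y l + v * z l"]) simp
    qed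
  qed
  then show ?thesis using assms that by blast
qed

text \<open>Both \<open>c + w\<close> and \<open>c - w\<close> have coordinates in the unit cube;
  half their difference is \<open>w\<close>.\<close>

lemma cball_coords:
  fixes w :: "'a::real_normed_vector"
  assumes B: "cball c r \<subseteq> kuhn_simplex n b 1 n a" and w: "norm w \<le> r"
  obtains t :: "nat \<Rightarrow> real" where "\<And>l. \<bar>t l\<bar> \<le> 1/2" "w = (\<Sum>l<n. t l *\<^sub>R a l)"
proof -
  have cw: "c + w \<in> kuhn_simplex n b 1 n a" "c - w \<in> kuhn_simplex n b 1 n a"
    using w by (auto intro!: subsetD[OF B] simp: dist_norm)
  obtain y :: "nat \<Rightarrow> real" where y: "\<And>l. 0 \<le> y l \<and> y l \<le> 1" "c + w = b + (\<Sum>l<n. y l *\<^sub>R a l)"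
    using kuhn_simplex_coords[OF cw(1)] by blast
  obtain z :: "nat \<Rightarrow> real" where z: "\<And>l. 0 \<le> z l \<and> z l \<le> 1" "c - w = b + (\<Sum>l<n. z l *\<^sub>R a l)"
    using kuhn_simplex_coords[OF cw(2)] by blast
  have "2 *\<^sub>R w = (c + w) - (c - w)" by (simp add: scaleR_2)
  also have "\<dots> = (\<Sum>l<n. (y l - z l) *\<^sub>R a l)" unfolding y(2) z(2) by (simp add: scaleR_diff_left sum_subtractf)
  finally have "(1/2) *\<^sub>R (2 *\<^sub>R w) = (1/2) *\<^sub>R (\<Sum>l<n. (y l - z l) *\<^sub>R a l)" by simp
  then have "w = (\<Sum>l<n. ((y l - z l) / 2) *\<^sub>R a l)" by (simp add: scaleR_sum_right)
  moreover have "\<bar>(y l - z l) / 2\<bar> \<le> 1/2" for l using y(1)[of l] z(1)[of l] by auto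
  ultimately show ?thesis by (intro that[of "\<lambda>l. (y l - z l) / 2"])
qed

lemma signed_perms_coords:
  fixes t :: "nat \<Rightarrow> real"
  assumes d: "d \<in> signed_perms n a" and t: "\<And>l. \<bar>t l\<bar> \<le> B"
  obtains t' where "\<And>l. \<bar>t' l\<bar> \<le> B" "(\<Sum>l<n. t l *\<^sub>R a l) = (\<Sum>l<n. t' l *\<^sub>R d l)"
proof -
  obtain \<sigma> E where s: "\<sigma> permutes {..<n}" "E \<subseteq> {..<n}" "d = (\<lambda>l. if l \<in> E then - a (\<sigma> l) else a (\<sigma> l))"
    using signed_permsE[OF d] .
  define t' where "t' l = (if l \<in> E then - t (\<sigma> l) else t (\<sigma> l))" for l
  have "(\<Sum>l<n. t l *\<^sub>R a l) = (\<Sum>l<n. t (\<sigma> l) *\<^sub>R a (\<sigma> l))"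
    using sum.permute[OF s(1), of "\<lambda>l. t l *\<^sub>R a l"] by (simp add: o_def)
  also have "\<dots> = (\<Sum>l<n. t' l *\<^sub>R d l)" by (rule sum.cong) (auto simp: t'_def s(3))
  finally show ?thesis using t by (intro that[of t']) (auto simp: t'_def)
qed

text \<open>Summation by parts turns decreasing coordinates into nonnegative weights on the vertices
  \<open>1..n\<close>. The differences from place \<open>k\<close> on count twice because those
  vertices are halved, so the total weight is \<open>y 0 + y k\<close>; vertex \<open>0\<close>
  receives what is missing to one.\<close>

lemma kuhn_simplexI:
  fixes y :: "nat \<Rightarrow> real"
  assumes k: "1 \<le> k" "k \<le> n" and y: "\<And>l. l < n \<Longrightarrow> y (Suc l) \<le> y l" "y n = 0" "y 0 + y k \<le> 1"
  shows "b + h *\<^sub>R (\<Sum>l<n. y l *\<^sub>R d l) \<in> kuhn_simplex n b h k d"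
proof -
  let ?s = "\<lambda>j. \<Sum>l<j. d l"
  define c where "c i = (if i \<le> k then 1 else 1/2 :: real)" for i
  define w where "w i = (y i - y (Suc i)) / c (Suc i)" for i
  have parts: "(\<Sum>i<m. (y i - y (Suc i)) *\<^sub>R ?s (Suc i)) + y m *\<^sub>R ?s m = (\<Sum>l<m. y l *\<^sub>R d l)" for m
    by (induction m) (auto simp: algebra_simps)
  have total: "sum w {..<m} = (if m \<le> k then y 0 - y m else y 0 + y k - 2 * y m)" for m
  proof (induction m)
    case (Suc m)
    then show ?case by (cases "m = k") (auto simp: w_def c_def field_simps)
  qed (use k in auto)
  have tn: "sum w {..<n} = y 0 + y k" using total[of n] y(2) k by (cases "n = k") auto
  define u where "u i = (case i of 0 \<Rightarrow> 1 - sum w {..<n} | Suc j \<Rightarrow> w j)" for i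
  have su: "sum u {..n} = 1"
    unfolding lessThan_Suc_atMost[symmetric] sum.lessThan_Suc_shift by (simp add: u_def)
  have u0: "0 \<le> u i" if "i \<le> n" for i
    using that tn y by (cases i) (auto simp: u_def w_def c_def)
  have "(\<Sum>i\<in>{..n}. u i *\<^sub>R (b + h *\<^sub>R kuhn_pt k d i)) \<in> kuhn_simplex n b h k d"
    unfolding kuhn_simplex_def
    by (rule convex_sum[OF _ convex_convex_hull su]) (use u0 in \<open>auto intro: hull_inc\<close>)
  also have "(\<Sum>i\<in>{..n}. u i *\<^sub>R (b + h *\<^sub>R kuhn_pt k d i)) = b + h *\<^sub>R (\<Sum>i\<in>{..n}. u i *\<^sub>R kuhn_pt k d i)"
    by (simp add: scaleR_add_right sum.distrib scaleR_sum_left[symmetric] su scaleR_sum_right mult.commute)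
  also have "(\<Sum>i\<in>{..n}. u i *\<^sub>R kuhn_pt k d i) = (\<Sum>i<n. w i *\<^sub>R kuhn_pt k d (Suc i))"
    unfolding lessThan_Suc_atMost[symmetric] sum.lessThan_Suc_shift by (simp add: u_def kuhn_pt_def)
  also have "\<dots> = (\<Sum>i<n. (y i - y (Suc i)) *\<^sub>R ?s (Suc i))"
    by (rule sum.cong) (auto simp: w_def c_def kuhn_pt_def)
  also have "\<dots> = (\<Sum>l<n. y l *\<^sub>R d l)" using parts[of n] y(2) by simp
  finally show ?thesis .
qed

text \<open>In the coordinates given by the steps, \<^term>\<open>kuhn_simplex n b h k d\<close> contains an axis-parallel
  cube of side \<open>h / (2 n)\<close>, while a ball inside the initial simplex is contained in a unit cube; both
  facts are insensitive to signed permutations of the steps.\<close>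

lemma kuhn_simplex_contains_ball:
  fixes a :: "nat \<Rightarrow> 'a::real_normed_vector"
  assumes d: "d \<in> signed_perms n a" and h: "h > 0" and k: "1 \<le> k" "k \<le> n"
    and B: "cball c r \<subseteq> kuhn_simplex n p 1 n a"
  shows "\<exists>c'. cball c' (h / (2 * real n) * r) \<subseteq> kuhn_simplex n b h k d"
proof -
  define \<delta> where "\<delta> = 1 / (2 * real n)"
  have n: "0 < real n" using k by simp
  have \<delta>: "0 < \<delta>" "\<delta> * (2 * real n) = 1" using n by (auto simp: \<delta>_def)
  \<comment> \<open>With half side \<open>\<delta> / 2\<close>, coordinate \<open>l\<close> of the
    cube runs between \<open>\<delta> * (n - l - 1)\<close> and \<open>\<delta> * (n - l)\<close>.
    Consecutive intervals touch, so all points have decreasing coordinates, and none exceeds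
    \<open>\<delta> * n = 1/2\<close>, which gives \<open>y 0 + y k \<le> 1\<close>.\<close>
  define c' where "c' = b + h *\<^sub>R (\<Sum>l<n. (\<delta> * (real n - real l - 1/2)) *\<^sub>R d l)"
  have "x \<in> kuhn_simplex n b h k d" if x: "x \<in> cball c' (h * \<delta> * r)" for x
  proof -
    define w where "w = (1 / (h * \<delta>)) *\<^sub>R (x - c')"
    have hd: "0 < h * \<delta>" using h \<delta> by simp
    have hw: "(h * \<delta>) *\<^sub>R w = x - c'" using h \<delta>(1) by (simp add: w_def)
    have "norm w \<le> r" unfolding w_def using x hd by (simp add: dist_norm norm_minus_commute divide_le_eq mult.commute)
    then obtain t0 :: "nat \<Rightarrow> real" where "\<And>l. \<bar>t0 l\<bar> \<le> 1/2" "w = (\<Sum>l<n. t0 l *\<^sub>R a l)" using cball_coords[OF B] by blast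
    then obtain t :: "nat \<Rightarrow> real" where t: "\<And>l. \<bar>t l\<bar> \<le> 1/2" "w = (\<Sum>l<n. t l *\<^sub>R d l)"
      using signed_perms_coords[OF d] by metis
    have t': "- (1/2) \<le> t l" "t l \<le> 1/2" for l using t(1)[of l] by linarith+
    define y where "y l = (if l < n then \<delta> * (real n - real l - 1/2 + t l) else 0)" for l
    have "h *\<^sub>R (\<Sum>l<n. y l *\<^sub>R d l) = h *\<^sub>R (\<Sum>l<n. (\<delta> * (real n - real l - 1/2)) *\<^sub>R d l + \<delta> *\<^sub>R (t l *\<^sub>R d l))"
      by (intro arg_cong[of _ _ "\<lambda>x. h *\<^sub>R x"] sum.cong) (auto simp: y_def scaleR_add_left[symmetric] distrib_left)
    also have "\<dots> = h *\<^sub>R (\<Sum>l<n. (\<delta> * (real n - real l - 1/2)) *\<^sub>R d l) + (h * \<delta>) *\<^sub>R w"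
      unfolding t(2) by (simp add: sum.distrib scaleR_add_right scaleR_sum_right mult.assoc)
    also have "b + \<dots> = c' + (x - c')" using hw by (simp add: c'_def)
    finally have x: "b + h *\<^sub>R (\<Sum>l<n. y l *\<^sub>R d l) = x" by simp
    have "b + h *\<^sub>R (\<Sum>l<n. y l *\<^sub>R d l) \<in> kuhn_simplex n b h k d"
    proof (rule kuhn_simplexI[OF k])
      show "y n = 0" by (simp add: y_def)
      show "y (Suc l) \<le> y l" if "l < n" for l
      proof (cases "Suc l < n")
        case True
        have "real n - real (Suc l) - 1/2 + t (Suc l) \<le> real n - real l - 1/2 + t l" using t'[of l] t'[of "Suc l"] by simp
        then show ?thesis using True \<delta> by (simp add: y_def mult_left_mono)
      next
        case False
        then have "real n = real l + 1" using that by simp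
        then have "0 \<le> real n - real l - 1/2 + t l" using t'[of l] by simp
        then show ?thesis using False that \<delta> by (simp add: y_def)
      qed
      have "y l \<le> \<delta> * real n" for l
      proof (cases "l < n")
        case True
        have "real n - real l - 1/2 + t l \<le> real n" using t'[of l] by simp
        then show ?thesis using True \<delta> by (simp add: y_def)
      qed (use \<delta> n in \<open>simp add: y_def\<close>)
      from this[of 0] this[of k] show "y 0 + y k \<le> 1" using \<delta> by linarith
    qed
    then show ?thesis unfolding x .
  qed
  then have "cball c' (h * \<delta> * r) \<subseteq> kuhn_simplex n b h k d" by blast
  then show ?thesis unfolding \<delta>_def by (intro exI[of _ c']) simp
qed

lemma steps_norm_le:
  fixes a :: "nat \<Rightarrow> 'a::real_normed_vector"
  assumes "kuhn_simplex n p 1 n a \<subseteq> cball c r" "l < n"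
  shows "norm (a l) \<le> 2 * r"
proof -
  have v: "p + (\<Sum>l<i. a l) \<in> cball c r" if "i \<le> n" for i
  proof -
    have "p + 1 *\<^sub>R kuhn_pt n a i \<in> kuhn_simplex n p 1 n a"
      unfolding kuhn_simplex_def by (rule hull_inc) (use that in blast)
    then show ?thesis using assms(1) that by (auto simp: kuhn_pt_def)
  qed
  have "dist (p + (\<Sum>l<Suc l. a l)) (p + (\<Sum>l<l. a l)) \<le> r + r"
    using v[of l] v[of "Suc l"] assms(2) by (intro dist_triangle_le[of _ c] add_mono) (auto simp: dist_commute)
  then show ?thesis by (simp add: dist_norm)
qed

lemma bounded_kuhn_simplex:
  fixes a :: "nat \<Rightarrow> 'a::real_normed_vector"
  shows "bounded (kuhn_simplex n b h k a)"
  unfolding kuhn_simplex_def by (intro bounded_convex_hull finite_imp_bounded) auto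

lemma shape_gamma_kuhn_simplex:
  fixes a :: "nat \<Rightarrow> real^'n"
  assumes d: "d \<in> signed_perms n a" and h: "h > 0" and k: "1 \<le> k" "k \<le> n"
    and i: "interior (kuhn_simplex n p 1 n a) \<noteq> {}"
  shows "shape_gamma (kuhn_simplex n b h k d)
    \<le> 2 * real n * (real n + sqrt 2 - 1) * shape_gamma (kuhn_simplex n p 1 n a)"
proof -
  let ?K = "kuhn_simplex n p 1 n a" and ?T = "kuhn_simplex n b h k d"
  have n: "0 < real n" using k by simp
  have ne: "?T \<noteq> {}" "?K \<noteq> {}" by (auto simp: kuhn_simplex_def)
  have "\<exists>c'. ?T \<subseteq> cball c' (h * real n * r)" if "?K \<subseteq> cball c r" for c r
  proof -
    have "norm (a l) \<le> 2 * r" if "l < n" for l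
      by (rule steps_norm_le[OF \<open>?K \<subseteq> cball c r\<close> that])
    then have "norm (d l) \<le> 2 * r" if "l < n" for l
      using signed_perms_norm[OF d _ that] by blast
    then show ?thesis using kuhn_simplex_in_cball[OF _ h k, of d r b] by blast
  qed
  then have c: "circ_diam ?T \<le> (h * real n) * circ_diam ?K" "0 \<le> circ_diam ?T"
    using circ_diam_le[OF ne(1) bounded_kuhn_simplex, of "h * real n" n p 1 n a] h n by auto
  have c0: "0 \<le> circ_diam ?K"
    using circ_diam_le(2)[OF ne(2) bounded_kuhn_simplex, of 1 n p 1 n a] by auto
  have r0: "0 < in_diam ?K" by (rule in_diam_pos[OF bounded_kuhn_simplex i])
  have r: "(h / (2 * real n)) * in_diam ?K \<le> in_diam ?T"
    by (rule in_diam_ge[OF ne(2) bounded_kuhn_simplex]) (use h n kuhn_simplex_contains_ball[OF d h k] in auto)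
  have p: "0 < (h / (2 * real n)) * in_diam ?K" using h n r0 by simp
  have "shape_gamma ?T \<le> ((h * real n) * circ_diam ?K) / ((h / (2 * real n)) * in_diam ?K)"
    unfolding shape_gamma_def using c r p by (intro frac_le) auto
  also have "\<dots> = 2 * real n * real n * shape_gamma ?K" unfolding shape_gamma_def using h n r0 by (simp add: field_simps)
  \<comment> \<open>The estimates give the factor \<open>2 * n * n\<close>; the stated constant is
    larger since \<open>sqrt 2\<close> is at least one.\<close>
  also have "\<dots> \<le> 2 * real n * (real n + sqrt 2 - 1) * shape_gamma ?K"
    by (intro mult_right_mono mult_left_mono) (use n c0 r0 in \<open>auto simp: shape_gamma_def\<close>)
  finally show ?thesis .
qed

section \<open>Descendants of an initial simplex\<close>

text \<open>The midpoint is vertex \<open>k\<close> halved towards \<open>b\<close>, so the steps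
  stay the same and the halving starts one place earlier. For \<open>k = 1\<close> all vertices but
  the base point are halved, and the factor moves into \<open>h\<close>.\<close>

lemma kuhn_pts_child_old:
  assumes p: "\<And>i. i \<le> n \<Longrightarrow> p i = b + h *\<^sub>R kuhn_pt k d i" and k: "1 \<le> k" "k \<le> n"
    and z: "z = (1/2) *\<^sub>R (p 0 + p k)" and i: "i \<le> n"
  shows "k > 1 \<Longrightarrow> (p(k := z)) i = b + h *\<^sub>R kuhn_pt (k - 1) d i"
    and "k = 1 \<Longrightarrow> (p(k := z)) i = b + (h / 2) *\<^sub>R kuhn_pt n d i"
proof -
  have z': "z = b + (h / 2) *\<^sub>R (\<Sum>l<k. d l)"
    using p[of 0] p[of k] k unfolding z by (simp add: kuhn_pt_def algebra_simps flip: scaleR_2 scaleR_add_left)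
  show "(p(k := z)) i = b + h *\<^sub>R kuhn_pt (k - 1) d i" if "k > 1"
    using p[OF i] that by (auto simp: kuhn_pt_def z')
  show "(p(k := z)) i = b + (h / 2) *\<^sub>R kuhn_pt n d i" if "k = 1"
    using p[OF i] that i by (cases "i = 0") (auto simp: kuhn_pt_def z')
qed

lemma kuhn_pts_child_new:
  assumes p: "\<And>i. i \<le> n \<Longrightarrow> p i = b + h *\<^sub>R kuhn_pt k d i" and k: "1 \<le> k" "k \<le> n"
    and z: "z = (1/2) *\<^sub>R (p 0 + p k)" and i: "i \<le> n"
  shows "k > 1 \<Longrightarrow> shift k z p i = (b + h *\<^sub>R d 0) + h *\<^sub>R kuhn_pt (k - 1) (rotate_steps k d) i"
    and "k = 1 \<Longrightarrow> shift k z p i = (b + h *\<^sub>R d 0) + (h / 2) *\<^sub>R kuhn_pt n (rotate_steps k d) i"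
proof -
  have z': "z = b + (h / 2) *\<^sub>R (\<Sum>l<k. d l)"
    using p[of 0] p[of k] k unfolding z by (simp add: kuhn_pt_def algebra_simps flip: scaleR_2 scaleR_add_left)
  note s = sum_rotate_steps[OF k(1), of d i]
  have hh: "(h / 2) *\<^sub>R 2 *\<^sub>R d 0 = h *\<^sub>R d 0" by simp
  show "shift k z p i = (b + h *\<^sub>R d 0) + h *\<^sub>R kuhn_pt (k - 1) (rotate_steps k d) i" if k1: "k > 1"
  proof -
    consider "i < k" | "i = k" | "k < i" by linarith
    then show ?thesis
    proof cases
      case 1
      then have "i \<le> k - 1" by simp
      then show ?thesis using p[of "Suc i"] k 1 by (simp add: kuhn_pt_def s shift_def scaleR_diff_right)
    next
      case 2
      have "\<not> k \<le> k - 1" using k1 by simp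
      then show ?thesis using k1 hh unfolding 2 by (simp add: kuhn_pt_def s[unfolded 2] shift_def z' scaleR_diff_right)
    next
      case 3
      then have "\<not> i \<le> k - 1" by simp
      then show ?thesis using p[OF i] k1 hh 3 by (simp add: kuhn_pt_def s shift_def scaleR_diff_right)
    qed
  qed
  show "shift k z p i = (b + h *\<^sub>R d 0) + (h / 2) *\<^sub>R kuhn_pt n (rotate_steps k d) i" if k1: "k = 1"
  proof -
    consider "i = 0" | "i = 1" | "1 < i" by linarith
    then show ?thesis
    proof cases
      case 1
      then show ?thesis using p[of "Suc i"] k k1 by (simp add: kuhn_pt_def s shift_def)
    next
      case 2
      have "(h / 2) *\<^sub>R d 0 + (h / 2) *\<^sub>R d 0 = h *\<^sub>R d 0" by (simp flip: scaleR_add_left)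
      then show ?thesis using k1 k(2) unfolding 2
        by (simp add: kuhn_pt_def shift_def z' rotate_steps_def eq_diff_eq)
    next
      case 3
      then show ?thesis using p[OF i] k1 i hh
        by (simp add: kuhn_pt_def s[unfolded k1 One_nat_def] shift_def scaleR_diff_right)
    qed
  qed
qed

text \<open>One enumeration \<open>P\<close> carries both the order of generations and the geometric
  path. This is what ties the combinatorial bisection rule to the step sequences.\<close>

definition kuhn_state :: "nat \<Rightarrow> (nat \<Rightarrow> real^'n::finite) \<Rightarrow> nat \<Rightarrow> 'n tsimplex \<Rightarrow> bool" where
  "kuhn_state N a k T \<longleftrightarrow> (\<exists>P L b h d. T = P ` {..CARD('n)} \<and> mgen N CARD('n) L k (\<lambda>i. snd (P i)) \<and>
     h > 0 \<and> d \<in> signed_perms CARD('n) a \<and> (\<forall>i\<le>CARD('n). fst (P i) = b + h *\<^sub>R kuhn_pt k d i))"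

lemma kuhn_state_hull:
  fixes T :: "('n::finite) tsimplex"
  assumes "kuhn_state N a k T"
  obtains b h d where "h > 0" "d \<in> signed_perms CARD('n) a" "1 \<le> k" "k \<le> CARD('n)"
    "tag_hull T = kuhn_simplex CARD('n) b h k d"
proof -
  obtain P L b h d where P: "T = P ` {..CARD('n)}" "mgen N CARD('n) L k (\<lambda>i. snd (P i))"
     "h > 0" "d \<in> signed_perms CARD('n) a" "\<forall>i\<le>CARD('n). fst (P i) = b + h *\<^sub>R kuhn_pt k d i"
    using assms unfolding kuhn_state_def by blast
  have "fst ` T = (\<lambda>i. b + h *\<^sub>R kuhn_pt k d i) ` {..CARD('n)}" unfolding P(1) image_image using P(5) by auto
  then show ?thesis using that[OF P(3,4) mgenD(1,2)[OF P(2)]] by (simp add: kuhn_simplex_def)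
qed

lemma kuhn_state_child:
  fixes T :: "('n::finite) tsimplex"
  assumes N: "N > 0" and a: "\<And>l. CARD('n) \<le> l \<Longrightarrow> a l = 0" and T: "kuhn_state N a k T" and C: "C \<in> children N T"
  shows "\<exists>k'. kuhn_state N a k' C"
proof -
  obtain P L b h d where P: "T = P ` {..CARD('n)}" "mgen N CARD('n) L k (\<lambda>i. snd (P i))"
     "h > 0" "d \<in> signed_perms CARD('n) a" "\<forall>i\<le>CARD('n). fst (P i) = b + h *\<^sub>R kuhn_pt k d i"
    using T unfolding kuhn_state_def by blast
  define p where "p = (\<lambda>i. fst (P i))"
  define z where "z = bsv N T"
  note D = mgenD(1,2)[OF P(2)]
  have p: "p i = b + h *\<^sub>R kuhn_pt k d i" if "i \<le> CARD('n)" for i using P(5) that by (simp add: p_def)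
  have z: "fst z = (1/2) *\<^sub>R (p 0 + p k)" "snd z = mid N (snd (P 0)) (snd (P k))"
    using maubach_bse(3)[OF N P(2)] P(1) by (auto simp: z_def p_def)
  have h2: "h / 2 > 0" using P(3) by simp
  consider "C = (P(k := z)) ` {..CARD('n)}" | "C = shift k z P ` {..CARD('n)}"
    using maubach_children[OF N P(2)] C P(1) z_def by auto
  then show ?thesis
  proof cases
    case 1
    note c = mgen_child_old[OF N P(2), folded z(2)]
    have e: "(\<lambda>i. snd ((P(k := z)) i)) = (\<lambda>i. snd (P i))(k := snd z)" by auto
    have f: "fst ((P(k := z)) i) = (p(k := fst z)) i" for i by (simp add: p_def)
    note g = kuhn_pts_child_old[of "CARD('n)" p b h k d "fst z", OF p D z(1)]
    show ?thesis
    proof (cases "k > 1")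
      case True
      have "mgen N CARD('n) L (k - 1) (\<lambda>i. snd ((P(k := z)) i))" using c(1)[OF True] unfolding e by simp
      moreover have "\<forall>i\<le>CARD('n). fst ((P(k := z)) i) = b + h *\<^sub>R kuhn_pt (k - 1) d i" unfolding f using g(1) True by blast
      ultimately have "kuhn_state N a (k - 1) C" unfolding kuhn_state_def using 1 P(3,4) by blast
      then show ?thesis by blast
    next
      case False
      then have k1: "k = 1" using D by simp
      have "mgen N CARD('n) (L + 1) CARD('n) (\<lambda>i. snd ((P(k := z)) i))" using c(2)[OF k1] unfolding e by simp
      moreover have "\<forall>i\<le>CARD('n). fst ((P(k := z)) i) = b + (h / 2) *\<^sub>R kuhn_pt CARD('n) d i" unfolding f using g(2) k1 by blast
      ultimately have "kuhn_state N a CARD('n) C" unfolding kuhn_state_def using 1 P(4) h2 by blast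
      then show ?thesis by blast
    qed
  next
    case 2
    note c = mgen_child_new[OF N P(2), folded z(2)]
    have e: "(\<lambda>i. snd (shift k z P i)) = shift k (snd z) (\<lambda>i. snd (P i))" by (auto simp: shift_def)
    have f: "fst (shift k z P i) = shift k (fst z) p i" for i by (simp add: p_def shift_def)
    note g = kuhn_pts_child_new[of "CARD('n)" p b h k d "fst z", OF p D z(1)]
    have r: "rotate_steps k d \<in> signed_perms CARD('n) a" by (rule signed_perms_rotate[OF a P(4) D])
    show ?thesis
    proof (cases "k > 1")
      case True
      have "mgen N CARD('n) L (k - 1) (\<lambda>i. snd (shift k z P i))" using c(1)[OF True] unfolding e by simp
      moreover have "\<forall>i\<le>CARD('n). fst (shift k z P i) = (b + h *\<^sub>R d 0) + h *\<^sub>R kuhn_pt (k - 1) (rotate_steps k d) i"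
        unfolding f using g(1) True by blast
      ultimately have "kuhn_state N a (k - 1) C" unfolding kuhn_state_def using 2 P(3) r by blast
      then show ?thesis by blast
    next
      case False
      then have k1: "k = 1" using D by simp
      have "mgen N CARD('n) (L + 1) CARD('n) (\<lambda>i. snd (shift k z P i))" using c(2)[OF k1] unfolding e by simp
      moreover have "\<forall>i\<le>CARD('n). fst (shift k z P i) = (b + h *\<^sub>R d 0) + (h / 2) *\<^sub>R kuhn_pt CARD('n) (rotate_steps k d) i"
        unfolding f using g(2) k1 by blast
      ultimately have "kuhn_state N a CARD('n) C" unfolding kuhn_state_def using 2 h2 r by blast
      then show ?thesis by blast
    qed
  qed
qed

lemma kuhn_state_descendant:
  fixes T :: "('n::finite) tsimplex"
  assumes "N > 0" "\<And>l. CARD('n) \<le> l \<Longrightarrow> a l = 0" "kuhn_state N a k0 T0" "descendant N T0 T"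
  shows "\<exists>k. kuhn_state N a k T"
  using assms(4) unfolding descendant_def
proof (induction rule: rtranclp_induct)
  case base then show ?case using assms by blast
next
  case (step Y Z)
  then show ?case using kuhn_state_child[of N a, OF assms(1,2)] by blast
qed

lemma affine_independent_index:
  fixes p :: "nat \<Rightarrow> 'a::real_vector"
  assumes "inj_on p {..n}" "\<not> affine_dependent (p ` {..n})"
    and "(\<Sum>i\<le>n. u i) = 0" "(\<Sum>i\<le>n. u i *\<^sub>R p i) = 0" "j \<le> n"
  shows "u j = 0"
proof -
  define U where "U x = u (inv_into {..n} p x)" for x
  have U: "U (p i) = u i" if "i \<le> n" for i unfolding U_def using inv_into_f_f[OF assms(1), of i] that by simp
  have "sum U (p ` {..n}) = (\<Sum>i\<le>n. u i)" unfolding sum.reindex[OF assms(1)] by (rule sum.cong) (auto simp: U)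
  moreover have "(\<Sum>x\<in>p ` {..n}. U x *\<^sub>R x) = (\<Sum>i\<le>n. u i *\<^sub>R p i)"
    unfolding sum.reindex[OF assms(1)] by (rule sum.cong) (auto simp: U)
  ultimately have "U (p j) = 0"
    using affine_coeffs_unique[of "p ` {..n}" U "\<lambda>_. 0" "p j"] assms by simp
  then show ?thesis using U assms(5) by simp
qed

lemma steps_distinct_simplex:
  fixes p :: "nat \<Rightarrow> 'a::real_vector"
  assumes p: "inj_on p {..n}" "\<not> affine_dependent (p ` {..n})"
    and a: "\<And>l. l < n \<Longrightarrow> a l = p (Suc l) - p l"
  shows "steps_distinct n a"
proof -
  have \<delta>: "(\<Sum>i\<le>n. (if i = j then 1 else 0 :: real)) = 1" "(\<Sum>i\<le>n. (if i = j then 1 else 0 :: real) *\<^sub>R p i) = p j"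
    if "j \<le> n" for j
    using that by (auto simp: if_distrib[of "\<lambda>x. x *\<^sub>R _"] cong: if_cong)
  have ne: "a l \<noteq> a m" "a l \<noteq> - a m" if lm: "l < m" "m < n" for l m
  proof -
    have le: "l \<le> n" "Suc l \<le> n" "m \<le> n" "Suc m \<le> n" using lm by auto
    let ?e = "\<lambda>j i. if i = j then 1 else 0 :: real"
    have al: "a l = p (Suc l) - p l" "a m = p (Suc m) - p m" using a lm by auto
    show "a l \<noteq> a m"
    proof
      assume "a l = a m"
      then have "(\<Sum>i\<le>n. (?e (Suc l) i - ?e l i - ?e (Suc m) i + ?e m i) *\<^sub>R p i) = 0"
        unfolding scaleR_add_left scaleR_diff_left sum.distrib sum_subtractf \<delta>(2)[OF le(1)] \<delta>(2)[OF le(2)]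
          \<delta>(2)[OF le(3)] \<delta>(2)[OF le(4)] al by (simp add: algebra_simps)
      moreover have "(\<Sum>i\<le>n. (?e (Suc l) i - ?e l i - ?e (Suc m) i + ?e m i)) = 0"
        unfolding sum.distrib sum_subtractf \<delta>(1)[OF le(1)] \<delta>(1)[OF le(2)] \<delta>(1)[OF le(3)] \<delta>(1)[OF le(4)] by simp
      \<comment> \<open>As \<open>l < m\<close>, vertex \<open>l\<close> occurs only in
        \<open>a l\<close>, so its coefficient is \<open>-1\<close> even when
        \<open>Suc l = m\<close> and other terms meet.\<close>
      ultimately have "?e (Suc l) l - ?e l l - ?e (Suc m) l + ?e m l = 0"
        using affine_independent_index[OF p, of "\<lambda>i. ?e (Suc l) i - ?e l i - ?e (Suc m) i + ?e m i" l] le(1) by blast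
      then show False using lm by simp
    qed
    show "a l \<noteq> - a m"
    proof
      assume "a l = - a m"
      then have "(\<Sum>i\<le>n. (?e (Suc l) i - ?e l i + ?e (Suc m) i - ?e m i) *\<^sub>R p i) = 0"
        unfolding scaleR_add_left scaleR_diff_left sum.distrib sum_subtractf \<delta>(2)[OF le(1)] \<delta>(2)[OF le(2)]
          \<delta>(2)[OF le(3)] \<delta>(2)[OF le(4)] al by (simp add: algebra_simps)
      moreover have "(\<Sum>i\<le>n. (?e (Suc l) i - ?e l i + ?e (Suc m) i - ?e m i)) = 0"
        unfolding sum.distrib sum_subtractf \<delta>(1)[OF le(1)] \<delta>(1)[OF le(2)] \<delta>(1)[OF le(3)] \<delta>(1)[OF le(4)] by simp
      ultimately have "?e (Suc l) l - ?e l l + ?e (Suc m) l - ?e m l = 0"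
        using affine_independent_index[OF p, of "\<lambda>i. ?e (Suc l) i - ?e l i + ?e (Suc m) i - ?e m i" l] le(1) by blast
      then show False using lm by simp
    qed
  qed
  show ?thesis unfolding steps_distinct_def
  proof (intro conjI allI impI)
    fix l assume l: "l < n"
    have "p (Suc l) \<noteq> p l" using inj_onD[OF p(1), of "Suc l" l] l by auto
    then show "a l \<noteq> 0" using a l by simp
  next
    fix l m assume lm: "l < n" "m < n" "l \<noteq> m"
    consider "l < m" | "m < l" using lm by linarith
    then have "a l \<noteq> a m \<and> a l \<noteq> - a m"
    proof cases
      case 1 then show ?thesis using ne lm by blast
    next
      case 2 then show ?thesis using ne[OF 2 lm(1)] by (metis minus_minus)
    qed
    then show "a l \<noteq> a m" "a l \<noteq> - a m" by auto
  qed
qed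

lemma initial_kuhn_state:
  fixes T :: "('n::finite) tsimplex"
  assumes T: "proper_simplex T" "maubach N L CARD('n) T"
  obtains a p where "\<And>l. CARD('n) \<le> l \<Longrightarrow> a l = 0" "steps_distinct CARD('n) a" "kuhn_state N a CARD('n) T"
    "tag_hull T = kuhn_simplex CARD('n) p 1 CARD('n) a"
proof -
  obtain P where P: "T = P ` {..CARD('n)}" "mgen N CARD('n) L CARD('n) (\<lambda>i. snd (P i))"
    using T(2) unfolding maubach_def by blast
  define p where "p i = fst (P i)" for i
  define a where "a l = (if l < CARD('n) then p (Suc l) - p l else 0)" for l
  have im: "fst ` T = p ` {..CARD('n)}" unfolding P(1) p_def by (simp add: image_image)
  have "inj_on (fst \<circ> P) {..CARD('n)}"
    by (rule comp_inj_on[OF mgen_inj_vert[OF P(2)]]) (use T(1) P(1) in \<open>simp add: proper_simplex_def\<close>)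
  then have inj: "inj_on p {..CARD('n)}" by (simp add: p_def[abs_def] comp_def)
  have sd: "steps_distinct CARD('n) a"
    by (rule steps_distinct_simplex[OF inj]) (use T(1) im in \<open>auto simp: proper_simplex_def a_def\<close>)
  have tel: "(\<Sum>l<i. a l) = p i - p 0" if "i \<le> CARD('n)" for i
    using that by (induction i) (auto simp: a_def)
  have pt: "p i = p 0 + 1 *\<^sub>R kuhn_pt CARD('n) a i" if "i \<le> CARD('n)" for i
    using tel[OF that] that by (simp add: kuhn_pt_def)
  have ks: "kuhn_state N a CARD('n) T" unfolding kuhn_state_def
    using P signed_perms_self[of a "CARD('n)"] pt unfolding p_def by (metis zero_less_one)
  have "fst ` T = (\<lambda>i. p 0 + 1 *\<^sub>R kuhn_pt CARD('n) a i) ` {..CARD('n)}"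
    unfolding im by (rule image_cong[OF refl], rule pt) simp
  then have "tag_hull T = kuhn_simplex CARD('n) (p 0) 1 CARD('n) a" by (simp add: kuhn_simplex_def)
  then show ?thesis by (intro that[OF _ sd ks]) (simp_all add: a_def)
qed

lemma similar_scaled:
  fixes K :: "(real^'n) set"
  assumes "h > 0" "\<bar>s\<bar> = 1"
  shows "similar ((\<lambda>x. b + h *\<^sub>R x) ` K) ((\<lambda>x. t + s *\<^sub>R x) ` K)"
proof -
  let ?f = "\<lambda>y. t + (s / h) *\<^sub>R (y - b)"
  have "dist (?f x) (?f y) = (1 / h) * dist x y" for x y
  proof -
    have "?f x - ?f y = (s / h) *\<^sub>R (x - y)" by (simp add: algebra_simps)
    then show ?thesis using assms by (simp add: dist_norm)
  qed
  moreover have "?f ` (\<lambda>x. b + h *\<^sub>R x) ` K = (\<lambda>x. t + s *\<^sub>R x) ` K"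
    using assms by (simp add: image_image)
  ultimately show ?thesis unfolding similar_def using assms(1)
    by (intro exI[of _ ?f] exI[of _ "1 / h"]) simp
qed

lemma similar_flat_class:
  fixes d :: "nat \<Rightarrow> real^'n"
  assumes h: "h > 0" and B: "B \<in> flat_class (kuhn_pt k d ` {..n})"
  shows "similar (kuhn_simplex n b h k d) (convex hull B)"
proof -
  let ?V = "kuhn_pt k d ` {..n}"
  have e: "kuhn_simplex n b h k d = (\<lambda>x. b + h *\<^sub>R x) ` (convex hull ?V)"
    unfolding kuhn_simplex_def convex_hull_affinity[symmetric] by (simp add: image_image)
  obtain t where t: "B = (\<lambda>x. t + x) ` ?V \<or> B = (\<lambda>x. t - x) ` ?V" using B unfolding flat_class_def by blast
  have "\<exists>s. \<bar>s\<bar> = 1 \<and> convex hull B = (\<lambda>x. t + s *\<^sub>R x) ` (convex hull ?V)"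
    using t
  proof
    assume "B = (\<lambda>x. t + x) ` ?V"
    then show ?thesis unfolding convex_hull_affinity[symmetric] by (intro exI[of _ 1]) simp
  next
    assume "B = (\<lambda>x. t - x) ` ?V"
    then show ?thesis unfolding convex_hull_affinity[symmetric] by (intro exI[of _ "-1"]) simp
  qed
  then show ?thesis unfolding e using similar_scaled[OF h] by auto
qed

text \<open>Each of the \<open>n\<close> values of \<open>k\<close> contributes the bound of
  \<open>card_flat_classes\<close>. One arbitrary member of each flat class serves as
  representative, since scaling and the base point are absorbed by similarity.\<close>

lemma finite_similarity_classes:
  fixes a :: "nat \<Rightarrow> real^'n::finite"
  assumes n: "2 \<le> n" and a: "\<And>l. n \<le> l \<Longrightarrow> a l = 0" "steps_distinct n a"
  shows "\<exists>R. finite R \<and> card R \<le> fact n * n * 2 ^ (n - 2) \<and>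
    (\<forall>k b h d. 1 \<le> k \<longrightarrow> k \<le> n \<longrightarrow> 0 < h \<longrightarrow> d \<in> signed_perms n a \<longrightarrow>
      (\<exists>S\<in>R. similar (kuhn_simplex n b h k d) S))"
proof -
  define cl where "cl k = (\<lambda>d. flat_class (kuhn_pt k d ` {..n})) ` signed_perms n a" for k
  define rep where "rep c = convex hull (SOME A. A \<in> c)" for c :: "(real^'n) set set"
  define R where "R = (\<Union>k\<in>{1..n}. rep ` cl k)"
  have fin: "finite (cl k)" for k unfolding cl_def by (intro finite_imageI finite_signed_perms)
  have "card R \<le> (\<Sum>k\<in>{1..n}. card (rep ` cl k))" unfolding R_def by (rule card_UN_le) simp
  also have "\<dots> \<le> (\<Sum>k\<in>{1..n}. fact n * 2 ^ (n - 2))"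
  proof (rule sum_mono)
    fix k assume "k \<in> {1..n}"
    then have "card (cl k) \<le> fact n * 2 ^ (n - 2)" unfolding cl_def using card_flat_classes[OF n a] by simp
    then show "card (rep ` cl k) \<le> fact n * 2 ^ (n - 2)" using card_image_le[OF fin[of k], of rep] by linarith
  qed
  finally have c: "card R \<le> fact n * n * 2 ^ (n - 2)" by (simp add: algebra_simps)
  have "\<exists>S\<in>R. similar (kuhn_simplex n b h k d) S"
    if "1 \<le> k" "k \<le> n" "0 < h" "d \<in> signed_perms n a" for k b h d
  proof -
    let ?c = "flat_class (kuhn_pt k d ` {..n})"
    have "(SOME A. A \<in> ?c) \<in> ?c" using flat_class_self by (rule someI)
    then have "similar (kuhn_simplex n b h k d) (rep ?c)" unfolding rep_def by (rule similar_flat_class[OF that(3)])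
    moreover have "?c \<in> cl k" unfolding cl_def using that(4) by (rule imageI)
    then have "rep ?c \<in> R" unfolding R_def using that(1,2) by auto
    ultimately show ?thesis by blast
  qed
  moreover have "finite R" unfolding R_def using fin by auto
  ultimately show ?thesis using c by blast
qed

text \<open>Colors below \<open>N\<close> give generations of level \<open>0\<close>, while color
  \<open>N\<close> gives a lower level. So the vertex of color \<open>N\<close>, if there is one,
  becomes vertex \<open>0\<close>, and otherwise the youngest vertex does; the others follow by
  increasing color, that is, decreasing generation.\<close>

lemma init_tag_maubach:
  fixes S :: "(real^'n::finite) set"
  assumes S: "finite S" "card S = CARD('n) + 1" and c: "\<forall>v\<in>S. c v \<le> N" "inj_on c S"
  shows "maubach N 0 CARD('n) (init_tag c S)"
proof -
  let ?n = "CARD('n)"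
  define xs where "xs = sorted_list_of_set (c ` S - {N})"
  define ys where "ys = (if N \<in> c ` S then N # xs else xs)"
  have fin: "finite (c ` S - {N})" using S by simp
  have xs: "set xs = c ` S - {N}" "sorted_wrt (<) xs" unfolding xs_def using fin by auto
  have ys: "set ys = c ` S" unfolding ys_def using xs by auto
  have "distinct ys" unfolding ys_def using xs by (auto simp: xs_def)
  then have len: "length ys = ?n + 1" using distinct_card[of ys] ys card_image[OF c(2)] S by simp
  have lt: "x < N" if "x \<in> set xs" for x using that xs(1) c(1) by force
  define P where "P i = (inv_into S c (ys ! i), - int (ys ! i))" for i
  have "P ` {..?n} = (\<lambda>x. (inv_into S c x, - int x)) ` ((!) ys ` {..<length ys})"
    unfolding P_def len by (auto simp: lessThan_Suc_atMost[symmetric] image_image)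
  also have "(!) ys ` {..<length ys} = c ` S" using ys by (metis list.set_map map_nth set_upt atLeast0LessThan)
  also have "(\<lambda>x. (inv_into S c x, - int x)) ` c ` S = init_tag c S"
    unfolding init_tag_def image_image by (rule image_cong) (use c(2) in auto)
  finally have im: "init_tag c S = P ` {..?n}" by simp
  have tail: "ys ! i < N" if "1 \<le> i" "i \<le> ?n" for i
  proof -
    have "ys ! i \<in> set xs" using that len unfolding ys_def by (cases i) (auto split: if_splits)
    then show ?thesis by (rule lt)
  qed
  have mono: "ys ! i < ys ! j" if "1 \<le> i" "i < j" "j \<le> ?n" for i j
    using that len sorted_wrt_nth_less[OF xs(2)] unfolding ys_def
    by (cases i; cases j) (auto split: if_splits)
  have zero: "ys ! 0 < ys ! 1" if "ys ! 0 < N"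
  proof -
    have "ys = xs" using that unfolding ys_def by (auto split: if_splits)
    then show ?thesis using sorted_wrt_nth_less[OF xs(2), of 0 1] len by simp
  qed
  have "mgen N ?n 0 ?n (\<lambda>i. snd (P i))"
    unfolding mgen_def P_def using tail mono zero by auto
  then show ?thesis unfolding maubach_def im by blast
qed

section \<open>The lattice of triangulations\<close>

context forest
begin

lemma closed_index:
  assumes "x \<in> BB N R"
  shows "closed_forest (SOME I. closed_forest I \<and> x = leaves I)"
    "x = leaves (SOME I. closed_forest I \<and> x = leaves I)"
proof -
  have "\<exists>I. closed_forest I \<and> x = leaves I" using assms unfolding BB_eq by blast
  from someI_ex[OF this] show "closed_forest (SOME I. closed_forest I \<and> x = leaves I)"
    "x = leaves (SOME I. closed_forest I \<and> x = leaves I)" by auto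
qed

lemma closed_index_leaves:
  assumes "closed_forest I"
  shows "(SOME J. closed_forest J \<and> leaves I = leaves J) = I"
  by (rule some_equality) (use assms leaves_inj in blast)+

lemma BB_distributive_lattice:
  defines "le \<equiv> (\<lambda>\<T>1 \<T>2. refines N \<T>2 \<T>1)"
  shows "(\<forall>x\<in>BB N R. le x x) \<and>
    (\<forall>x\<in>BB N R. \<forall>y\<in>BB N R. le x y \<and> le y x \<longrightarrow> x = y) \<and>
    (\<forall>x\<in>BB N R. \<forall>y\<in>BB N R. \<forall>z\<in>BB N R. le x y \<and> le y z \<longrightarrow> le x z) \<and>
    (\<exists>join meet. \<forall>x\<in>BB N R. \<forall>y\<in>BB N R.
      join x y \<in> BB N R \<and> le x (join x y) \<and> le y (join x y) \<and>
      (\<forall>z\<in>BB N R. le x z \<and> le y z \<longrightarrow> le (join x y) z) \<and>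
      meet x y \<in> BB N R \<and> le (meet x y) x \<and> le (meet x y) y \<and>
      (\<forall>z\<in>BB N R. le z x \<and> le z y \<longrightarrow> le z (meet x y)) \<and>
      (\<forall>z\<in>BB N R. meet x (join y z) = join (meet x y) (meet x z)))"
proof -
  define f where "f x = (SOME I. closed_forest I \<and> x = leaves I)" for x
  have f: "closed_forest (f x)" "leaves (f x) = x" if "x \<in> BB N R" for x
    using closed_index[OF that] unfolding f_def by auto
  have fl: "f (leaves I) = I" if "closed_forest I" for I
    using closed_index_leaves[OF that] unfolding f_def by simp
  have B: "leaves I \<in> BB N R" if "closed_forest I" for I using closed_in_BB that by blast
  have le: "le x y \<longleftrightarrow> f x \<subseteq> f y" if "x \<in> BB N R" "y \<in> BB N R" for x y
    using refines_iff[OF f(1)[OF that(1)] f(1)[OF that(2)]] f(2) that unfolding le_def by simp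
  define join where "join x y = leaves (f x \<union> f y)" for x y
  define meet where "meet x y = leaves (f x \<inter> f y)" for x y
  have j: "join x y \<in> BB N R" "f (join x y) = f x \<union> f y" if "x \<in> BB N R" "y \<in> BB N R" for x y
    using closed_Un[OF f(1)[OF that(1)] f(1)[OF that(2)]] B fl unfolding join_def by auto
  have m: "meet x y \<in> BB N R" "f (meet x y) = f x \<inter> f y" if "x \<in> BB N R" "y \<in> BB N R" for x y
    using closed_Int[OF f(1)[OF that(1)] f(1)[OF that(2)]] B fl unfolding meet_def by auto
  have eq: "x = y" if "x \<in> BB N R" "y \<in> BB N R" "f x = f y" for x y using f(2) that by metis
  \<comment> \<open>Under \<open>f\<close> this is distributivity of intersection over union of
    closed sets.\<close>
  have "meet x (join y z) = join (meet x y) (meet x z)"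
    if "x \<in> BB N R" "y \<in> BB N R" "z \<in> BB N R" for x y z
    by (rule eq) (use that j m in auto)
  then have "\<forall>x\<in>BB N R. \<forall>y\<in>BB N R.
      join x y \<in> BB N R \<and> le x (join x y) \<and> le y (join x y) \<and>
      (\<forall>z\<in>BB N R. le x z \<and> le y z \<longrightarrow> le (join x y) z) \<and>
      meet x y \<in> BB N R \<and> le (meet x y) x \<and> le (meet x y) y \<and>
      (\<forall>z\<in>BB N R. le z x \<and> le z y \<longrightarrow> le z (meet x y)) \<and>
      (\<forall>z\<in>BB N R. meet x (join y z) = join (meet x y) (meet x z))"
    using le j m by auto
  moreover have "\<forall>x\<in>BB N R. \<forall>y\<in>BB N R. le x y \<and> le y x \<longrightarrow> x = y" using le eq by blast
  moreover have "\<forall>x\<in>BB N R. \<forall>y\<in>BB N R. \<forall>z\<in>BB N R. le x y \<and> le y z \<longrightarrow> le x z" using le by blast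
  moreover have "\<forall>x\<in>BB N R. le x x" using le by blast
  ultimately show ?thesis by blast
qed

end

lemma descendants_shape:
  fixes T0 :: "('n::finite) tsimplex"
  assumes n: "2 \<le> CARD('n)" and N: "N > 0" and T0: "proper_simplex T0" "maubach N 0 CARD('n) T0"
  shows "\<exists>R. finite R \<and> card R \<le> fact CARD('n) * CARD('n) * 2 ^ (CARD('n) - 2) \<and>
      (\<forall>T. descendant N T0 T \<longrightarrow> (\<exists>S\<in>R. similar (tag_hull T) S))"
    and "descendant N T0 T \<Longrightarrow> shape_gamma (tag_hull T)
      \<le> 2 * real CARD('n) * (real CARD('n) + sqrt 2 - 1) * shape_gamma (tag_hull T0)"
proof -
  obtain a p where a: "\<And>l. CARD('n) \<le> l \<Longrightarrow> a l = 0" "steps_distinct CARD('n) a" "kuhn_state N a CARD('n) T0"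
    "tag_hull T0 = kuhn_simplex CARD('n) p 1 CARD('n) a"
    using initial_kuhn_state[OF T0] by blast
  have desc: "\<exists>k. kuhn_state N a k T" if "descendant N T0 T" for T
    by (rule kuhn_state_descendant[of N a, OF N a(1,3) that])
  obtain R where R: "finite R" "card R \<le> fact CARD('n) * CARD('n) * 2 ^ (CARD('n) - 2)"
    "\<forall>k b h d. 1 \<le> k \<longrightarrow> k \<le> CARD('n) \<longrightarrow> 0 < h \<longrightarrow> d \<in> signed_perms CARD('n) a \<longrightarrow>
      (\<exists>S\<in>R. similar (kuhn_simplex CARD('n) b h k d) S)"
    using finite_similarity_classes[of "CARD('n)" a, OF n a(1,2)] by blast
  have "\<exists>S\<in>R. similar (tag_hull T) S" if T: "descendant N T0 T" for T
  proof -
    obtain k where "kuhn_state N a k T" using desc[OF T] by blast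
    then obtain b h d where "h > 0" "d \<in> signed_perms CARD('n) a" "1 \<le> k" "k \<le> CARD('n)"
      "tag_hull T = kuhn_simplex CARD('n) b h k d" by (rule kuhn_state_hull)
    then show ?thesis using R(3) by simp
  qed
  then show "\<exists>R. finite R \<and> card R \<le> fact CARD('n) * CARD('n) * 2 ^ (CARD('n) - 2) \<and>
      (\<forall>T. descendant N T0 T \<longrightarrow> (\<exists>S\<in>R. similar (tag_hull T) S))" using R(1,2) by blast
  assume T: "descendant N T0 T"
  obtain k where "kuhn_state N a k T" using desc[OF T] by blast
  then obtain b h d where d: "h > 0" "d \<in> signed_perms CARD('n) a" "1 \<le> k" "k \<le> CARD('n)"
    "tag_hull T = kuhn_simplex CARD('n) b h k d" by (rule kuhn_state_hull)
  have "card (fst ` T0) = Suc (DIM(real^'n))" "\<not> affine_dependent (fst ` T0)"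
    using T0(1) unfolding proper_simplex_def by (auto simp: card_image)
  then have "interior (tag_hull T0) \<noteq> {}" using interior_convex_hull_eq_empty by blast
  then show "shape_gamma (tag_hull T)
      \<le> 2 * real CARD('n) * (real CARD('n) + sqrt 2 - 1) * shape_gamma (tag_hull T0)"
    unfolding d(5) a(4) by (rule shape_gamma_kuhn_simplex[OF d(2,1,3,4)])
qed

text \<open>The color depends on the point alone, so a vertex shared by two initial simplices has
  the same generation in both, and conformity carries over to tagged vertices.\<close>

lemma init_tag_face:
  fixes S S' :: "(real^'n::finite) set"
  assumes tri: "conforming_triangulation \<T>0" "S \<in> \<T>0" "S' \<in> \<T>0"
  shows "face_to_face (init_tag c S) (init_tag c S')"
proof -
  have f: "fst ` init_tag c A = A" for A by (force simp: init_tag_def)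
  have i: "init_tag c S \<inter> init_tag c S' = init_tag c (S \<inter> S')" by (auto simp: init_tag_def)
  have "convex hull S \<inter> convex hull S' \<subseteq> convex hull (S \<inter> S')"
  proof (cases "convex hull S \<inter> convex hull S' = {}")
    case False
    have "\<forall>S\<in>\<T>0. \<forall>S'\<in>\<T>0. convex hull S \<inter> convex hull S' = {} \<or>
        (\<exists>W. W \<noteq> {} \<and> W \<subseteq> S \<inter> S' \<and> convex hull S \<inter> convex hull S' = convex hull W)"
      using tri(1) unfolding conforming_triangulation_def by (elim conjE)
    then obtain W where W: "W \<subseteq> S \<inter> S'" "convex hull S \<inter> convex hull S' = convex hull W"
      using tri(2,3) False by meson
    show ?thesis unfolding W(2) by (rule hull_mono[OF W(1)])
  qed simp
  then show ?thesis unfolding face_to_face_def i f .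
qed

theorem theorem3p11:
  fixes \<T>0 :: "(real^'n) set set" and c :: "real^'n \<Rightarrow> nat" and N :: nat
  assumes n2: "CARD('n) \<ge> 2"
    and Nn: "N \<ge> CARD('n)"
    and tri: "conforming_triangulation \<T>0"
    and col_range: "\<forall>S\<in>\<T>0. \<forall>v\<in>S. c v \<le> N"
    and col_inj: "\<forall>S\<in>\<T>0. inj_on c S"
  shows
    "(\<forall>\<T>\<in>BB N (init_tag c ` \<T>0). \<forall>T\<in>\<T>. refine_terminates N \<T> T)
   \<and> (\<forall>T0\<in>\<T>0.
        (\<exists>R. finite R \<and> card R \<le> fact CARD('n) * CARD('n) * 2 ^ (CARD('n) - 2) \<and>
             (\<forall>T\<in>TT N (init_tag c ` \<T>0). descendant N (init_tag c T0) T \<longrightarrow>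
                (\<exists>S\<in>R. similar (convex hull (fst ` T)) S))) \<and>
        (\<forall>T\<in>TT N (init_tag c ` \<T>0). descendant N (init_tag c T0) T \<longrightarrow>
            shape_gamma (convex hull (fst ` T))
              \<le> 2 * real CARD('n) * (real CARD('n) + sqrt 2 - 1) * shape_gamma (convex hull T0)))
   \<and> (\<forall>k. conforming_triangulation (geom ((bisect_all N ^^ (CARD('n) * k)) (init_tag c ` \<T>0))))
   \<and> (let B = BB N (init_tag c ` \<T>0); le = (\<lambda>\<T>1 \<T>2. refines N \<T>2 \<T>1) in
        (\<forall>x\<in>B. le x x) \<and>
        (\<forall>x\<in>B. \<forall>y\<in>B. le x y \<and> le y x \<longrightarrow> x = y) \<and>
        (\<forall>x\<in>B. \<forall>y\<in>B. \<forall>z\<in>B. le x y \<and> le y z \<longrightarrow> le x z) \<and>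
        (\<exists>join meet. \<forall>x\<in>B. \<forall>y\<in>B.
            join x y \<in> B \<and> le x (join x y) \<and> le y (join x y) \<and>
            (\<forall>z\<in>B. le x z \<and> le y z \<longrightarrow> le (join x y) z) \<and>
            meet x y \<in> B \<and> le (meet x y) x \<and> le (meet x y) y \<and>
            (\<forall>z\<in>B. le z x \<and> le z y \<longrightarrow> le z (meet x y)) \<and>
            (\<forall>z\<in>B. meet x (join y z) = join (meet x y) (meet x z))))"
proof -
  let ?R = "init_tag c ` \<T>0"
  have N: "N > 0" using Nn n2 by linarith
  have S: "finite S" "card S = CARD('n) + 1" "\<not> affine_dependent S" if "S \<in> \<T>0" for S
    using tri that unfolding conforming_triangulation_def by auto
  have f: "fst ` init_tag c A = A" for A by (force simp: init_tag_def)
  have inj: "inj_on fst (init_tag c A)" for A by (auto simp: init_tag_def inj_on_def)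
  have proper: "proper_simplex (init_tag c S)" if "S \<in> \<T>0" for S
  proof -
    have "card (init_tag c S) = card S" using card_image[OF inj[of S]] by (simp add: f)
    moreover have "finite (init_tag c S)" using S(1)[OF that] by (simp add: init_tag_def)
    ultimately show ?thesis unfolding proper_simplex_def f using S[OF that] inj[of S] by simp
  qed
  have mau: "maubach N 0 CARD('n) (init_tag c S)" if "S \<in> \<T>0" for S
    using init_tag_maubach[OF S(1,2)[OF that]] col_range col_inj that by blast
  interpret forest N ?R
  proof
    show "finite ?R" using tri unfolding conforming_triangulation_def by simp
    show "face_to_face T T'" if "T \<in> ?R" "T' \<in> ?R" for T T'
      using that init_tag_face[OF tri] by blast
  qed (use N proper mau in auto)
  have i: "\<forall>\<T>\<in>BB N ?R. \<forall>T\<in>\<T>. refine_terminates N \<T> T"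
  proof (intro ballI)
    fix \<T> T assume \<T>: "\<T> \<in> BB N ?R" "T \<in> \<T>"
    obtain I where I: "closed_forest I" "\<T> = leaves I" using \<T>(1) unfolding BB_eq by blast
    then have "T \<in> FT" using closed_forestD(2)[OF I(1)] leaves_FT \<T>(2) by blast
    then show "refine_terminates N \<T> T" unfolding I(2) by (rule refine_terminates_leaves[OF _ I(1)])
  qed
  have ii: "\<forall>T0\<in>\<T>0.
        (\<exists>R. finite R \<and> card R \<le> fact CARD('n) * CARD('n) * 2 ^ (CARD('n) - 2) \<and>
             (\<forall>T\<in>TT N ?R. descendant N (init_tag c T0) T \<longrightarrow>
                (\<exists>S\<in>R. similar (convex hull (fst ` T)) S))) \<and>
        (\<forall>T\<in>TT N ?R. descendant N (init_tag c T0) T \<longrightarrow>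
            shape_gamma (convex hull (fst ` T))
              \<le> 2 * real CARD('n) * (real CARD('n) + sqrt 2 - 1) * shape_gamma (convex hull T0))"
  proof
    fix T0 assume T0: "T0 \<in> \<T>0"
    note d = descendants_shape[OF n2 N proper[OF T0] mau[OF T0], unfolded f]
    obtain R where R: "finite R" "card R \<le> fact CARD('n) * CARD('n) * 2 ^ (CARD('n) - 2)"
      "\<forall>T. descendant N (init_tag c T0) T \<longrightarrow> (\<exists>S\<in>R. similar (tag_hull T) S)" using d(1) by blast
    show "(\<exists>R. finite R \<and> card R \<le> fact CARD('n) * CARD('n) * 2 ^ (CARD('n) - 2) \<and>
             (\<forall>T\<in>TT N ?R. descendant N (init_tag c T0) T \<longrightarrow>
                (\<exists>S\<in>R. similar (convex hull (fst ` T)) S))) \<and>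
        (\<forall>T\<in>TT N ?R. descendant N (init_tag c T0) T \<longrightarrow>
            shape_gamma (convex hull (fst ` T))
              \<le> 2 * real CARD('n) * (real CARD('n) + sqrt 2 - 1) * shape_gamma (convex hull T0))"
      by (intro conjI exI[of _ R] ballI impI R(1,2) R(3)[rule_format] d(2)) assumption+
  qed
  have iii: "\<forall>k. conforming_triangulation (geom ((bisect_all N ^^ (CARD('n) * k)) ?R))"
    by (intro allI conforming_uniform[OF bisect_all_uniform finite_bisect_all]) simp
  show ?thesis unfolding Let_def
    by (rule conjI[OF i conjI[OF ii conjI[OF iii BB_distributive_lattice]]])
qed

end
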